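(* Let $\Omega\subset\mathbb{R}^2$ be a bounded smooth annular domain with interior boundary $\gamma_I$ and external boundary $\gamma_E$. Suppose that $\psi\in C^1(\overline{\Omega})$, that $H$ is a given real constant with $$\min_{\gamma_E}\psi<H<\max_{\gamma_E}\psi,$$ and that $\psi$ has $N$ local maximal points on $\gamma_E$. Let $u$ be a non-constant solution of the boundary value problem $$\sum_{i,j=1}^{2}a_{ij}(\nabla u)\frac{\partial^2 u}{\partial x_i\partial x_j}=0\ \text{ in }\Omega,\qquad u|_{\gamma_I}=H,\quad u|_{\gamma_E}=\psi.$$ Then $u$ has finitely many interior critical points $x_1,\dots,x_k$ in $\Omega$, and $$\sum_{i=1}^{k}m_i\le N,$$ where $m_1,\dots,m_k$ are the multiplicities of the critical points $x_1,\dots,x_k$ respectively.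
   Context: An annular domain is a bounded planar domain whose boundary consists of two disjoint simple closed curves, the interior one $\gamma_I$ and the external one $\gamma_E$. The coefficients $a_{ij}$ are smooth functions of $\nabla u$ and the operator $L$, $Lu=\sum_{i,j=1}^2 a_{ij}(\nabla u)u_{x_ix_j}$, is uniformly elliptic in $\Omega$ (there are constants $0<\lambda\le\Lambda$ with $\lambda|\xi|^2\le\sum_{i,j}a_{ij}(\nabla u(x))\xi_i\xi_j\le\Lambda|\xi|^2$ for all $x\in\Omega$, $\xi\in\mathbb{R}^2$). "Solution" means a classical solution attaining its boundary values continuously. Local maximal points on $\gamma_E$ are those of the restriction $\psi|_{\gamma_E}$. An interior critical point is a point $x_0\in\Omega$ with $\nabla u(x_0)=0$; its multiplicity is the integer $m\ge1$ such that, in a neighborhood of $x_0$, the level set $\{x\in\Omega:u(x)=u(x_0)\}$ consists of $m+1$ simple arcs intersecting at $x_0$ (as given by the Hartman–Wintner theorem). An empty sum is $0$. *)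

theory Defs
  imports "HOL-Analysis.Analysis"
begin

text \<open>Classes \<open>C\<^sup>k\<close> and \<open>C\<^sup>\<infinity>\<close>, meant for open sets \<open>S\<close>.\<close>

primrec Ck_on :: "nat \<Rightarrow> ('a::euclidean_space \<Rightarrow> 'b::real_normed_vector) \<Rightarrow> 'a set \<Rightarrow> bool" where
  "Ck_on 0 f S \<longleftrightarrow> continuous_on S f"
| "Ck_on (Suc k) f S \<longleftrightarrow>
     (\<forall>x\<in>S. f differentiable (at x)) \<and>
     (\<forall>b\<in>Basis. Ck_on k (\<lambda>x. frechet_derivative f (at x) b) S)"

definition smooth_on :: "('a::euclidean_space \<Rightarrow> 'b::real_normed_vector) \<Rightarrow> 'a set \<Rightarrow> bool" where
  "smooth_on f S \<longleftrightarrow> (\<forall>k. Ck_on k f S)"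

text \<open>For open \<open>\<Omega>\<close>, the class \<open>C\<^sup>1\<close> on the closure: both \<open>f\<close> and its gradient on \<open>\<Omega>\<close>
  extend continuously to the closure (\<open>G\<close> is the extended gradient).\<close>

definition C1_closure :: "('a::euclidean_space \<Rightarrow> real) \<Rightarrow> 'a set \<Rightarrow> bool" where
  "C1_closure f \<Omega> \<longleftrightarrow>
     continuous_on (closure \<Omega>) f \<and>
     (\<exists>G. continuous_on (closure \<Omega>) G \<and>
          (\<forall>x\<in>\<Omega>. (f has_derivative (\<lambda>h. G x \<bullet> h)) (at x)))"

definition partial_deriv :: "'n::finite \<Rightarrow> (real^'n \<Rightarrow> real) \<Rightarrow> real^'n \<Rightarrow> real" where
  "partial_deriv i f x = frechet_derivative f (at x) (axis i 1)"

definition grad :: "(real^'n::finite \<Rightarrow> real) \<Rightarrow> real^'n \<Rightarrow> real^'n" where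
  "grad f x = (\<chi> i. partial_deriv i f x)"

text \<open>The parametrization is regular and \<open>1\<close>-periodic on the whole line, so that the curve is
  smooth also at its base point.\<close>

definition smooth_simple_closed_curve :: "(real^2) set \<Rightarrow> bool" where
  "smooth_simple_closed_curve \<Gamma> \<longleftrightarrow>
     (\<exists>g. simple_path g \<and> pathfinish g = pathstart g \<and> path_image g = \<Gamma> \<and>
          (\<forall>t. g (t + 1) = g t) \<and> smooth_on g UNIV \<and>
          (\<forall>t. vector_derivative g (at t) \<noteq> 0))"

definition smooth_annular_domain :: "(real^2) set \<Rightarrow> (real^2) set \<Rightarrow> (real^2) set \<Rightarrow> bool" where
  "smooth_annular_domain \<Omega> \<gamma>\<^sub>I \<gamma>\<^sub>E \<longleftrightarrow>
     open \<Omega> \<and> connected \<Omega> \<and> bounded \<Omega> \<and>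
     smooth_simple_closed_curve \<gamma>\<^sub>I \<and> smooth_simple_closed_curve \<gamma>\<^sub>E \<and>
     \<gamma>\<^sub>I \<inter> \<gamma>\<^sub>E = {} \<and> frontier \<Omega> = \<gamma>\<^sub>I \<union> \<gamma>\<^sub>E \<and> \<gamma>\<^sub>I \<subseteq> inside \<gamma>\<^sub>E"

definition local_max_points :: "('a::topological_space \<Rightarrow> real) \<Rightarrow> 'a set \<Rightarrow> 'a set" where
  "local_max_points \<psi> \<Gamma> = {p \<in> \<Gamma>. \<forall>\<^sub>F y in at p within \<Gamma>. \<psi> y \<le> \<psi> p}"

definition critical_points :: "(real^2 \<Rightarrow> real) \<Rightarrow> (real^2) set \<Rightarrow> (real^2) set" where
  "critical_points u \<Omega> = {x \<in> \<Omega>. grad u x = 0}"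

text \<open>The \<open>m + 1\<close> arcs pass through \<open>x0\<close> (it is not an end point of any of them) and meet
  nowhere else, so \<open>2 (m + 1)\<close> branches of the level set emanate from \<open>x0\<close> and \<open>m\<close> does not
  depend on the choice of the neighbourhood \<open>U\<close> and of the arcs.\<close>

definition has_multiplicity :: "(real^2 \<Rightarrow> real) \<Rightarrow> (real^2) set \<Rightarrow> real^2 \<Rightarrow> nat \<Rightarrow> bool" where
  "has_multiplicity u \<Omega> x0 m \<longleftrightarrow>
     1 \<le> m \<and>
     (\<exists>U g. x0 \<in> interior U \<and>
        {x \<in> \<Omega> \<inter> U. u x = u x0} = (\<Union>i\<le>m. path_image (g i)) \<and>
        (\<forall>i\<le>m. arc (g i) \<and> x0 \<in> path_image (g i) - {pathstart (g i), pathfinish (g i)}) \<and>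
        (\<forall>i\<le>m. \<forall>j\<le>m. i \<noteq> j \<longrightarrow> path_image (g i) \<inter> path_image (g j) = {x0}))"

definition multiplicity_at :: "(real^2 \<Rightarrow> real) \<Rightarrow> (real^2) set \<Rightarrow> real^2 \<Rightarrow> nat" where
  "multiplicity_at u \<Omega> x0 = (THE m. has_multiplicity u \<Omega> x0 m)"

end

theory Submission
  imports Defs "HOL-Analysis.Analysis"
begin

text \<open>
  At a critical point normalise \<open>a(0)\<close> to the identity by a linear change of variables. Then
  \<open>f = U_x - i U_y\<close> satisfies \<open>|dbar f| \<le> C |f|\<close>. The Fourier coefficients of \<open>f\<close> on circles, divided by
  the matching power of the radius, have a radial derivative involving only \<open>dbar f\<close>. Hence \<open>f\<close> vanishes near
  the point if it vanishes there to infinite order, and otherwise \<open>f = c z^m + o(|z|^m)\<close>. So \<open>u\<close>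
  is a perturbation of \<open>Re z^n\<close> with \<open>n = m + 1\<close>, the level set consists of \<open>2 n\<close> rays, that is \<open>m + 1\<close>
  arcs, and \<open>u\<close> has no interior extrema.

  To count, fill the hole with the value \<open>H\<close>. Every component of a superlevel set \<open>{w > c}\<close> either contains
  a local maximum of the boundary values in its closure or contains the hole. A saddle of order \<open>n\<close> joins \<open>n\<close> such
  components as \<open>c\<close> decreases. If the joined components are always different, the saddles are the edges of a
  hypergraph forest on the boundary maxima and the hole, whence \<open>\<Sum>(n - 1) \<le> N + 1 - 1\<close>. If two of them
  agree, they contain a loop surrounding a component of a sublevel set, which contains the hole by the maximum
  principle. This costs one edge, but it happens at most once, and then the hole is not needed as a vertex.
\<close>

section \<open>Fourier coefficients on circles\<close>

text \<open>The solution is only C^2, so \<open>f\<close> is merely C^1, and all its local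
  properties are drawn from an ordinary differential identity in the radius for its circle
  coefficients. Integrating that identity with Cauchy-Schwarz and Bessel produces the integrable
  singularity |r - \<rho>|^(-1/2). This gains half a power of the radius at a time and is the origin
  of all half-integer exponents below. Unique continuation and the maximum principle are read off
  the local normal form. The obstacle in the count is that several saddles may share a level. A
  superlevel set alone does not show whether two ascending sectors of one saddle are joined through
  other saddles of that level, so the labels in the forest argument are path components of the
  superlevel set enlarged by such saddles. Every such junction yields a Jordan curve through the
  saddle on which the function stays at or above the level. Finiteness is not derived from
  isolation, which would leave accumulation at the boundary possible. The counting bound is proved
  for every finite set of critical points, each contributing at least 1.\<close>

definition fcoef :: "(complex \<Rightarrow> complex) \<Rightarrow> int \<Rightarrow> complex" where
  "fcoef g j = integral {0..2*pi} (\<lambda>t. g (cis t) * cis (- (of_int j * t))) / (2*pi)"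

lemma continuous_on_circle:
  assumes "continuous_on (sphere 0 1) g"
  shows "continuous_on A (\<lambda>t. g (cis t) :: complex)"
  by (rule continuous_on_compose2[OF assms]) (auto intro!: continuous_intros)

lemma continuous_on_circle_coef:
  assumes "continuous_on (sphere 0 1) g"
  shows "continuous_on A (\<lambda>t. g (cis t) * cis (- (of_int j * t)) :: complex)"
  by (intro continuous_intros continuous_on_circle assms)

lemma integrable_circle:
  assumes "continuous_on (sphere 0 1) g"
  shows "(\<lambda>t. g (cis t) * cis (- (of_int j * t)) :: complex) integrable_on {0..2*pi}"
  by (intro integrable_continuous_real continuous_on_circle_coef assms)

lemma fcoef_bound:
  assumes "continuous_on (sphere 0 1) g" and "\<And>z. norm z = 1 \<Longrightarrow> norm (g z) \<le> B"
  shows "norm (fcoef g j) \<le> B"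
proof -
  have "norm (integral (cbox 0 (2*pi)) (\<lambda>t. g (cis t) * cis (- (of_int j * t)))) \<le> B * measure lborel (cbox 0 (2*pi))"
  proof (rule integrable_bound)
    have "norm (g 1) \<le> B" using assms(2)[of 1] by simp
    thus "0 \<le> B" using norm_ge_zero order_trans by blast
    show "(\<lambda>t. g (cis t) * cis (- (of_int j * t))) integrable_on cbox 0 (2*pi)"
      using integrable_circle[OF assms(1)] by simp
    show "norm (g (cis t) * cis (- (of_int j * t))) \<le> B" if "t \<in> cbox 0 (2*pi)" for t
      using assms(2)[of "cis t"] by (simp add: norm_mult)
  qed
  thus ?thesis by (simp add: fcoef_def norm_divide divide_simps)
qed

lemma fcoef_diff:
  assumes "continuous_on (sphere 0 1) g" "continuous_on (sphere 0 1) h"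
  shows "fcoef (\<lambda>z. g z - h z) j = fcoef g j - fcoef h j"
  unfolding fcoef_def left_diff_distrib
  by (subst integral_diff) (auto intro!: integrable_circle assms simp: diff_divide_distrib)

lemma fcoef_add:
  assumes "continuous_on (sphere 0 1) g" "continuous_on (sphere 0 1) h"
  shows "fcoef (\<lambda>z. g z + h z) j = fcoef g j + fcoef h j"
  unfolding fcoef_def distrib_right
  by (subst integral_add) (auto intro!: integrable_circle assms simp: add_divide_distrib)

lemma fcoef_cmult: "fcoef (\<lambda>z. c * g z) j = c * fcoef g j"
  unfolding fcoef_def by (simp add: mult.assoc)

lemma fcoef_sum:
  assumes "finite I" "\<And>i. i \<in> I \<Longrightarrow> continuous_on (sphere 0 1) (g i)"
  shows "fcoef (\<lambda>z. \<Sum>i\<in>I. g i z) j = (\<Sum>i\<in>I. fcoef (g i) j)"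
  unfolding fcoef_def sum_distrib_right
  by (subst integral_sum) (auto intro!: integrable_circle assms simp: sum_divide_distrib)

lemma integral_cis_int:
  "integral {0..2*pi} (\<lambda>t. cis (of_int j * t)) = (if j = 0 then 2*pi else 0)"
proof (cases "j = 0")
  case False
  have "((\<lambda>t. cis (of_int j * t)) has_integral
      (cis (of_int j * (2*pi)) / (\<i> * of_int j) - cis (of_int j * 0) / (\<i> * of_int j))) {0..2*pi}"
  proof (rule fundamental_theorem_of_calculus)
    fix x :: real
    have "((\<lambda>t. exp (\<i> * of_real (of_int j * t)) / (\<i> * of_int j)) has_vector_derivative cis (of_int j * x)) (at x within {0..2*pi})"
      using False by (auto intro!: derivative_eq_intros has_vector_derivative_real_field simp: cis_conv_exp mult_ac)
    then show "((\<lambda>t. cis (of_int j * t) / (\<i> * of_int j)) has_vector_derivative cis (of_int j * x)) (at x within {0..2*pi})"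
      by (simp add: cis_conv_exp)
  qed simp
  moreover have "cis (of_int j * (2*pi)) = 1"
    using cis_multiple_2pi[of "of_int j"] by (simp add: mult_ac)
  ultimately show ?thesis using False by (simp add: integral_unique)
qed (simp add: scaleR_conv_of_real)

lemma powi_cis: "(cis t) powi k = cis (of_int k * t)"
  by (simp add: cis_power_int)

lemma fcoef_powi: "fcoef (\<lambda>z. z powi k) j = (if k = j then 1 else 0)"
proof -
  have "fcoef (\<lambda>z. z powi k) j = integral {0..2*pi} (\<lambda>t. cis (of_int (k - j) * t)) / (2*pi)"
    unfolding fcoef_def powi_cis cis_mult by (simp add: algebra_simps)
  thus ?thesis by (simp add: integral_cis_int del: of_int_diff)
qed

lemma continuous_on_sphere_powi: "continuous_on (sphere 0 1) (\<lambda>z::complex. z powi k)"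
  by (intro continuous_intros) auto

lemma fcoef_shift: "fcoef (\<lambda>z. g z * z powi k) j = fcoef g (j - k)"
  unfolding fcoef_def powi_cis mult.assoc cis_mult by (simp add: algebra_simps)

lemma fcoef_norm_square:
  assumes "continuous_on (sphere 0 1) h"
  shows "fcoef (\<lambda>z. h z * cnj (h z)) 0 = of_real (integral {0..2*pi} (\<lambda>t. (norm (h (cis t)))\<^sup>2) / (2*pi))"
proof -
  have "((\<lambda>t. (norm (h (cis t)))\<^sup>2) has_integral integral {0..2*pi} (\<lambda>t. (norm (h (cis t)))\<^sup>2)) {0..2*pi}"
    by (intro integrable_integral integrable_continuous_real continuous_intros continuous_on_circle assms)
  from has_integral_of_real[OF this, where 'b=complex]
  have "((\<lambda>t. h (cis t) * cnj (h (cis t))) has_integral 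
      of_real (integral {0..2*pi} (\<lambda>t. (norm (h (cis t)))\<^sup>2))) {0..2*pi}"
    unfolding complex_norm_square .
  then show ?thesis unfolding fcoef_def by (simp add: integral_unique)
qed

text \<open>Nonnegativity of the mean square of \<open>g - S\<close>, where \<open>S\<close> is the
  orthogonal projection of \<open>g\<close> to the frequencies in \<open>J\<close>. A sup bound
  replaces the mean square of \<open>g\<close>, since only sup bounds are available in the
  applications.\<close>

lemma Bessel:
  assumes g: "continuous_on (sphere 0 1) g" and B: "\<And>z. norm z = 1 \<Longrightarrow> norm (g z) \<le> B"
    and J: "finite J"
  shows "(\<Sum>j\<in>J. (norm (fcoef g j))\<^sup>2) \<le> B\<^sup>2"
proof -
  have B0: "B \<ge> 0" using B[of 1] norm_ge_zero order_trans by (metis norm_one)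
  define S where "S z = (\<Sum>j\<in>J. fcoef g j * z powi j)" for z
  have cS: "continuous_on (sphere 0 1) S"
    unfolding S_def by (intro continuous_intros continuous_on_sphere_powi)
  define Q where "Q = (\<Sum>j\<in>J. (norm (fcoef g j))\<^sup>2)"
  \<comment> \<open>The zeroth coefficient of \<open>h * cnj S\<close> is the inner product of
    \<open>h\<close> with \<open>S\<close>. With \<open>h\<close> equal to \<open>g\<close> and to
    \<open>S\<close> this evaluates the mixed terms of the expanded square.\<close>
  have inner: "fcoef (\<lambda>z. h z * cnj (S z)) 0 = (\<Sum>j\<in>J. cnj (fcoef g j) * fcoef h j)"
    if h: "continuous_on (sphere 0 1) h" for h
  proof -
    have "fcoef (\<lambda>z. h z * cnj (S z)) 0 = fcoef (\<lambda>z. \<Sum>j\<in>J. cnj (fcoef g j) * (h z * z powi (-j))) 0"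
    proof -
      have "(\<lambda>t. h (cis t) * cnj (S (cis t)) * cis (- (real_of_int 0 * t))) = 
          (\<lambda>t. (\<Sum>j\<in>J. cnj (fcoef g j) * (h (cis t) * cis t powi (- j))) * cis (- (real_of_int 0 * t)))"
      proof (rule ext)
        fix t
        have "cnj (cis t powi j) = cis t powi (-j)" for j
          by (simp add: powi_cis cis_cnj)
        then show "h (cis t) * cnj (S (cis t)) * cis (- (real_of_int 0 * t)) = 
          (\<Sum>j\<in>J. cnj (fcoef g j) * (h (cis t) * cis t powi (- j))) * cis (- (real_of_int 0 * t))"
          unfolding S_def by (simp add: sum_distrib_left mult_ac)
      qed
      then show ?thesis unfolding fcoef_def by simp
    qed 
    also have "\<dots> = (\<Sum>j\<in>J. cnj (fcoef g j) * fcoef h j)"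
      by (subst fcoef_sum[OF J]) 
         (auto intro!: continuous_intros h continuous_on_sphere_powi simp: fcoef_cmult fcoef_shift)
    finally show ?thesis .
  qed
  have cnjS: "continuous_on (sphere 0 1) (\<lambda>z. cnj (S z))" "continuous_on (sphere 0 1) (\<lambda>z. cnj (g z))"
    by (intro continuous_intros cS g)+
  have fS: "fcoef S j = fcoef g j" if "j \<in> J" for j
    unfolding S_def using that J
    by (subst fcoef_sum) (auto intro!: continuous_intros continuous_on_sphere_powi simp: fcoef_cmult fcoef_powi if_distrib[of "(*) _"] cong: if_cong)
  have Qc: "(\<Sum>j\<in>J. cnj (fcoef g j) * fcoef g j) = of_real Q"
    unfolding Q_def of_real_sum by (rule sum.cong) (auto simp: complex_norm_square mult.commute simp del: of_real_power)
  have 1: "fcoef (\<lambda>z. g z * cnj (S z)) 0 = of_real Q" using inner[OF g] Qc by simp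
  have 2: "fcoef (\<lambda>z. S z * cnj (S z)) 0 = of_real Q"
    using inner[OF cS] Qc fS by simp
  have conj0: "fcoef (\<lambda>z. cnj (h z)) 0 = cnj (fcoef h 0)" if "continuous_on (sphere 0 1) h" for h
    unfolding fcoef_def by (simp add: integral_cnj)
  have 3: "fcoef (\<lambda>z. S z * cnj (g z)) 0 = of_real Q"
  proof -
    have "fcoef (\<lambda>z. S z * cnj (g z)) 0 = fcoef (\<lambda>z. cnj (g z * cnj (S z))) 0"
      by (simp add: mult.commute)
    also have "\<dots> = cnj (of_real Q)"
      by (subst conj0) (auto intro!: continuous_intros g cS simp: 1 cnjS)
    finally show ?thesis by simp
  qed
  have "fcoef (\<lambda>z. (g z - S z) * cnj (g z - S z)) 0 = 
        fcoef (\<lambda>z. (g z * cnj (g z) - g z * cnj (S z)) - (S z * cnj (g z) - S z * cnj (S z))) 0"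
    by (simp add: algebra_simps)
  also have "\<dots> = fcoef (\<lambda>z. g z * cnj (g z)) 0 - of_real Q"
    by (subst fcoef_diff; (intro continuous_intros g cS cnjS)?)+ (simp add: 1 2 3)
  finally have eq: "Re (fcoef (\<lambda>z. g z * cnj (g z)) 0) - Q = Re (fcoef (\<lambda>z. (g z - S z) * cnj (g z - S z)) 0)"
    by simp
  have nn: "0 \<le> Re (fcoef (\<lambda>z. (g z - S z) * cnj (g z - S z)) 0)"
  proof -
    have "fcoef (\<lambda>z. (g z - S z) * cnj (g z - S z)) 0 = of_real (integral {0..2*pi} (\<lambda>t. (norm (g (cis t) - S (cis t)))\<^sup>2) / (2*pi))"
      by (rule fcoef_norm_square[of "\<lambda>z. g z - S z"]) (intro continuous_intros g cS)
    then show ?thesis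
      by (simp add: integral_nonneg integrable_continuous_real)
        (auto intro!: divide_nonneg_nonneg integral_nonneg integrable_continuous_real continuous_intros continuous_on_circle g cS)
  qed
  have "norm (fcoef (\<lambda>z. g z * cnj (g z)) 0) \<le> B\<^sup>2"
    by (rule fcoef_bound) (auto intro!: continuous_intros g mult_mono B B0 simp: norm_mult power2_eq_square)
  thus ?thesis using eq nn complex_Re_le_cmod[of "fcoef (\<lambda>z. g z * cnj (g z)) 0"] unfolding Q_def by linarith
qed

text \<open>Multiplication by cos t or sin t mixes only coefficients with shifted index, so
  vanishing of all coefficients survives multiplication by any real polynomial. Continuity is
  carried along because the product step of the induction needs it.\<close>

lemma fcoef_mult_real_polynomial:
  assumes "real_polynomial_function p"
  shows "continuous_on (sphere 0 1) (\<lambda>z. of_real (p z) :: complex) \<and>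
     (\<forall>g. continuous_on (sphere 0 1) g \<longrightarrow> (\<forall>j. fcoef g j = 0) \<longrightarrow> 
        (\<forall>j. fcoef (\<lambda>z. g z * of_real (p z)) j = 0))"
  using assms
proof induction
  case (linear f)
  then interpret bounded_linear f .
  have f: "f z = Re z * f 1 + Im z * f \<i>" for z
  proof -
    have "z = Re z *\<^sub>R 1 + Im z *\<^sub>R \<i>" by (simp add: complex_eq_iff)
    then have "f z = f (Re z *\<^sub>R 1 + Im z *\<^sub>R \<i>)" by simp
    then show ?thesis by (simp add: add scaleR)
  qed
  have c: "continuous_on (sphere 0 1) (\<lambda>z. of_real (f z) :: complex)"
    by (intro continuous_intros continuous_on)
  have "fcoef (\<lambda>z. g z * of_real (f z)) j = 0" 
    if g: "continuous_on (sphere 0 1) g" "\<And>j. fcoef g j = 0" for g j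
  proof -
    \<comment> \<open>On the circle a real linear \<open>f\<close> is \<open>f 1\<close> cos t +
      \<open>f \<i>\<close> sin t. These are its coefficients in terms of e^(it) and
      e^(-it).\<close>
    define \<alpha> \<beta> where "\<alpha> = (of_real (f 1) - \<i> * of_real (f \<i>)) / 2"
       and "\<beta> = (of_real (f 1) + \<i> * of_real (f \<i>)) / 2"
    have "of_real (f (cis t)) = \<alpha> * cis t powi 1 + \<beta> * cis t powi (-1)" for t
      unfolding f[of "cis t"] \<alpha>_def \<beta>_def powi_cis by (simp add: complex_eq_iff field_simps)
    then have "fcoef (\<lambda>z. g z * of_real (f z)) j = 
         fcoef (\<lambda>z. \<alpha> * (g z * z powi 1) + \<beta> * (g z * z powi (-1))) j"
      unfolding fcoef_def by (simp add: algebra_simps)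
    also have "\<dots> = 0"
      by (subst fcoef_add, (intro continuous_intros g continuous_on_sphere_powi)+,
          subst (1 2) fcoef_cmult, subst (1 2) fcoef_shift, simp add: g)
    finally show ?thesis .
  qed
  with c show ?case by blast
next
  case (const c)
  show ?case by (simp add: fcoef_cmult mult.commute[of _ "of_real c"])
next
  case (add f g)
  show ?case
  proof (intro conjI allI impI)
    show "continuous_on (sphere 0 1) (\<lambda>z. complex_of_real (f z + g z))"
      unfolding of_real_add using add by (intro continuous_on_add) auto
    fix h j assume h: "continuous_on (sphere 0 1) h" "\<forall>j. fcoef h j = 0"
    have "fcoef (\<lambda>z. h z * of_real (f z + g z)) j = 
        fcoef (\<lambda>z. h z * of_real (f z) + h z * of_real (g z)) j" by (simp add: algebra_simps)
    also have "\<dots> = 0" using add h by (subst fcoef_add) (auto intro!: continuous_on_mult)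
    finally show "fcoef (\<lambda>z. h z * of_real (f z + g z)) j = 0" .
  qed
next
  case (mult f g)
  show ?case
  proof (intro conjI allI impI)
    show "continuous_on (sphere 0 1) (\<lambda>z. complex_of_real (f z * g z))"
      unfolding of_real_mult using mult by (intro continuous_on_mult) auto
    fix h j assume h: "continuous_on (sphere 0 1) h" "\<forall>j. fcoef h j = 0"
    have "continuous_on (sphere 0 1) (\<lambda>z. h z * of_real (f z))"
      using mult h by (intro continuous_on_mult) auto
    then have "fcoef (\<lambda>z. (h z * of_real (f z)) * of_real (g z)) j = 0" using mult h by blast
    then show "fcoef (\<lambda>z. h z * of_real (f z * g z)) j = 0" by (simp add: mult.assoc)
  qed
qed

text \<open>Stone-Weierstrass approximates \<open>cnj G\<close> by a polynomial \<open>g\<close>. As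
  \<open>G * g\<close> has zero mean, the mean of |G|^2 equals that of
  \<open>G * (cnj G - g)\<close>, which is arbitrarily small. A continuous nonnegative function with
  zero mean vanishes.\<close>

lemma fcoef_eq_0_imp_eq_0:
  assumes G: "continuous_on (sphere 0 1) G" and "\<And>j. fcoef G j = 0" and z: "norm z = 1"
  shows "G z = 0"
proof -
  obtain B where B: "\<And>z. norm z = 1 \<Longrightarrow> norm (G z) \<le> B" "B > 0"
  proof -
    have "bounded (G ` sphere 0 1)" 
      by (intro compact_imp_bounded compact_continuous_image G) auto
    then obtain B where "B > 0" "\<forall>x\<in>G ` sphere 0 1. norm x \<le> B" unfolding bounded_pos by blast
    then show ?thesis using that[of B] by auto
  qed
  have cG: "continuous_on (sphere 0 1) (\<lambda>z. cnj (G z))" by (intro continuous_intros G)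
  have small: "norm (fcoef (\<lambda>z. G z * cnj (G z)) 0) \<le> B * e" if e: "e > 0" for e
  proof -
    obtain g where g: "polynomial_function g" "\<And>x. x \<in> sphere 0 1 \<Longrightarrow> norm (cnj (G x) - g x) < e"
      using Stone_Weierstrass_polynomial_function[OF compact_sphere cG e] by blast
    have "real_polynomial_function (\<lambda>z. Re (g z))" "real_polynomial_function (\<lambda>z. Im (g z))"
      using g(1) bounded_linear_Re bounded_linear_Im unfolding polynomial_function_def o_def by blast+
    note pp = fcoef_mult_real_polynomial[OF this(1)] fcoef_mult_real_polynomial[OF this(2)]
    have gcont: "continuous_on (sphere 0 1) g" 
      using g(1) continuous_on_polymonial_function by blast
    have "fcoef (\<lambda>z. G z * g z) 0 = fcoef (\<lambda>z. G z * of_real (Re (g z)) + \<i> * (G z * of_real (Im (g z)))) 0"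
    proof -
      have "G z * g z = G z * of_real (Re (g z)) + \<i> * (G z * of_real (Im (g z)))" for z
        using complex_eq[of "g z"] by (metis distrib_left mult.left_commute)
      then show ?thesis by presburger
    qed
    also have "\<dots> = 0"
      using pp assms by (subst fcoef_add) (auto intro!: continuous_on_mult simp: fcoef_cmult)
    finally have z0: "fcoef (\<lambda>z. G z * g z) 0 = 0" .
    have "fcoef (\<lambda>z. G z * (cnj (G z) - g z)) 0 = fcoef (\<lambda>z. G z * cnj (G z) - G z * g z) 0"
      by (simp add: algebra_simps)
    also have "\<dots> = fcoef (\<lambda>z. G z * cnj (G z)) 0"
      by (subst fcoef_diff) (auto intro!: continuous_on_mult G gcont cG simp: z0)
    finally have "fcoef (\<lambda>z. G z * cnj (G z)) 0 = fcoef (\<lambda>z. G z * (cnj (G z) - g z)) 0" ..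
    moreover have "norm (fcoef (\<lambda>z. G z * (cnj (G z) - g z)) 0) \<le> B * e"
    proof (rule fcoef_bound)
      show "norm (G z * (cnj (G z) - g z)) \<le> B * e" if "norm z = 1" for z
        unfolding norm_mult using B g(2)[of z] that by (intro mult_mono) auto
    qed (intro continuous_intros G gcont)
    ultimately show ?thesis by simp
  qed
  have z0: "fcoef (\<lambda>z. G z * cnj (G z)) 0 = 0"
  proof (rule ccontr)
    assume "fcoef (\<lambda>z. G z * cnj (G z)) 0 \<noteq> 0"
    then have "norm (fcoef (\<lambda>z. G z * cnj (G z)) 0) > 0" (is "?N > 0") by simp
    then show False using small[of "?N / (2 * B)"] B(2) by simp
  qed
  have "integral {0..2*pi} (\<lambda>t. (norm (G (cis t)))\<^sup>2) = 0" 
    using z0 fcoef_norm_square[OF G] by (simp del: of_real_divide of_real_power)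
  then have "\<forall>t\<in>{0..2*pi}. (norm (G (cis t)))\<^sup>2 = 0"
    by (subst (asm) integral_eq_0_iff) (auto intro!: continuous_intros continuous_on_circle G)
  moreover have "z = cis (Arg2pi z)" "Arg2pi z \<in> {0..2*pi}"
    using Arg2pi[of z] z by (auto simp: cis_conv_exp is_Arg_def less_imp_le)
  ultimately show ?thesis by (metis norm_eq_zero power_eq_0_iff)
qed

text \<open>Absolute summability makes the Fourier series converge uniformly to a continuous
  function with the same coefficients, and this function is \<open>g\<close> by uniqueness. The sum
  of the moduli then bounds the value.\<close>

lemma norm_le_sum_fcoef:
  assumes g: "continuous_on (sphere 0 1) g" 
    and S: "\<And>J. finite J \<Longrightarrow> (\<Sum>j\<in>J. norm (fcoef g j)) \<le> S" and z: "norm z = 1"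
  shows "norm (g z) \<le> S"
proof -
  \<comment> \<open>Frequency k is paired with -(k + 1), so that a series over the naturals runs
    through every integer exactly once.\<close>
  define d where "d k z = fcoef g (int k) * z powi (int k) + fcoef g (- int (Suc k)) * z powi (- int (Suc k))" for k and z
  define M where "M k = norm (fcoef g (int k)) + norm (fcoef g (- int (Suc k)))" for k
  have psum: "(\<Sum>k<n. M k) \<le> S" for n
  proof -
    have "(\<Sum>k<n. M k) = (\<Sum>j\<in>int ` {..<n}. norm (fcoef g j)) + (\<Sum>j\<in>(\<lambda>k. - int (Suc k)) ` {..<n}. norm (fcoef g j))"
      unfolding M_def sum.distrib by (subst (1 2) sum.reindex) (auto simp: inj_on_def)
    also have "\<dots> = (\<Sum>j\<in>int ` {..<n} \<union> (\<lambda>k. - int (Suc k)) ` {..<n}. norm (fcoef g j))"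
      by (subst sum.union_disjoint) auto
    also have "\<dots> \<le> S" by (rule S) auto
    finally show ?thesis .
  qed
  have Mpos: "M k \<ge> 0" for k unfolding M_def by simp
  have summ: "summable M" by (rule summableI_nonneg_bounded[of M S]) (auto simp: psum Mpos)
  have dM: "norm (d k z) \<le> M k" if "z \<in> sphere 0 1" for k z
    using that unfolding d_def M_def
    by (intro norm_triangle_le add_mono) (auto simp: norm_mult norm_power_int norm_power)
  define h where "h z = suminf (\<lambda>k. d k z)" for z
  have unif: "uniform_limit (sphere 0 1) (\<lambda>n z. \<Sum>k<n. d k z) h sequentially"
    unfolding h_def by (rule Weierstrass_m_test[OF dM summ])
  have dcont: "continuous_on (sphere 0 1) (d k)" for k
    unfolding d_def by (intro continuous_intros continuous_on_sphere_powi) auto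
  have pcont: "continuous_on (sphere 0 1) (\<lambda>z. \<Sum>k<n. d k z)" for n
    by (intro continuous_intros dcont)
  have hcont: "continuous_on (sphere 0 1) h"
    by (rule uniform_limit_theorem[OF _ unif]) (auto intro!: always_eventually pcont)
  have pc: "fcoef (\<lambda>z. \<Sum>k<n. d k z) j = fcoef g j" if "n > nat \<bar>j\<bar>" for n j
  proof -
    have "fcoef (\<lambda>z. \<Sum>k<n. d k z) j = (\<Sum>k<n. fcoef (d k) j)"
      by (subst fcoef_sum) (auto simp: dcont)
    also have "\<dots> = (\<Sum>k<n. (if int k = j then fcoef g j else 0) + (if - int (Suc k) = j then fcoef g j else 0))"
    proof (rule sum.cong)
      fix k 
      show "fcoef (d k) j = (if int k = j then fcoef g j else 0) + (if - int (Suc k) = j then fcoef g j else 0)"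
        unfolding d_def by (subst fcoef_add, (intro continuous_intros continuous_on_sphere_powi)+,
          subst (1 2) fcoef_cmult, subst (1 2) fcoef_powi) auto
    qed simp
    also have "\<dots> = fcoef g j"
    proof (cases "j \<ge> 0")
      case True
      have "(\<Sum>k<n. (if int k = j then fcoef g j else 0) + (if - int (Suc k) = j then fcoef g j else 0)) = 
         (\<Sum>k<n. (if k = nat j then fcoef g j else 0))"
        using True by (intro sum.cong) auto
      then show ?thesis using that True by simp
    next
      case False
      have "(\<Sum>k<n. (if int k = j then fcoef g j else 0) + (if - int (Suc k) = j then fcoef g j else 0)) = 
         (\<Sum>k<n. (if k = nat (-j) - 1 then fcoef g j else 0))"
        using False by (intro sum.cong) auto
      then show ?thesis using that False by simp
    qed
    finally show ?thesis .
  qed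
  have hc: "fcoef h j = fcoef g j" for j
  proof -
    have "norm (fcoef h j - fcoef g j) \<le> e" if "e > 0" for e
    proof -
      have "\<forall>\<^sub>F n in sequentially. \<forall>z\<in>sphere 0 1. dist (\<Sum>k<n. d k z) (h z) < e"
        using unif that unfolding uniform_limit_iff by blast
      then have "\<forall>\<^sub>F n in sequentially. (\<forall>z\<in>sphere 0 1. dist (\<Sum>k<n. d k z) (h z) < e) \<and> n > nat \<bar>j\<bar>"
        using eventually_gt_at_top eventually_conj by blast
      then obtain n where n: "\<forall>z\<in>sphere 0 1. dist (\<Sum>k<n. d k z) (h z) < e" "n > nat \<bar>j\<bar>"
        by (auto simp: eventually_sequentially)
      have "fcoef h j - fcoef g j = fcoef (\<lambda>z. h z - (\<Sum>k<n. d k z)) j"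
        by (subst fcoef_diff) (auto simp: hcont pcont pc[OF n(2)])
      also have "norm \<dots> \<le> e"
        by (rule fcoef_bound) (use n(1) in \<open>auto intro!: continuous_on_diff hcont pcont less_imp_le simp: dist_norm norm_minus_commute\<close>)
      finally show ?thesis .
    qed
    then have "norm (fcoef h j - fcoef g j) \<le> 0" by (rule field_le_epsilon[of _ 0, simplified])
    then show ?thesis by simp
  qed
  have "g z - h z = 0"
    by (rule fcoef_eq_0_imp_eq_0[of "\<lambda>z. g z - h z"]) (auto intro!: continuous_intros g hcont z simp: fcoef_diff g hcont hc)
  moreover have "norm (h z) \<le> S"
  proof -
    have "norm (h z) \<le> suminf M" unfolding h_def
      by (rule norm_suminf_le[OF _ summ]) (use z in \<open>auto intro!: dM\<close>)
    also have "\<dots> \<le> S" by (rule suminf_le_const[OF summ psum])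
    finally show ?thesis .
  qed
  ultimately show ?thesis by simp
qed

section \<open>The inequality \<open>|dbar f| \<le> C |f|\<close>\<close>

text \<open>The Wirtinger operator (\<partial>x + i \<partial>y) / 2, computed from the real
  derivative \<open>D\<close>. It vanishes exactly for complex linear derivatives.\<close>

definition dbar :: "(complex \<Rightarrow> complex \<Rightarrow> complex) \<Rightarrow> complex \<Rightarrow> complex" where
  "dbar D z = (D z 1 + \<i> * D z \<i>) / 2"

text \<open>The division by r^j makes this constant in r when \<open>f\<close> is holomorphic, where
  it is the Taylor coefficient of z^j. In general its variation measures
  \<open>dbar\<close>.\<close>

definition rcoef :: "(complex \<Rightarrow> complex) \<Rightarrow> int \<Rightarrow> real \<Rightarrow> complex" where
  "rcoef f j r = fcoef (\<lambda>z. f (of_real r * z)) j / of_real r powi j"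

lemma derivative_Re_Im:
  assumes "bounded_linear (d :: complex \<Rightarrow> complex)"
  shows "d w = of_real (Re w) * d 1 + of_real (Im w) * d \<i>"
proof -
  interpret bounded_linear d by fact
  have "w = Re w *\<^sub>R 1 + Im w *\<^sub>R \<i>" by (simp add: complex_eq_iff)
  then have "d w = Re w *\<^sub>R d 1 + Im w *\<^sub>R d \<i>" by (metis add scaleR)
  then show ?thesis by (simp add: scaleR_conv_of_real)
qed

section \<open>Radial derivatives of the circle coefficients of a C^1 function\<close>

locale C1_disc =
  fixes f :: "complex \<Rightarrow> complex" and D :: "complex \<Rightarrow> complex \<Rightarrow> complex" and R0 :: real
  assumes deriv: "z \<in> ball 0 R0 \<Longrightarrow> (f has_derivative D z) (at z)"
    and cont1: "continuous_on (ball 0 R0) (\<lambda>z. D z 1)"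
    and conti: "continuous_on (ball 0 R0) (\<lambda>z. D z \<i>)"
begin

lemma cont_f: "continuous_on (ball 0 R0) f"
  using deriv by (meson continuous_at_imp_continuous_on has_derivative_continuous)

lemma cont_dbar: "continuous_on (ball 0 R0) (dbar D)"
  unfolding dbar_def by (intro continuous_intros cont1 conti) auto

lemma D_eq: "z \<in> ball 0 R0 \<Longrightarrow> D z w = of_real (Re w) * D z 1 + of_real (Im w) * D z \<i>"
  using deriv has_derivative_bounded_linear derivative_Re_Im by blast

lemma cont_circle:
  fixes g :: "complex \<Rightarrow> complex"
  assumes "0 \<le> r" "r < R0" and g: "continuous_on (ball 0 R0) g"
  shows "continuous_on (sphere 0 1) (\<lambda>z. g (of_real r * z))"
proof -
  have c: "continuous_on (sphere 0 1) (\<lambda>z. complex_of_real r * z)" by (intro continuous_intros)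
  show ?thesis
    by (rule continuous_on_compose2[OF g c]) (use assms in \<open>auto simp: norm_mult dist_norm\<close>)
qed

lemma deriv_r:
  assumes "0 < r" "r < R0"
  shows "((\<lambda>r. f (of_real r * cis t)) has_vector_derivative D (of_real r * cis t) (cis t)) (at r)"
proof -
  have "((\<lambda>r. of_real r * cis t) has_derivative (\<lambda>h. of_real h * cis t)) (at r)"
    by (auto intro!: derivative_eq_intros)
  moreover have "(f has_derivative D (of_real r * cis t)) (at (of_real r * cis t))"
    using assms by (intro deriv) (auto simp: norm_mult)
  ultimately have *: "((\<lambda>r. f (of_real r * cis t)) has_derivative (\<lambda>h. D (of_real r * cis t) (of_real h * cis t))) (at r)"
    using diff_chain_at[of "\<lambda>r. of_real r * cis t" _ r f] by (simp add: o_def)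
  have z: "of_real r * cis t \<in> ball 0 R0" using assms by (simp add: norm_mult)
  interpret bounded_linear "D (of_real r * cis t)" using deriv[OF z] has_derivative_bounded_linear by blast
  have "D (of_real r * cis t) (of_real h * cis t) = h *\<^sub>R D (of_real r * cis t) (cis t)" for h
    using scaleR[of h "cis t"] by (simp only: scaleR_conv_of_real)
  then show ?thesis using * unfolding has_vector_derivative_def by simp
qed

lemma deriv_t:
  assumes "0 < r" "r < R0"
  shows "((\<lambda>t. f (of_real r * cis t)) has_vector_derivative D (of_real r * cis t) (\<i> * of_real r * cis t)) (at t within S)"
proof -
  have "((\<lambda>t. of_real r * cis t) has_vector_derivative (\<i> * of_real r * cis t)) (at t within S)"
    unfolding cis_conv_exp
    by (auto intro!: derivative_eq_intros has_vector_derivative_real_field simp: mult_ac)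
  then have 1: "((\<lambda>t. of_real r * cis t) has_derivative (\<lambda>h. h *\<^sub>R (\<i> * of_real r * cis t))) (at t within S)"
    unfolding has_vector_derivative_def .
  have z: "of_real r * cis t \<in> ball 0 R0" using assms by (simp add: norm_mult)
  have 2: "(f has_derivative D (of_real r * cis t)) (at (of_real r * cis t) within (\<lambda>t. of_real r * cis t) ` S)"
    using has_derivative_at_withinI[OF deriv[OF z]] .
  have *: "((\<lambda>t. f (of_real r * cis t)) has_derivative (\<lambda>h. D (of_real r * cis t) (h *\<^sub>R (\<i> * of_real r * cis t)))) (at t within S)"
    using diff_chain_within[OF 1 2] by (simp add: o_def)
  interpret bounded_linear "D (of_real r * cis t)" using deriv[OF z] has_derivative_bounded_linear by blast
  show ?thesis using * unfolding has_vector_derivative_def scaleR .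
qed

text \<open>The polar form of \<open>dbar\<close>, e^(it) (\<partial>r + (i/r) \<partial>t) / 2,
  solved for the radial derivative. The last term is the angular derivative.\<close>

lemma polar_dbar:
  assumes "0 < r" "r < R0"
  shows "D (of_real r * cis t) (cis t) = 2 * dbar D (of_real r * cis t) * cis (-t) 
      - \<i> / of_real r * D (of_real r * cis t) (\<i> * of_real r * cis t)"
proof -
  have z: "of_real r * cis t \<in> ball 0 R0" using assms by (simp add: norm_mult)
  obtain A where A: "D (of_real r * cis t) 1 = A" by blast
  obtain B where B: "D (of_real r * cis t) \<i> = B" by blast
  show ?thesis
    unfolding D_eq[OF z, of "cis t"] D_eq[OF z, of "\<i> * of_real r * cis t"] dbar_def A B
    using assms by (simp add: complex_eq_iff field_simps)
qed

lemma cont_polar: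
  fixes g :: "complex \<Rightarrow> complex"
  assumes g: "continuous_on (ball 0 R0) g"
  shows "continuous_on ({0<..<R0} \<times> T) (\<lambda>(r, t). g (of_real r * cis t))"
  unfolding split_beta
  by (rule continuous_on_compose2[OF g]) (auto intro!: continuous_intros simp: norm_mult)

text \<open>After differentiation under the integral sign, \<open>polar_dbar\<close> replaces the
  radial derivative. Its angular part is integrated by parts over a full period and returns the
  coefficient itself with the factor j/r.\<close>

lemma coef_deriv:
  assumes r: "0 < r" "r < R0"
  shows "((\<lambda>r. integral {0..2*pi} (\<lambda>t. f (of_real r * cis t) * cis (- (of_int j * t)))) has_vector_derivative
     (2 * integral {0..2*pi} (\<lambda>t. dbar D (of_real r * cis t) * cis (- (of_int (j + 1) * t))) 
       + of_int j / of_real r * integral {0..2*pi} (\<lambda>t. f (of_real r * cis t) * cis (- (of_int j * t))))) (at r)"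
proof -
  let ?F = "\<lambda>r t. f (of_real r * cis t) * cis (- (of_int j * t))"
  let ?F' = "\<lambda>r t. D (of_real r * cis t) (cis t) * cis (- (of_int j * t))"
  let ?T = "\<lambda>t. D (of_real r * cis t) (\<i> * of_real r * cis t) * cis (- (of_int j * t))"
  have "((\<lambda>x. integral (cbox 0 (2*pi)) (?F x)) has_vector_derivative integral (cbox 0 (2*pi)) (?F' r)) (at r within {0<..<R0})"
  proof (rule leibniz_rule_vector_derivative)
    show "((\<lambda>x. ?F x t) has_vector_derivative ?F' x t) (at x within {0<..<R0})" 
      if "x \<in> {0<..<R0}" "t \<in> cbox 0 (2*pi)" for x t
      using that by (intro has_vector_derivative_mult_left has_vector_derivative_at_within[OF deriv_r]) auto
    show "?F x integrable_on cbox 0 (2 * pi)" if "x \<in> {0<..<R0}" for x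
      using that integrable_circle[OF cont_circle[OF _ _ cont_f, of x], of j] by simp
    have eq: "?F' x t = (of_real (cos t) * D (of_real x * cis t) 1 + of_real (sin t) * D (of_real x * cis t) \<i>) * cis (- (of_int j * t))"
      if "x \<in> {0<..<R0}" for x t
    proof -
      have "of_real x * cis t \<in> ball 0 R0" using that by (simp add: norm_mult)
      from D_eq[OF this, of "cis t"] show ?thesis by simp
    qed
    have "continuous_on ({0<..<R0} \<times> cbox 0 (2 * pi))
      (\<lambda>p. (of_real (cos (snd p)) * (case p of (x, t) \<Rightarrow> D (of_real x * cis t) 1) + of_real (sin (snd p)) * (case p of (x, t) \<Rightarrow> D (of_real x * cis t) \<i>)) * cis (- (of_int j * snd p)))"
      by (intro continuous_intros cont_polar cont1 conti)
    then show "continuous_on ({0<..<R0} \<times> cbox 0 (2 * pi)) (\<lambda>(x, t). ?F' x t)"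
      by (rule continuous_on_eq) (auto simp: eq)
  qed (use r in auto)
  then have 1: "((\<lambda>x. integral {0..2*pi} (?F x)) has_vector_derivative integral {0..2*pi} (?F' r)) (at r)"
    using r at_within_open[of r "{0<..<R0}"] by simp
  have cT: "continuous_on {0..2*pi} ?T"
  proof -
    have "continuous_on {0..2*pi} (\<lambda>t. (of_real (- r * sin t) * D (of_real r * cis t) 1 + of_real (r * cos t) * D (of_real r * cis t) \<i>) * cis (- (of_int j * t)))"
      by (intro continuous_intros continuous_on_circle[OF cont_circle[OF _ _ cont1]] continuous_on_circle[OF cont_circle[OF _ _ conti]])
         (use r in auto)
    then show ?thesis
    proof (rule continuous_on_eq)
      fix t
      have "of_real r * cis t \<in> ball 0 R0" using r by (simp add: norm_mult)
      from D_eq[OF this, of "\<i> * of_real r * cis t"]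
      show "(of_real (- r * sin t) * D (of_real r * cis t) 1 + of_real (r * cos t) * D (of_real r * cis t) \<i>) * cis (- (of_int j * t)) = ?T t"
        by simp
    qed
  qed
  have int: "?T integrable_on {0..2*pi}" "?F r integrable_on {0..2*pi}"
    "(\<lambda>t. dbar D (of_real r * cis t) * cis (- (of_int (j + 1) * t))) integrable_on {0..2*pi}"
    using cT integrable_circle[OF cont_circle[OF _ _ cont_f, of r], of j] 
      integrable_circle[OF cont_circle[OF _ _ cont_dbar, of r], of "j+1"] r
    by (auto intro: integrable_continuous_real)
  \<comment> \<open>Integration by parts without boundary term: the integrand is the derivative of a
    function that takes equal values at 0 and 2 pi.\<close>
  have "((\<lambda>t. ?T t - \<i> * of_int j * ?F r t) has_integral (?F r (2*pi) - ?F r 0)) {0..2*pi}"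
  proof (rule fundamental_theorem_of_calculus)
    show "(?F r has_vector_derivative ?T t - \<i> * of_int j * ?F r t) (at t within {0..2*pi})" for t
    proof -
      have "((\<lambda>t. cis (- (of_int j * t))) has_vector_derivative (- \<i> * of_int j * cis (- (of_int j * t)))) (at t within {0..2*pi})"
        unfolding cis_conv_exp
        by (auto intro!: derivative_eq_intros has_vector_derivative_real_field simp: mult_ac)
      from has_vector_derivative_mult[OF deriv_t[OF r] this] show ?thesis
        by (simp add: algebra_simps)
    qed
  qed auto
  moreover have "?F r (2*pi) = ?F r 0"
  proof -
    have "cis (- (of_int j * (2*pi))) = 1"
      using cis_multiple_2pi[of "- of_int j"] by (simp add: mult_ac)
    then show ?thesis by (simp only:) simp
  qed
  ultimately have "integral {0..2*pi} (\<lambda>t. ?T t - \<i> * of_int j * ?F r t) = 0"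
    by (simp add: integral_unique)
  then have T: "integral {0..2*pi} ?T = \<i> * of_int j * integral {0..2*pi} (?F r)"
    by (subst (asm) integral_diff) (use int in \<open>auto intro!: integrable_on_mult_right\<close>)
  have "?F' r t = 2 * (dbar D (of_real r * cis t) * cis (- (of_int (j + 1) * t))) - \<i> / of_real r * ?T t" for t
  proof -
    have "cis (- (of_int (j + 1) * t)) = cis (-t) * cis (- (of_int j * t))"
      by (simp add: cis_mult algebra_simps)
    then show ?thesis
      by (subst polar_dbar[OF r]) (simp add: algebra_simps)
  qed
  then have "integral {0..2*pi} (?F' r) = 
      integral {0..2*pi} (\<lambda>t. 2 * (dbar D (of_real r * cis t) * cis (- (of_int (j + 1) * t))) - \<i> / of_real r * ?T t)"
    by presburger
  also have "\<dots> = 2 * integral {0..2*pi} (\<lambda>t. dbar D (of_real r * cis t) * cis (- (of_int (j + 1) * t))) 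
      - \<i> / of_real r * integral {0..2*pi} ?T"
    by (subst integral_diff; (intro integrable_on_mult_right int)?) (simp add: integral_mult_right)
  also have "\<dots> = 2 * integral {0..2*pi} (\<lambda>t. dbar D (of_real r * cis t) * cis (- (of_int (j + 1) * t))) 
      + of_int j / of_real r * integral {0..2*pi} (?F r)"
    unfolding T by (simp add: field_simps)
  finally show ?thesis using 1 by simp
qed

text \<open>The factor r^(-j) has logarithmic derivative -j/r, which cancels the second term of
  \<open>coef_deriv\<close> and leaves only \<open>dbar\<close>.\<close>

lemma rcoef_deriv:
  assumes r: "0 < r" "r < R0"
  shows "(rcoef f j has_vector_derivative (2 * fcoef (\<lambda>z. dbar D (complex_of_real r * z)) (j + 1) / complex_of_real r powi j)) (at r)"
proof -
  let ?P = "\<lambda>r. integral {0..2*pi} (\<lambda>t. f (complex_of_real r * cis t) * cis (- (of_int j * t)))"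
  let ?B = "integral {0..2*pi} (\<lambda>t. dbar D (complex_of_real r * cis t) * cis (- (of_int (j + 1) * t)))"
  have rr: "rcoef f j = (\<lambda>r. ?P r * (complex_of_real r powi (-j) / (2 * pi)))"
    by (auto simp: rcoef_def fcoef_def fun_eq_iff power_int_minus field_simps)
  have "((\<lambda>r. complex_of_real r powi (-j) / (2 * pi)) has_vector_derivative (of_int (-j) * complex_of_real r powi (-j-1) / (2*pi))) (at r)"
    by (rule has_vector_derivative_real_field[where f="\<lambda>r::complex. r powi (-j) / (2 * pi)"])
       (use r in \<open>auto intro!: derivative_eq_intros\<close>)
  from has_vector_derivative_mult[OF coef_deriv[OF r, of j] this]
  have "(rcoef f j has_vector_derivative (?P r * (of_int (-j) * complex_of_real r powi (-j-1) / (2*pi)) + 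
      (2 * ?B + of_int j / complex_of_real r * ?P r) * (complex_of_real r powi (-j) / (2 * pi)))) (at r)"
    unfolding rr .
  moreover have "complex_of_real r powi (-j-1) = complex_of_real r powi (-j) / complex_of_real r"
    using r by (simp add: power_int_diff)
  ultimately have "(rcoef f j has_vector_derivative (2 * ?B * (complex_of_real r powi (-j) / (2 * pi)))) (at r)"
    by (simp add: algebra_simps)
  moreover have "2 * ?B * (complex_of_real r powi (-j) / (2 * pi)) = 2 * fcoef (\<lambda>z. dbar D (complex_of_real r * z)) (j + 1) / complex_of_real r powi j"
    unfolding fcoef_def by (simp add: power_int_minus field_simps)
  ultimately show ?thesis by simp
qed

end

section \<open>Estimates for low and high Fourier modes\<close>

lemma sum_power_le_geometric:
  assumes "finite K" "0 \<le> q" "q < (1::real)"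
  shows "(\<Sum>k\<in>K. q ^ k) \<le> 1 / (1 - q)"
proof -
  have "(\<Sum>k\<in>K. q ^ k) \<le> suminf (\<lambda>k. q ^ k)"
    by (rule sum_le_suminf) (use assms in \<open>auto intro: summable_geometric\<close>)
  then show ?thesis using assms by (simp add: suminf_geometric)
qed

lemma inj_on_nat_diff:
  assumes "\<And>j. j \<in> J \<Longrightarrow> m \<le> (j :: int)"
  shows "inj_on (\<lambda>j. nat (j - m)) J"
proof (rule inj_onI)
  fix x y assume "x \<in> J" "y \<in> J" "nat (x - m) = nat (y - m)"
  then show "x = y" using assms[of x] assms[of y] by linarith
qed

lemma sum_powi_squares_le:
  assumes J: "finite J" "\<And>j. j \<in> J \<Longrightarrow> m \<le> j" and q: "0 < q" "q < (1::real)"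
  shows "(\<Sum>j\<in>J. (q powi j)\<^sup>2) \<le> (q powi m)\<^sup>2 / (1 - q)"
proof -
  have "(\<Sum>j\<in>J. (q powi j)\<^sup>2) \<le> (\<Sum>j\<in>J. (q powi m)\<^sup>2 * q ^ nat (j - m))"
  proof (rule sum_mono)
    fix j assume "j \<in> J"
    then have "m \<le> j" using J(2) by blast
    then obtain k where k: "j = m + int k" using zle_iff_zadd by blast
    have "q powi j = q powi m * q ^ nat (j - m)"
      unfolding k using q by (subst power_int_add) auto
    moreover have "(q ^ nat (j - m))\<^sup>2 \<le> q ^ nat (j - m)"
      using q unfolding power_mult[symmetric] by (intro power_decreasing) auto
    ultimately show "(q powi j)\<^sup>2 \<le> (q powi m)\<^sup>2 * q ^ nat (j - m)"
      by (simp add: power_mult_distrib mult_left_mono)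
  qed
  also have "\<dots> = (q powi m)\<^sup>2 * (\<Sum>k\<in>(\<lambda>j. nat (j - m)) ` J. q ^ k)"
    using inj_on_nat_diff[OF J(2)] by (subst sum.reindex) (auto simp: sum_distrib_left simp del: of_nat_Suc power_Suc)
  also have "\<dots> \<le> (q powi m)\<^sup>2 * (1 / (1 - q))"
    using J q by (intro mult_left_mono sum_power_le_geometric) auto
  finally show ?thesis by simp
qed

lemma powr_half_mult_sqrt:
  assumes "0 < r"
  shows "r powr (\<mu> + 1/2) * sqrt r = r powr (\<mu> + 1)"
proof -
  have "r powr (\<mu> + 1/2) * sqrt r = r powr ((\<mu> + 1/2) + 1/2)"
    unfolding powr_add[of r "\<mu> + 1/2"] using assms by (simp add: powr_half_sqrt)
  then show ?thesis by (simp add: add.commute)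
qed

lemma powr_shift_half:
  fixes r \<mu> :: real
  assumes "0 < r"
  shows "r ^ Suc n * r powr (\<mu> - real n - 1/2) = r powr (\<mu> + 1/2)"
proof -
  have "r ^ Suc n * r powr (\<mu> - real n - 1/2) = r powr (real (Suc n) + (\<mu> - real n - 1/2))"
    unfolding powr_add using assms by (simp add: powr_realpow del: of_nat_Suc power_Suc)
  moreover have "real (Suc n) + (\<mu> - real n - 1/2) = \<mu> + 1/2" by simp
  ultimately show ?thesis by (simp only:)
qed

context C1_disc begin

text \<open>Cauchy-Schwarz separates the weights (r/\<rho>)^j, whose square sum is at most
  \<open>W\<^sup>2\<close>, from the coefficients of \<open>dbar\<close> on the circle of radius
  \<rho>, whose square sum is at most \<open>\<beta>\<^sup>2\<close> by Bessel. The shift of the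
  index by one is harmless there.\<close>

lemma norm_sum_rcoef_deriv_le:
  assumes \<rho>: "0 < \<rho>" "\<rho> < R0" and r: "0 < r" and J: "finite J" and \<sigma>: "\<And>j. norm (\<sigma> j) \<le> 1"
    and \<beta>: "\<And>z. norm z = \<rho> \<Longrightarrow> norm (dbar D z) \<le> \<beta>" 
    and W: "(\<Sum>j\<in>J. ((r / \<rho>) powi j)\<^sup>2) \<le> W\<^sup>2" "0 \<le> W"
  shows "norm (\<Sum>j\<in>J. \<sigma> j * of_real (r powi j) * (2 * fcoef (\<lambda>z. dbar D (of_real \<rho> * z)) (j + 1) / of_real \<rho> powi j))
      \<le> 2 * W * \<beta>"
proof -
  let ?b = "\<lambda>j. fcoef (\<lambda>z. dbar D (of_real \<rho> * z)) j"
  have \<beta>0: "\<beta> \<ge> 0" using \<beta>[of "of_real \<rho>"] \<rho> norm_ge_zero[of "dbar D (of_real \<rho>)"] by (simp del: norm_ge_zero)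
  have cont: "continuous_on (sphere 0 1) (\<lambda>z. dbar D (of_real \<rho> * z))"
    using cont_circle[OF _ _ cont_dbar, of \<rho>] \<rho> by simp
  have "norm (\<Sum>j\<in>J. \<sigma> j * of_real (r powi j) * (2 * ?b (j + 1) / of_real \<rho> powi j)) \<le> 
      (\<Sum>j\<in>J. 2 * (((r / \<rho>) powi j) * norm (?b (j + 1))))"
  proof (rule sum_norm_le)
    fix j assume "j \<in> J"
    have "norm (\<sigma> j * of_real (r powi j) * (2 * ?b (j + 1) / of_real \<rho> powi j)) = 
        norm (\<sigma> j) * (2 * (((r / \<rho>) powi j) * norm (?b (j + 1))))"
      using r \<rho> by (simp add: norm_mult norm_divide norm_power_int power_int_divide_distrib del: of_real_power_int)
    also have "\<dots> \<le> 1 * (2 * (((r / \<rho>) powi j) * norm (?b (j + 1))))"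
      using r \<rho> \<sigma> by (intro mult_right_mono) auto
    finally show "norm (\<sigma> j * of_real (r powi j) * (2 * ?b (j + 1) / of_real \<rho> powi j)) \<le> 2 * (((r / \<rho>) powi j) * norm (?b (j + 1)))"
      by simp
  qed
  also have "\<dots> = 2 * (\<Sum>j\<in>J. \<bar>(r / \<rho>) powi j\<bar> * \<bar>norm (?b (j + 1))\<bar>)"
    using r \<rho> by (simp add: sum_distrib_left)
  also have "\<dots> \<le> 2 * (L2_set (\<lambda>j. (r / \<rho>) powi j) J * L2_set (\<lambda>j. norm (?b (j + 1))) J)"
    by (intro mult_left_mono L2_set_mult_ineq) auto
  also have "\<dots> \<le> 2 * (W * \<beta>)"
  proof (intro mult_left_mono mult_mono)
    show "L2_set (\<lambda>j. (r / \<rho>) powi j) J \<le> W"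
      unfolding L2_set_def by (rule real_le_lsqrt) (use W in \<open>auto\<close>)
    have "(\<Sum>j\<in>J. (norm (?b (j + 1)))\<^sup>2) = (\<Sum>j\<in>(\<lambda>j. j + 1) ` J. (norm (?b j))\<^sup>2)"
      by (subst sum.reindex) auto
    also have "\<dots> \<le> \<beta>\<^sup>2"
      by (rule Bessel[OF cont]) (use J \<rho> in \<open>auto intro!: \<beta> simp: norm_mult\<close>)
    finally show "L2_set (\<lambda>j. norm (?b (j + 1))) J \<le> \<beta>"
      unfolding L2_set_def using \<beta>0 by (intro real_le_lsqrt) auto
  qed (use W in auto)
  finally show ?thesis by simp
qed

lemma fcoef_eq_rcoef: "r > 0 \<Longrightarrow> fcoef (\<lambda>z. f (of_real r * z)) j = of_real (r powi j) * rcoef f j r"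
  unfolding rcoef_def by simp

lemma has_vector_derivative_rcoef_sum:
  assumes "0 < \<rho>" "\<rho> < R0"
  shows "((\<lambda>\<rho>. \<Sum>j\<in>J. c j * rcoef f j \<rho>) has_vector_derivative
     (\<Sum>j\<in>J. c j * (2 * fcoef (\<lambda>z. dbar D (of_real \<rho> * z)) (j + 1) / of_real \<rho> powi j))) (at \<rho>)"
  by (intro has_vector_derivative_sum has_vector_derivative_mult_right rcoef_deriv assms)

text \<open>The conjugate phases of the coefficients turn a sum of moduli into the modulus of one
  linear combination with fixed factors. The mean value inequality in the radius can then be applied
  to a single function.\<close>

lemma rcoef_sum_unimodular:
  assumes "0 < r" 
  obtains \<sigma> where "\<And>j. norm (\<sigma> j :: complex) \<le> 1"
    "\<And>J. norm (\<Sum>j\<in>J. \<sigma> j * of_real (r powi j) * rcoef f j r) = (\<Sum>j\<in>J. norm (fcoef (\<lambda>z. f (of_real r * z)) j))"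
proof
  define \<sigma> where "\<sigma> j = cnj (sgn (rcoef f j r))" for j
  show "norm (\<sigma> j) \<le> 1" for j unfolding \<sigma>_def by (simp add: norm_sgn)
  have "\<sigma> j * of_real (r powi j) * rcoef f j r = of_real (norm (fcoef (\<lambda>z. f (of_real r * z)) j))" for j
  proof -
    have "cnj (sgn z) * z = of_real (norm z)" for z :: complex
    proof (cases "z = 0")
      case False
      have "cnj (sgn z) * z = (z * cnj z) / of_real (norm z)" by (simp add: sgn_eq)
      also have "\<dots> = of_real ((norm z)\<^sup>2 / norm z)" unfolding complex_norm_square[symmetric] by simp
      also have "(norm z)\<^sup>2 / norm z = norm z" by (simp add: power2_eq_square)
      finally show ?thesis .
    qed simp
    from this[of "rcoef f j r"] show ?thesis
      unfolding \<sigma>_def fcoef_eq_rcoef[OF assms] using assms 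
      by (simp add: norm_mult norm_power_int mult_ac del: of_real_power_int) 
  qed
  then show "norm (\<Sum>j\<in>J. \<sigma> j * of_real (r powi j) * rcoef f j r) = (\<Sum>j\<in>J. norm (fcoef (\<lambda>z. f (of_real r * z)) j))" for J
    by (simp add: of_real_sum[symmetric] sum_nonneg del: of_real_sum)
qed

text \<open>For these modes the weights (r/\<rho>)^j with \<rho> < r are controlled by (r/\<rho>)^n,
  so integration starts at radius 0, where the coefficients tend to 0 by assumption. The condition
  \<open>real n \<le> \<mu>\<close> makes \<rho>^(\<mu> - n) nondecreasing, hence at most its value
  at r.\<close>

lemma low_modes:
  assumes r: "0 < r" "r < R0" and J: "finite J" "\<And>j. j \<in> J \<Longrightarrow> j \<le> int n"
    and B: "\<And>z. 0 < norm z \<Longrightarrow> norm z < r \<Longrightarrow> norm (dbar D z) \<le> B * norm z powr \<mu>" "0 \<le> B"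
    and \<mu>: "real n \<le> \<mu>"
    and lim: "\<And>j. j \<in> J \<Longrightarrow> (rcoef f j \<longlongrightarrow> 0) (at_right 0)"
  shows "(\<Sum>j\<in>J. norm (fcoef (\<lambda>z. f (of_real r * z)) j)) \<le> 4 * B * r powr (\<mu> + 1)"
proof -
  obtain \<sigma> where \<sigma>: "\<And>j. norm (\<sigma> j :: complex) \<le> 1"
    "\<And>J. norm (\<Sum>j\<in>J. \<sigma> j * of_real (r powi j) * rcoef f j r) = (\<Sum>j\<in>J. norm (fcoef (\<lambda>z. f (of_real r * z)) j))"
    using rcoef_sum_unimodular[OF r(1)] by metis
  define \<Psi> where "\<Psi> \<rho> = (\<Sum>j\<in>J. \<sigma> j * of_real (r powi j) * rcoef f j \<rho>)" for \<rho>
  let ?\<Psi>' = "\<lambda>\<rho>. \<Sum>j\<in>J. \<sigma> j * of_real (r powi j) * (2 * fcoef (\<lambda>z. dbar D (of_real \<rho> * z)) (j + 1) / of_real \<rho> powi j)"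
  have d\<Psi>: "(\<Psi> has_vector_derivative ?\<Psi>' \<rho>) (at \<rho>)" if "0 < \<rho>" "\<rho> < R0" for \<rho>
    unfolding \<Psi>_def by (rule has_vector_derivative_rcoef_sum[OF that])
  \<comment> \<open>A primitive of the bound \<open>bnd\<close> below. The singularity at \<rho> = r
    is an inverse square root and hence integrable, and integrating it doubles the factor 2 to
    4.\<close>
  define \<phi> where "\<phi> \<rho> = - 4 * B * r powr (\<mu> + 1/2) * sqrt (r - \<rho>)" for \<rho>
  have bnd: "norm (?\<Psi>' \<rho>) \<le> 2 * B * r powr (\<mu> + 1/2) / sqrt (r - \<rho>)" if \<rho>: "0 < \<rho>" "\<rho> < r" for \<rho>
  proof -
    have q: "0 < \<rho> / r" "\<rho> / r < 1" using \<rho> by auto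
    define W where "W = (r / \<rho>) ^ n * sqrt (r / (r - \<rho>))"
    \<comment> \<open>The ratio r/\<rho> exceeds 1, so the sign of the index is reversed in order to
      have a decreasing geometric series.\<close>
    have "(\<Sum>j\<in>J. ((r / \<rho>) powi j)\<^sup>2) = (\<Sum>j\<in>uminus ` J. ((\<rho> / r) powi j)\<^sup>2)"
      by (subst sum.reindex) (auto simp: power_int_minus power_int_divide_distrib divide_simps)
    also have "\<dots> \<le> ((\<rho> / r) powi (- int n))\<^sup>2 / (1 - \<rho> / r)"
      by (rule sum_powi_squares_le) (use J q in auto)
    also have "\<dots> = W\<^sup>2"
      unfolding W_def using \<rho> r by (simp add: power_int_minus power_mult_distrib power_divide field_simps)
    finally have W: "(\<Sum>j\<in>J. ((r / \<rho>) powi j)\<^sup>2) \<le> W\<^sup>2" .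
    have W0: "0 \<le> W" unfolding W_def using \<rho> by simp
    have "norm (dbar D z) \<le> B * \<rho> powr \<mu>" if "norm z = \<rho>" for z
      using B(1)[of z] \<rho> r that by auto
    then have "norm (?\<Psi>' \<rho>) \<le> 2 * W * (B * \<rho> powr \<mu>)"
      by (intro norm_sum_rcoef_deriv_le[OF _ _ r(1) J(1) \<sigma>(1) _ W W0]) (use \<rho> r in auto)
    also have "\<dots> = 2 * B * ((r / \<rho>) ^ n * \<rho> powr \<mu>) * (sqrt r / sqrt (r - \<rho>))"
      unfolding W_def real_sqrt_divide by simp
    also have "\<dots> \<le> 2 * B * r powr \<mu> * (sqrt r / sqrt (r - \<rho>))"
    proof (intro mult_right_mono mult_left_mono)
      have "(r / \<rho>) ^ n * \<rho> powr \<mu> = r ^ n * \<rho> powr (\<mu> - n)"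
        using \<rho> by (simp add: powr_diff powr_realpow power_divide)
      also have "\<dots> \<le> r ^ n * r powr (\<mu> - n)"
        using \<rho> \<mu> r by (intro mult_left_mono powr_mono2) auto
      also have "\<dots> = r powr \<mu>" using r by (simp add: powr_diff powr_realpow)
      finally show "(r / \<rho>) ^ n * \<rho> powr \<mu> \<le> r powr \<mu>" .
    qed (use B \<rho> in auto)
    also have "\<dots> = 2 * B * r powr (\<mu> + 1/2) / sqrt (r - \<rho>)"
      using r by (simp add: powr_add powr_half_sqrt)
    finally show ?thesis .
  qed
  have step: "norm (\<Psi> r) \<le> norm (\<Psi> \<epsilon>) + 4 * B * r powr (\<mu> + 1)" if \<epsilon>: "0 < \<epsilon>" "\<epsilon> < r" for \<epsilon>
  proof -
    have "norm (\<Psi> r - \<Psi> \<epsilon>) \<le> \<phi> r - \<phi> \<epsilon>"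
    proof (rule differentiable_bound_general[OF \<epsilon>(2)])
      show "continuous_on {\<epsilon>..r} \<Psi>"
        using d\<Psi> \<epsilon> r
        by (intro continuous_at_imp_continuous_on ballI has_vector_derivative_continuous[OF d\<Psi>]) auto
      show "continuous_on {\<epsilon>..r} \<phi>" unfolding \<phi>_def by (intro continuous_intros)
      show "(\<Psi> has_vector_derivative ?\<Psi>' x) (at x)" if "\<epsilon> < x" "x < r" for x
        using that \<epsilon> r by (intro d\<Psi>) auto
      show "(\<phi> has_vector_derivative (2 * B * r powr (\<mu> + 1/2) / sqrt (r - x))) (at x)" if "\<epsilon> < x" "x < r" for x
        unfolding \<phi>_def has_real_derivative_iff_has_vector_derivative[symmetric]
        using that by (auto intro!: derivative_eq_intros simp: field_simps)
      show "norm (?\<Psi>' x) \<le> 2 * B * r powr (\<mu> + 1/2) / sqrt (r - x)" if "\<epsilon> < x" "x < r" for x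
        using that \<epsilon> by (intro bnd) auto
    qed
    also have "\<dots> = 4 * B * r powr (\<mu> + 1/2) * sqrt (r - \<epsilon>)" unfolding \<phi>_def by simp
    also have "\<dots> \<le> 4 * B * r powr (\<mu> + 1/2) * sqrt r"
      using \<epsilon> B by (intro mult_left_mono) auto
    also have "\<dots> = 4 * B * r powr (\<mu> + 1)"
      using powr_half_mult_sqrt[OF r(1), of \<mu>] by simp
    finally show ?thesis using norm_triangle_ineq2[of "\<Psi> r" "\<Psi> \<epsilon>"] by linarith
  qed
  have "((\<lambda>\<epsilon>. norm (\<Psi> \<epsilon>) + 4 * B * r powr (\<mu> + 1)) \<longlongrightarrow> norm (\<Sum>j\<in>J. \<sigma> j * of_real (r powi j) * 0) + 4 * B * r powr (\<mu> + 1)) (at_right 0)"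
    unfolding \<Psi>_def by (intro tendsto_intros lim)
  moreover have "\<forall>\<^sub>F \<epsilon> in at_right 0. norm (\<Psi> r) \<le> norm (\<Psi> \<epsilon>) + 4 * B * r powr (\<mu> + 1)"
    using eventually_at_right_less[of 0] order_tendstoD(2)[OF tendsto_ident_at r(1)]
    by eventually_elim (rule step)
  ultimately have "norm (\<Psi> r) \<le> norm (\<Sum>j\<in>J. \<sigma> j * of_real (r powi j) * 0) + 4 * B * r powr (\<mu> + 1)"
    by (rule tendsto_lowerbound) simp
  then show ?thesis using \<sigma>(2)[of J] unfolding \<Psi>_def by simp
qed

text \<open>Here the weights (r/\<rho>)^j are small for \<rho> > r, so integration runs outwards
  from r to R and the values at R enter as a boundary term. The condition
  \<open>\<mu> \<le> real n + 1/2\<close> makes the remaining power of \<rho> nonincreasing, and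
  \<open>r \<le> R / 2\<close> bounds the geometric series at R by 2.\<close>

lemma high_modes:
  assumes r: "0 < r" "r \<le> R / 2" "R < R0" and J: "finite J" "\<And>j. j \<in> J \<Longrightarrow> int (Suc n) \<le> j"
    and B: "\<And>z. 0 < norm z \<Longrightarrow> norm z < R \<Longrightarrow> norm (dbar D z) \<le> B * norm z powr \<mu>" "0 \<le> B"
    and \<mu>: "\<mu> \<le> real n + 1/2"
    and M: "\<And>z. norm z = R \<Longrightarrow> norm (f z) \<le> M"
  shows "(\<Sum>j\<in>J. norm (fcoef (\<lambda>z. f (of_real r * z)) j)) \<le> 4 * B * r powr (\<mu> + 1/2) * sqrt R + 2 * M * (r / R) ^ Suc n"
proof -
  obtain \<sigma> where \<sigma>: "\<And>j. norm (\<sigma> j :: complex) \<le> 1"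
    "\<And>J. norm (\<Sum>j\<in>J. \<sigma> j * of_real (r powi j) * rcoef f j r) = (\<Sum>j\<in>J. norm (fcoef (\<lambda>z. f (of_real r * z)) j))"
    using rcoef_sum_unimodular[OF r(1)] by metis
  have rR: "r < R" "0 < R" using r by auto
  define \<Psi> where "\<Psi> \<rho> = (\<Sum>j\<in>J. \<sigma> j * of_real (r powi j) * rcoef f j \<rho>)" for \<rho>
  let ?\<Psi>' = "\<lambda>\<rho>. \<Sum>j\<in>J. \<sigma> j * of_real (r powi j) * (2 * fcoef (\<lambda>z. dbar D (of_real \<rho> * z)) (j + 1) / of_real \<rho> powi j)"
  have d\<Psi>: "(\<Psi> has_vector_derivative ?\<Psi>' \<rho>) (at \<rho>)" if "0 < \<rho>" "\<rho> < R0" for \<rho>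
    unfolding \<Psi>_def by (rule has_vector_derivative_rcoef_sum[OF that])
  define \<phi> where "\<phi> \<rho> = 4 * B * r powr (\<mu> + 1/2) * sqrt (\<rho> - r)" for \<rho>
  have bnd: "norm (?\<Psi>' \<rho>) \<le> 2 * B * r powr (\<mu> + 1/2) / sqrt (\<rho> - r)" if \<rho>: "r < \<rho>" "\<rho> < R" for \<rho>
  proof -
    have q: "0 < r / \<rho>" "r / \<rho> < 1" using \<rho> r by auto
    define W where "W = (r / \<rho>) ^ Suc n * sqrt (\<rho> / (\<rho> - r))"
    have "(\<Sum>j\<in>J. ((r / \<rho>) powi j)\<^sup>2) \<le> ((r / \<rho>) powi (int (Suc n)))\<^sup>2 / (1 - r / \<rho>)"
      by (rule sum_powi_squares_le) (use J q in auto)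
    also have "\<dots> = ((r / \<rho>) ^ Suc n)\<^sup>2 * (\<rho> / (\<rho> - r))"
      unfolding power_int_of_nat using \<rho> r by (simp add: divide_simps del: power_Suc)
    also have "\<dots> = W\<^sup>2"
      unfolding W_def power_mult_distrib using \<rho> r by simp
    finally have W: "(\<Sum>j\<in>J. ((r / \<rho>) powi j)\<^sup>2) \<le> W\<^sup>2" .
    have W0: "0 \<le> W" unfolding W_def using \<rho> r by simp
    have "norm (dbar D z) \<le> B * \<rho> powr \<mu>" if "norm z = \<rho>" for z
      using B(1)[of z] \<rho> r that by auto
    then have "norm (?\<Psi>' \<rho>) \<le> 2 * W * (B * \<rho> powr \<mu>)"
      by (intro norm_sum_rcoef_deriv_le[OF _ _ r(1) J(1) \<sigma>(1) _ W W0]) (use \<rho> r in auto)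
    also have "\<dots> = 2 * B * ((r / \<rho>) ^ Suc n * \<rho> powr \<mu> * sqrt \<rho>) / sqrt (\<rho> - r)"
      unfolding W_def real_sqrt_divide by simp
    also have "\<dots> \<le> 2 * B * r powr (\<mu> + 1/2) / sqrt (\<rho> - r)"
    proof (intro divide_right_mono mult_left_mono)
      have "(r / \<rho>) ^ Suc n * \<rho> powr \<mu> * sqrt \<rho> = r ^ Suc n * \<rho> powr (\<mu> - n - 1/2)"
      proof -
        have "\<rho> powr \<mu> * sqrt \<rho> = \<rho> powr (\<mu> + 1/2)"
          using \<rho> r by (simp add: powr_add powr_half_sqrt)
        also have "\<dots> = \<rho> ^ Suc n * \<rho> powr (\<mu> - n - 1/2)"
          using \<rho> r by (intro powr_shift_half[symmetric]) auto
        finally have "(r / \<rho>) ^ Suc n * (\<rho> powr \<mu> * sqrt \<rho>) = ((r / \<rho>) ^ Suc n * \<rho> ^ Suc n) * \<rho> powr (\<mu> - n - 1/2)"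
          by (simp only: mult.assoc)
        also have "(r / \<rho>) ^ Suc n * \<rho> ^ Suc n = r ^ Suc n"
          using \<rho> r by (simp add: power_divide del: power_Suc)
        finally show ?thesis by (simp only: mult.assoc)
      qed
      also have "\<dots> \<le> r ^ Suc n * r powr (\<mu> - n - 1/2)"
        using \<rho> \<mu> r by (intro mult_left_mono powr_mono2') auto
      also have "\<dots> = r powr (\<mu> + 1/2)" by (rule powr_shift_half[OF r(1)])
      finally show "(r / \<rho>) ^ Suc n * \<rho> powr \<mu> * sqrt \<rho> \<le> r powr (\<mu> + 1/2)" .
    qed (use B \<rho> in auto)
    finally show ?thesis .
  qed
  have "norm (\<Psi> R - \<Psi> r) \<le> \<phi> R - \<phi> r"
  proof (rule differentiable_bound_general[OF rR(1)])
    show "continuous_on {r..R} \<Psi>"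
      using r
      by (intro continuous_at_imp_continuous_on ballI has_vector_derivative_continuous[OF d\<Psi>]) auto
    show "continuous_on {r..R} \<phi>" unfolding \<phi>_def by (intro continuous_intros)
    show "(\<Psi> has_vector_derivative ?\<Psi>' x) (at x)" if "r < x" "x < R" for x
      using that r by (intro d\<Psi>) auto
    show "(\<phi> has_vector_derivative (2 * B * r powr (\<mu> + 1/2) / sqrt (x - r))) (at x)" if "r < x" "x < R" for x
      unfolding \<phi>_def has_real_derivative_iff_has_vector_derivative[symmetric]
      using that by (auto intro!: derivative_eq_intros simp: field_simps)
    show "norm (?\<Psi>' x) \<le> 2 * B * r powr (\<mu> + 1/2) / sqrt (x - r)" if "r < x" "x < R" for x
      using that by (intro bnd) auto
  qed
  also have "\<dots> = 4 * B * r powr (\<mu> + 1/2) * sqrt (R - r)" unfolding \<phi>_def by simp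
  also have "\<dots> \<le> 4 * B * r powr (\<mu> + 1/2) * sqrt R"
    using B r by (intro mult_left_mono) auto
  finally have 1: "norm (\<Psi> R - \<Psi> r) \<le> 4 * B * r powr (\<mu> + 1/2) * sqrt R" .
  have M0: "M \<ge> 0" using M[of "of_real R"] rR norm_ge_zero[of "f (of_real R)"] by (simp del: norm_ge_zero)
  have "norm (\<Psi> R) \<le> (\<Sum>j\<in>J. M * (r / R) powi j)"
    unfolding \<Psi>_def
  proof (rule sum_norm_le)
    fix j
    have "norm (fcoef (\<lambda>z. f (of_real R * z)) j) \<le> M"
      by (rule fcoef_bound) (use r rR in \<open>auto intro!: cont_circle cont_f M simp: norm_mult\<close>)
    then have "norm (rcoef f j R) \<le> M / R powi j"
      unfolding rcoef_def using rR by (simp add: norm_divide norm_power_int divide_right_mono)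
    then have "norm (\<sigma> j) * (r powi j * norm (rcoef f j R)) \<le> 1 * (r powi j * (M / R powi j))"
      using r \<sigma>(1) by (intro mult_mono mult_left_mono) auto
    then show "norm (\<sigma> j * of_real (r powi j) * rcoef f j R) \<le> M * (r / R) powi j"
      using r by (simp add: norm_mult norm_power_int power_int_divide_distrib mult_ac)
  qed
  also have "\<dots> = M * (\<Sum>j\<in>J. (r / R) powi j)" by (simp add: sum_distrib_left)
  also have "(\<Sum>j\<in>J. (r / R) powi j) = (\<Sum>j\<in>J. (r / R) ^ Suc n * (r / R) ^ nat (j - int (Suc n)))"
  proof (rule sum.cong)
    fix j assume "j \<in> J"
    then have "j = int (Suc n + nat (j - int (Suc n)))" using J(2)[of j] by simp
    then show "(r / R) powi j = (r / R) ^ Suc n * (r / R) ^ nat (j - int (Suc n))"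
      unfolding power_add[symmetric] by (metis power_int_of_nat)
  qed simp
  also have "\<dots> = (r / R) ^ Suc n * (\<Sum>k\<in>(\<lambda>j. nat (j - int (Suc n))) ` J. (r / R) ^ k)"
    using inj_on_nat_diff[OF J(2)] by (subst sum.reindex) (auto simp: sum_distrib_left simp del: of_nat_Suc power_Suc)
  also have "\<dots> \<le> (r / R) ^ Suc n * 2"
  proof (intro mult_left_mono)
    have "(\<Sum>k\<in>(\<lambda>j. nat (j - int (Suc n))) ` J. (r / R) ^ k) \<le> 1 / (1 - r / R)"
      by (rule sum_power_le_geometric) (use J r rR in auto)
    also have "\<dots> \<le> 2" using r rR by (simp add: field_simps)
    finally show "(\<Sum>k\<in>(\<lambda>j. nat (j - int (Suc n))) ` J. (r / R) ^ k) \<le> 2" .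
  qed (use r in auto)
  finally have "norm (\<Psi> R) \<le> M * ((r / R) ^ Suc n * 2)" using M0 by (simp add: mult_left_mono)
  with 1 have "norm (\<Psi> r) \<le> 4 * B * r powr (\<mu> + 1/2) * sqrt R + 2 * M * (r / R) ^ Suc n"
    using norm_triangle_ineq3[of "\<Psi> R" "\<Psi> r"] by linarith
  then show ?thesis using \<sigma>(2)[of J] unfolding \<Psi>_def by simp
qed

text \<open>The bootstrapping step: a bound of order \<mu> on \<open>dbar\<close> gives order \<mu>
  + 1/2 for the function, up to a boundary term of order n + 1. The window for \<mu> is the
  intersection of the requirements for low and high modes. The better exponent \<mu> + 1 of the low
  modes is given up, using r \<le> R, to obtain one common form.\<close>

proposition growth_estimate:
  assumes R: "R < R0" 
    and z: "0 < norm z" "norm z \<le> R / 2" 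
    and B: "\<And>z. 0 < norm z \<Longrightarrow> norm z < R \<Longrightarrow> norm (dbar D z) \<le> B * norm z powr \<mu>" "0 \<le> B"
    and \<mu>: "real n \<le> \<mu>" "\<mu> \<le> real n + 1/2"
    and M: "\<And>z. norm z = R \<Longrightarrow> norm (f z) \<le> M"
    and lim: "\<And>j. j \<le> int n \<Longrightarrow> (rcoef f j \<longlongrightarrow> 0) (at_right 0)"
  shows "norm (f z) \<le> 8 * B * norm z powr (\<mu> + 1/2) * sqrt R + 2 * M * (norm z / R) ^ Suc n"
proof -
  define r where "r = norm z"
  have r: "0 < r" "r \<le> R / 2" "r < R0" "r \<le> R" using z R unfolding r_def by linarith+
  have "norm (f (of_real r * (z / of_real r))) \<le> 8 * B * r powr (\<mu> + 1/2) * sqrt R + 2 * M * (r / R) ^ Suc n"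
  proof (rule norm_le_sum_fcoef[where g="\<lambda>z. f (of_real r * z)"])
    show "continuous_on (sphere 0 1) (\<lambda>z. f (of_real r * z))" 
      using r by (intro cont_circle cont_f) auto
    show "norm (z / of_real r) = 1" using z unfolding r_def by (simp add: norm_divide)
    fix J :: "int set" assume J: "finite J"
    let ?a = "\<lambda>j. norm (fcoef (\<lambda>z. f (of_real r * z)) j)"
    have "(\<Sum>j\<in>J. ?a j) = (\<Sum>j\<in>{j\<in>J. j \<le> int n}. ?a j) + (\<Sum>j\<in>{j\<in>J. int (Suc n) \<le> j}. ?a j)"
      using J by (subst sum.union_disjoint[symmetric]) (auto intro!: sum.cong)
    also have "\<dots> \<le> 4 * B * r powr (\<mu> + 1) + (4 * B * r powr (\<mu> + 1/2) * sqrt R + 2 * M * (r / R) ^ Suc n)"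
    proof (intro add_mono low_modes high_modes)
      show "norm (dbar D z) \<le> B * norm z powr \<mu>" if "0 < norm z" "norm z < r" for z
        using B(1)[of z] that r by linarith
    qed (use J r R \<mu> B M lim in auto)
    also have "r powr (\<mu> + 1) = r powr (\<mu> + 1/2) * sqrt r" 
      using powr_half_mult_sqrt[OF r(1), of \<mu>] by simp
    also have "4 * B * (r powr (\<mu> + 1/2) * sqrt r) \<le> 4 * B * (r powr (\<mu> + 1/2) * sqrt R)"
      using r B by (intro mult_left_mono) auto
    finally show "(\<Sum>j\<in>J. ?a j) \<le> 8 * B * r powr (\<mu> + 1/2) * sqrt R + 2 * M * (r / R) ^ Suc n"
      by (simp add: algebra_simps)
  qed
  then show ?thesis using r unfolding r_def by simp
qed

end

lemma Lipschitz_imp_tendsto_at_right: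
  fixes g :: "real \<Rightarrow> 'a::banach"
  assumes R: "0 < R" and L: "\<And>x y. \<lbrakk>0 < x; x < R; 0 < y; y < R\<rbrakk> \<Longrightarrow> norm (g x - g y) \<le> L * \<bar>x - y\<bar>"
  obtains c where "(g \<longlongrightarrow> c) (at_right 0)"
proof -
  have L': "norm (g x - g y) \<le> \<bar>L\<bar> * \<bar>x - y\<bar>" if "0 < x" "x < R" "0 < y" "y < R" for x y
    by (rule order_trans[OF L[OF that]]) (auto intro: mult_right_mono)
  \<comment> \<open>A sample sequence in the open interval tending to 0. By the Lipschitz bound its
    values form a Cauchy sequence, and the limit serves for the whole one-sided approach.\<close>
  define X where "X n = R / 2 / real (Suc n)" for n
  have X: "0 < X n" "X n < R" for n
    using R by (auto simp: X_def divide_simps intro: le_less_trans[of _ "R * 1"])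
  have X0: "X \<longlonglongrightarrow> 0" unfolding X_def
    using LIMSEQ_Suc[OF tendsto_divide_0[OF tendsto_const filterlim_at_top_imp_at_infinity[OF filterlim_real_sequentially]]] .
  have "Cauchy (\<lambda>n. g (X n))"
  proof (rule CauchyI)
    fix e :: real assume e: "e > 0"
    have "Cauchy X" using X0 LIMSEQ_imp_Cauchy by blast
    then obtain M where M: "\<And>m n. m \<ge> M \<Longrightarrow> n \<ge> M \<Longrightarrow> norm (X m - X n) < e / (\<bar>L\<bar> + 1)"
      using e CauchyD[of X "e / (\<bar>L\<bar> + 1)"] by fastforce
    have "norm (g (X m) - g (X n)) < e" if "m \<ge> M" "n \<ge> M" for m n
    proof -
      have "norm (g (X m) - g (X n)) \<le> \<bar>L\<bar> * norm (X m - X n)"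
        using L'[OF X X] by simp
      also have "\<dots> \<le> (\<bar>L\<bar> + 1) * norm (X m - X n)" by (intro mult_right_mono) auto
      also have "\<dots> < e" using M[OF that] by (simp add: pos_less_divide_eq mult.commute)
      finally show ?thesis .
    qed
    then show "\<exists>M. \<forall>m\<ge>M. \<forall>n\<ge>M. norm (g (X m) - g (X n)) < e" by blast
  qed
  then obtain c where c: "(\<lambda>n. g (X n)) \<longlonglongrightarrow> c" using Cauchy_convergent convergent_def by blast
  have "norm (g x - c) \<le> \<bar>L\<bar> * x" if "0 < x" "x < R" for x
  proof (rule tendsto_le[OF sequentially_bot])
    show "(\<lambda>n. norm (g x - g (X n))) \<longlonglongrightarrow> norm (g x - c)" by (intro tendsto_intros c)
    show "(\<lambda>n. \<bar>L\<bar> * \<bar>x - X n\<bar>) \<longlonglongrightarrow> \<bar>L\<bar> * x" using tendsto_mult[OF tendsto_const tendsto_rabs[OF tendsto_diff[OF tendsto_const X0]], of "\<bar>L\<bar>" x] that by simp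
    show "\<forall>\<^sub>F n in sequentially. norm (g x - g (X n)) \<le> \<bar>L\<bar> * \<bar>x - X n\<bar>"
      using L' that X by (intro always_eventually) blast
  qed
  then have "\<forall>\<^sub>F x in at_right 0. norm (g x - c) \<le> \<bar>L\<bar> * x"
    using R unfolding eventually_at_right_field by auto
  moreover have "((\<lambda>x. \<bar>L\<bar> * x) \<longlongrightarrow> 0) (at_right 0)"
    by (rule tendsto_eq_intros | simp)+
  ultimately have "((\<lambda>x. g x - c) \<longlongrightarrow> 0) (at_right 0)"
    by (rule Lim_null_comparison)
  then show ?thesis using that LIM_zero_iff by blast
qed

context C1_disc begin

lemma rcoef_tendsto_0:
  assumes R: "0 < R" "R \<le> R0" and K: "\<And>z. 0 < norm z \<Longrightarrow> norm z < R \<Longrightarrow> norm (f z) \<le> K * norm z powr p" and j: "of_int j < p"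
  shows "(rcoef f j \<longlongrightarrow> 0) (at_right 0)"
proof (rule Lim_null_comparison)
  have "norm (rcoef f j r) \<le> K * r powr (p - of_int j)" if r: "0 < r" "r < R" for r
  proof -
    have "norm (fcoef (\<lambda>z. f (of_real r * z)) j) \<le> K * r powr p"
    proof (rule fcoef_bound)
      show "continuous_on (sphere 0 1) (\<lambda>z. f (of_real r * z))" using r R by (intro cont_circle cont_f) auto
      show "norm (f (of_real r * z)) \<le> K * r powr p" if "norm z = 1" for z
        using K[of "of_real r * z"] r that by (simp add: norm_mult)
    qed
    then have "norm (rcoef f j r) \<le> K * r powr p / r powi j"
      unfolding rcoef_def using r by (simp add: norm_divide norm_power_int divide_right_mono)
    also have "\<dots> = K * r powr (p - of_int j)" using r by (simp add: powr_diff powr_real_of_int')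
    finally show ?thesis .
  qed
  then show "\<forall>\<^sub>F r in at_right 0. norm (rcoef f j r) \<le> K * r powr (p - of_int j)"
    using R unfolding eventually_at_right_field by auto
  have "((\<lambda>r. r powr (p - of_int j)) \<longlongrightarrow> 0 powr (p - of_int j)) (at_right 0)"
    by (rule tendsto_powr') (use j in \<open>auto intro!: tendsto_eq_intros simp: eventually_at_right_field intro: exI[of _ 1]\<close>)
  then show "((\<lambda>r. K * r powr (p - of_int j)) \<longlongrightarrow> 0) (at_right 0)"
    using j tendsto_mult[OF tendsto_const, of _ 0 "at_right 0" K] by simp
qed

lemma norm_bounded_cball:
  assumes "R < R0"
  obtains M where "\<And>z. norm z \<le> R \<Longrightarrow> norm (f z) \<le> M" "M > 0"
proof -
  have "bounded (f ` cball 0 R)" 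
    by (intro compact_imp_bounded compact_continuous_image continuous_on_subset[OF cont_f]) (use assms in auto)
  then obtain B where "B > 0" "\<forall>x\<in>f ` cball 0 R. norm x \<le> B" unfolding bounded_pos by blast
  then show ?thesis using that[of B] by auto
qed

end

section \<open>Vanishing order and leading term under the differential inequality\<close>

locale dbar_inequality = C1_disc +
  fixes C :: real
  assumes R0: "0 < R0" and C: "0 \<le> C" 
    and ineq: "z \<in> ball 0 R0 \<Longrightarrow> norm (dbar D z) \<le> C * norm (f z)"
    and f0: "f 0 = 0"
begin

definition vanish :: "nat \<Rightarrow> bool" where
  "vanish k \<longleftrightarrow> (\<exists>K \<delta>. \<delta> > 0 \<and> (\<forall>z. norm z < \<delta> \<longrightarrow> norm (f z) \<le> K * norm z ^ k))"

text \<open>For \<mu> = n + 1/2 the weighted supremum of |f| / |z|^\<mu> is finite by flatness.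
  \<open>growth_estimate\<close> bounds it by half of itself plus an explicit term, so it is at most
  4 M (2/R)^\<mu>. Letting n grow kills \<open>f\<close> on the disc of radius R/2.\<close>

lemma flat_imp_zero:
  assumes flat: "\<And>k. vanish k"
  obtains \<rho> where "\<rho> > 0" "\<And>z. norm z < \<rho> \<Longrightarrow> f z = 0"
proof -
  \<comment> \<open>The radius is small enough for 8 C R \<le> 1/2, which lets the supremum be
    absorbed in the left side. R \<le> 1 allows lowering exponents of |z|.\<close>
  define R where "R = min (R0 / 2) (min 1 (1 / (16 * (C + 1))))"
  have R: "0 < R" "R < R0" "R \<le> 1" "8 * C * R \<le> 1/2"
  proof -
    have "R \<le> 1 / (16 * (C + 1))" unfolding R_def by simp
    then have "8 * C * R \<le> 8 * C * (1 / (16 * (C + 1)))" using C by (intro mult_left_mono) auto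
    also have "\<dots> \<le> 1/2" using C by (simp add: field_simps)
    finally show "8 * C * R \<le> 1/2" .
    show "R \<le> 1" unfolding R_def by (rule min.coboundedI2, rule min.coboundedI1) simp
  qed (use R0 C in \<open>auto simp: R_def min_less_iff_disj\<close>)
  obtain M where M: "\<And>z. norm z \<le> R \<Longrightarrow> norm (f z) \<le> M" "M > 0" using norm_bounded_cball[OF R(2)] by blast
  have main: "norm (f z) \<le> 4 * M * (2 * norm z / R) powr (n + 1/2)" if z: "0 < norm z" "norm z \<le> R" for z and n :: nat
  proof -
    define \<mu> where "\<mu> = real n + 1/2"
    have \<mu>: "\<mu> > 0" unfolding \<mu>_def by simp
    define A where "A = {z::complex. 0 < norm z \<and> norm z \<le> R}"
    \<comment> \<open>Flatness of order n + 1 is used only to make the supremum finite. The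
      constants \<open>K\<close> and \<open>\<delta>\<close> depend on n and do not enter the final
      bound.\<close>
    obtain K \<delta> where K: "\<delta> > 0" "\<And>z. norm z < \<delta> \<Longrightarrow> norm (f z) \<le> K * norm z ^ Suc n" 
      using flat[of "Suc n"] unfolding vanish_def by blast
    have bdd: "norm (f z) / norm z powr \<mu> \<le> max \<bar>K\<bar> (M / \<delta> powr \<mu>)" if "z \<in> A" for z
    proof (cases "norm z < \<delta>")
      case True
      have "norm (f z) \<le> \<bar>K\<bar> * norm z ^ Suc n" 
        by (rule order_trans[OF K(2)[OF True]]) (intro mult_right_mono, auto)
      also have "norm z ^ Suc n = norm z powr (real (Suc n))" using that by (simp add: A_def powr_realpow del: power_Suc of_nat_Suc)
      also have "\<dots> \<le> norm z powr \<mu>" using that R by (intro powr_mono') (auto simp: A_def \<mu>_def)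
      finally have "norm (f z) \<le> \<bar>K\<bar> * norm z powr \<mu>" by (simp add: mult_left_mono)
      then have "norm (f z) / norm z powr \<mu> \<le> \<bar>K\<bar>" using that by (simp add: A_def pos_divide_le_eq)
      then show ?thesis by simp
    next
      case False
      have "norm (f z) / norm z powr \<mu> \<le> M / \<delta> powr \<mu>"
        using that False K(1) M \<mu> by (intro frac_le powr_mono2) (auto simp: A_def)
      then show ?thesis by simp
    qed
    define \<Phi> where "\<Phi> = (SUP z\<in>A. norm (f z) / norm z powr \<mu>)"
    have bddA: "bdd_above ((\<lambda>z. norm (f z) / norm z powr \<mu>) ` A)" using bdd by (intro bdd_aboveI2) auto
    have zA: "z \<in> A" using z by (simp add: A_def)
    have up: "norm (f z) / norm z powr \<mu> \<le> \<Phi>" if "z \<in> A" for z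
      unfolding \<Phi>_def by (rule cSUP_upper[OF that bddA])
    have \<Phi>0: "0 \<le> \<Phi>" by (rule order_trans[OF _ up[OF zA]]) auto
    have fle: "norm (f z) \<le> \<Phi> * norm z powr \<mu>" if "z \<in> A" for z
      using up[OF that] that by (simp add: A_def pos_divide_le_eq)
    have "\<Phi> \<le> \<Phi> / 2 + 2 * M * (2 / R) powr \<mu>"
      unfolding \<Phi>_def
    proof (rule cSUP_least)
      fix w assume w: "w \<in> A"
      show "norm (f w) / norm w powr \<mu> \<le> (SUP z\<in>A. norm (f z) / norm z powr \<mu>) / 2 + 2 * M * (2 / R) powr \<mu>"
        unfolding \<Phi>_def[symmetric]
      proof (cases "norm w \<le> R / 2")
        case True
        have w0: "0 < norm w" "norm w \<le> R" using w by (auto simp: A_def)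
        have "norm (f w) \<le> 8 * (C * \<Phi>) * norm w powr (\<mu> + 1/2) * sqrt R + 2 * M * (norm w / R) ^ Suc n"
        proof (rule growth_estimate[OF R(2) _ True])
          show "norm (dbar D z) \<le> C * \<Phi> * norm z powr \<mu>" if "0 < norm z" "norm z < R" for z
          proof -
            have "norm (dbar D z) \<le> C * norm (f z)" using that R by (intro ineq) auto
            also have "\<dots> \<le> C * (\<Phi> * norm z powr \<mu>)" using that C by (intro mult_left_mono fle) (auto simp: A_def)
            finally show ?thesis by simp
          qed
          show "(rcoef f j \<longlongrightarrow> 0) (at_right 0)" if "j \<le> int n" for j
            by (rule rcoef_tendsto_0[of R \<Phi> \<mu>]) (use that R fle in \<open>auto simp: A_def \<mu>_def\<close>)
        qed (use w0 C \<Phi>0 M \<mu>_def in auto)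
        also have "8 * (C * \<Phi>) * norm w powr (\<mu> + 1/2) * sqrt R = \<Phi> * norm w powr \<mu> * (8 * C * (sqrt (norm w) * sqrt R))"
          using w0 by (simp add: powr_add powr_half_sqrt)
        also have "\<dots> \<le> \<Phi> * norm w powr \<mu> * (8 * C * (sqrt R * sqrt R))"
          using w0 \<Phi>0 C R by (intro mult_left_mono mult_right_mono) auto
        also have "\<dots> \<le> \<Phi> * norm w powr \<mu> * (1 / 2)"
          using R \<Phi>0 by (intro mult_left_mono) auto
        also have "(norm w / R) ^ Suc n = (norm w / R) powr (real (Suc n))" using w0 R by (subst powr_realpow) auto
        also have "\<dots> \<le> (norm w / R) powr \<mu>" using w0 R by (intro powr_mono') (auto simp: \<mu>_def)
        also have "(norm w / R) powr \<mu> = norm w powr \<mu> * (1 / R) powr \<mu>"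
          using w0 R by (subst powr_mult[symmetric]) auto
        finally have "norm (f w) \<le> norm w powr \<mu> * (\<Phi> / 2 + 2 * M * (1 / R) powr \<mu>)"
          using M by (simp add: algebra_simps)
        also have "\<dots> \<le> norm w powr \<mu> * (\<Phi> / 2 + 2 * M * (2 / R) powr \<mu>)"
          using M R \<mu> by (intro mult_left_mono add_left_mono powr_mono2) (auto simp: divide_right_mono)
        finally show "norm (f w) / norm w powr \<mu> \<le> \<Phi> / 2 + 2 * M * (2 / R) powr \<mu>"
          using w0 by (simp add: pos_divide_le_eq mult.commute)
      next
        case False
        have "norm (f w) / norm w powr \<mu> \<le> M / (R / 2) powr \<mu>"
          using w False R M \<mu> by (intro frac_le powr_mono2) (auto simp: A_def)
        also have "\<dots> = M * (2 / R) powr \<mu>"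
          using R powr_mult[of "R/2" "2/R" \<mu>] by (simp add: field_simps)
        also have "\<dots> \<le> \<Phi> / 2 + 2 * M * (2 / R) powr \<mu>" using \<Phi>0 M by simp
        finally show "norm (f w) / norm w powr \<mu> \<le> \<Phi> / 2 + 2 * M * (2 / R) powr \<mu>" .
      qed
    qed (use zA in auto)
    then have \<Phi>le: "\<Phi> \<le> 4 * M * (2 / R) powr \<mu>" by simp
    have "norm (f z) \<le> \<Phi> * norm z powr \<mu>" by (rule fle[OF zA])
    also have "\<dots> \<le> 4 * M * (2 / R) powr \<mu> * norm z powr \<mu>" using \<Phi>le by (intro mult_right_mono) auto
    also have "\<dots> = 4 * M * (2 * norm z / R) powr \<mu>"
      using R z powr_mult[of "2/R" "norm z" \<mu>] by simp
    finally show ?thesis unfolding \<mu>_def .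
  qed
  have "f z = 0" if z: "norm z < R / 2" for z
  proof (cases "z = 0")
    case False
    define q where "q = 2 * norm z / R"
    have q: "0 < q" "q < 1" using z False R by (auto simp: q_def field_simps)
    \<comment> \<open>Since 2|z|/R < 1, the estimate \<open>main\<close> tends to 0 as n grows; its
      constant M does not depend on n.\<close>
    have "(\<lambda>n. 4 * M * (q ^ n * q powr (1/2))) \<longlonglongrightarrow> 4 * M * (0 * q powr (1/2))"
      using q by (intro tendsto_intros LIMSEQ_power_zero) auto
    moreover have "norm (f z) \<le> 4 * M * (q ^ n * q powr (1/2))" for n
      using main[of z n] z False R q unfolding q_def[symmetric] by (simp add: powr_add powr_realpow)
    ultimately have "norm (f z) \<le> 4 * M * (0 * q powr (1/2))"
      by (intro tendsto_lowerbound) auto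
    then show ?thesis by simp
  qed (simp add: f0)
  then show ?thesis using that[of "R/2"] R by auto
qed

lemma vanish_1: "vanish 1"
proof -
  have d: "(f has_derivative D 0) (at 0)" using R0 by (intro deriv) auto
  interpret d: bounded_linear "D 0" using d has_derivative_bounded_linear by blast
  obtain K where K: "\<And>x. norm (D 0 x) \<le> norm x * K" using d.bounded by blast
  from d obtain \<delta> where \<delta>: "\<delta> > 0" "\<And>y. norm (y - 0) < \<delta> \<Longrightarrow> norm (f y - f 0 - D 0 (y - 0)) \<le> 1 * norm (y - 0)"
    unfolding has_derivative_at_alt by (meson zero_less_one)
  have "norm (f z) \<le> (K + 1) * norm z ^ 1" if "norm z < \<delta>" for z
  proof -
    have "norm (f z) \<le> norm (D 0 z) + norm (f z - D 0 z)" by (metis add.commute diff_add_cancel norm_triangle_ineq)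
    also have "\<dots> \<le> norm z * K + norm z" using K[of z] \<delta>(2)[of z] that f0 by (intro add_mono) auto
    finally show ?thesis by (simp add: algebra_simps)
  qed
  then show ?thesis unfolding vanish_def using \<delta>(1) by blast
qed

text \<open>If \<open>f\<close> has order |z|^m then so has \<open>dbar\<close>, and division by r^m
  leaves a bounded radial derivative. A Lipschitz function on an interval (0, R) has a limit at
  0.\<close>

lemma rcoef_has_limit:
  assumes R: "0 < R" "R < R0" and K: "\<And>z. norm z \<le> R \<Longrightarrow> norm (f z) \<le> K * norm z ^ m"
  obtains c where "(rcoef f (int m) \<longlongrightarrow> c) (at_right 0)"
proof (rule Lipschitz_imp_tendsto_at_right[OF R(1), where g="rcoef f (int m)" and L = "2 * (C * K)"])
  fix x y assume xy: "0 < x" "x < R" "0 < y" "y < R"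
  show "norm (rcoef f (int m) x - rcoef f (int m) y) \<le> 2 * (C * K) * \<bar>x - y\<bar>"
    unfolding real_norm_def[symmetric]
  proof (rule differentiable_bound[OF convex_real_interval(8)])
    fix r assume r: "r \<in> {0<..<R}"
    let ?v = "2 * fcoef (\<lambda>z. dbar D (of_real r * z)) (int m + 1) / of_real r powi int m"
    show "(rcoef f (int m) has_derivative (\<lambda>h. h *\<^sub>R ?v)) (at r within {0<..<R})"
      using rcoef_deriv[of r "int m"] r R by (auto simp: has_vector_derivative_def intro: has_derivative_at_withinI)
    have "norm (fcoef (\<lambda>z. dbar D (of_real r * z)) (int m + 1)) \<le> C * K * r ^ m"
    proof (rule fcoef_bound)
      show "continuous_on (sphere 0 1) (\<lambda>z. dbar D (of_real r * z))" using r R by (intro cont_circle cont_dbar) auto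
      fix z :: complex assume z: "norm z = 1"
      have "norm (dbar D (of_real r * z)) \<le> C * norm (f (of_real r * z))" using r R z by (intro ineq) (auto simp: norm_mult)
      also have "\<dots> \<le> C * (K * r ^ m)" using K[of "of_real r * z"] r z C by (intro mult_left_mono) (auto simp: norm_mult)
      finally show "norm (dbar D (of_real r * z)) \<le> C * K * r ^ m" by simp
    qed
    then have "norm ?v \<le> 2 * (C * K)" using r by (simp add: norm_mult norm_divide norm_power pos_divide_le_eq)
    moreover have "onorm (\<lambda>h::real. h *\<^sub>R ?v) \<le> norm ?v" by (rule onorm_le) simp
    ultimately show "onorm (\<lambda>h::real. h *\<^sub>R ?v) \<le> 2 * (C * K)" by linarith
  qed (use xy in auto)
qed (use that in auto)

text \<open>The order m is the largest with f = O(|z|^m), and c is the limit of the m-th normalised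
  coefficient. Subtracting c z^m does not change \<open>dbar\<close> and makes all modes up to m
  tend to 0, so \<open>growth_estimate\<close> improves the remainder by half a power.\<close>

proposition asymptotics:
  assumes "\<not> (\<exists>\<rho>>0. \<forall>z. norm z < \<rho> \<longrightarrow> f z = 0)"
  obtains m c K \<delta> where "m \<ge> 1" "c \<noteq> 0" "\<delta> > 0" "\<delta> \<le> R0" "K > 0" "\<And>z. norm z < \<delta> \<Longrightarrow> norm (f z - c * z ^ m) \<le> K * norm z powr (m + 1/2)"
proof -
  have "\<not> (\<forall>k. vanish k)" using flat_imp_zero assms by metis
  define k where "k = (LEAST k. \<not> vanish k)"
  have k: "\<not> vanish k" "\<And>i. i < k \<Longrightarrow> vanish i"
    using \<open>\<not> (\<forall>k. vanish k)\<close> LeastI_ex[of "\<lambda>k. \<not> vanish k"] not_less_Least[of _ "\<lambda>k. \<not> vanish k"] unfolding k_def by blast+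
  have "vanish 0"
  proof -
    obtain M where "\<And>z. norm z \<le> R0 / 2 \<Longrightarrow> norm (f z) \<le> M" using norm_bounded_cball[of "R0/2"] R0 by auto
    then show ?thesis unfolding vanish_def using R0 by (intro exI[of _ M] exI[of _ "R0/2"]) auto
  qed
  \<comment> \<open>Orders 0 and 1 always hold, the latter by \<open>f0\<close> and
    differentiability. Hence m = k - 1 is at least 1.\<close>
  then have k2: "k \<ge> 2" using k vanish_1 by (metis One_nat_def less_2_cases not_le)
  define m where "m = k - 1"
  have m: "m \<ge> 1" "k = Suc m" "vanish m" using k2 k by (auto simp: m_def)
  obtain K' \<delta> where K': "\<delta> > 0" "\<And>z. norm z < \<delta> \<Longrightarrow> norm (f z) \<le> K' * norm z ^ m" using m(3) unfolding vanish_def by blast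
  define K where "K = \<bar>K'\<bar>"
  have K: "K \<ge> 0" "norm (f z) \<le> K * norm z ^ m" if "norm z < \<delta>" for z
    using K'(2)[OF that] order_trans[OF _ mult_right_mono[of K' "\<bar>K'\<bar>" "norm z ^ m"]] by (auto simp: K_def)
  have K0: "K \<ge> 0" by (simp add: K_def)
  define R where "R = min (\<delta> / 2) (min (R0 / 2) 1)"
  have R: "0 < R" "R < \<delta>" "R < R0" "R \<le> 1" using K'(1) R0 by (auto simp: R_def)
  have fK: "norm (f z) \<le> K * norm z ^ m" if "norm z \<le> R" for z using K that R by auto
  obtain c where c: "(rcoef f (int m) \<longlongrightarrow> c) (at_right 0)" using rcoef_has_limit[OF R(1,3) fK] by blast
  define h where "h z = f z - c * z ^ m" for z
  define D' where "D' z w = D z w - c * (of_nat m * z ^ (m - 1) * w)" for z w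
  interpret h: C1_disc h D' R0
  proof
    show "(h has_derivative D' z) (at z)" if "z \<in> ball 0 R0" for z
      unfolding h_def D'_def by (auto intro!: derivative_eq_intros deriv that simp: mult_ac)
  qed (auto simp: D'_def intro!: continuous_intros cont1 conti)
  have dbar_eq: "dbar D' z = dbar D z" for z
    unfolding dbar_def D'_def by (simp add: algebra_simps)
  obtain M where M: "\<And>z. norm z \<le> R \<Longrightarrow> norm (h z) \<le> M" "M > 0" using h.norm_bounded_cball[OF R(3)] by blast
  have rh: "rcoef h j r = rcoef f j r - (if j = int m then c else 0)" if "0 < r" "r < R0" for j r
  proof -
    have "fcoef (\<lambda>z. h (of_real r * z)) j = fcoef (\<lambda>z. f (of_real r * z) - (c * of_real r ^ m) * z powi int m) j"
      unfolding h_def by (simp add: power_mult_distrib mult_ac)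
    also have "\<dots> = fcoef (\<lambda>z. f (of_real r * z)) j - fcoef (\<lambda>z. (c * of_real r ^ m) * z powi int m) j"
      using that by (intro fcoef_diff cont_circle cont_f continuous_intros continuous_on_sphere_powi) auto
    also have "fcoef (\<lambda>z. (c * of_real r ^ m) * z powi int m) j = (if j = int m then c * of_real r ^ m else 0)"
      by (simp only: fcoef_cmult fcoef_powi) auto
    finally show ?thesis unfolding rcoef_def using that by (auto simp: diff_divide_distrib)
  qed
  have limh: "(rcoef h j \<longlongrightarrow> 0) (at_right 0)" if "j \<le> int m" for j
  proof -
    have "((\<lambda>r. rcoef f j r - (if j = int m then c else 0)) \<longlongrightarrow> 0) (at_right 0)"
    proof (cases "j = int m")
      case True
      then show ?thesis using c LIM_zero by auto
    next
      case False
      have "(rcoef f j \<longlongrightarrow> 0) (at_right 0)"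
        by (rule rcoef_tendsto_0[of R K "real m"]) (use R fK that False in \<open>auto simp: powr_realpow\<close>)
      then show ?thesis using False by simp
    qed
    then show ?thesis
      by (rule Lim_transform_eventually) 
        (use R0 rh in \<open>auto simp: eventually_at_right_field intro!: exI[of _ R0]\<close>)
  qed
  define K2 where "K2 = 8 * (C * K) * sqrt R + 2 * M / R ^ Suc m"
  have K2: "K2 > 0" using C K0 M(2) R by (auto simp: K2_def intro!: add_nonneg_pos)
  have hle: "norm (h z) \<le> K2 * norm z powr (m + 1/2)" if z: "norm z \<le> R / 2" for z
  proof (cases "z = 0")
    case True
    then show ?thesis using f0 m by (simp add: h_def)
  next
    case False
    have "norm (h z) \<le> 8 * (C * K) * norm z powr (real m + 1/2) * sqrt R + 2 * M * (norm z / R) ^ Suc m"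
    proof (rule h.growth_estimate[OF R(3) _ z])
      show "norm (dbar D' z) \<le> C * K * norm z powr real m" if "0 < norm z" "norm z < R" for z
      proof -
        have "norm (dbar D z) \<le> C * norm (f z)" using that R by (intro ineq) auto
        also have "\<dots> \<le> C * (K * norm z ^ m)" using that C by (intro mult_left_mono fK) auto
        finally show ?thesis unfolding dbar_eq using that by (simp add: powr_realpow)
      qed
    qed (use False C K0 M limh in auto)
    also have "(norm z / R) ^ Suc m = norm z powr real (Suc m) / R ^ Suc m"
      using False unfolding power_divide by (subst powr_realpow) auto
    also have "norm z powr real (Suc m) \<le> norm z powr (m + 1/2)"
      using z R False by (intro powr_mono') auto
    finally show ?thesis using M R by (simp add: K2_def field_simps)
  qed
  \<comment> \<open>If c were 0, the remainder estimate would read f = O(|z|^(m + 1/2)). A second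
    application, with \<mu> = m + 1/2, would give order m + 1 and contradict the choice of
    k.\<close>
  have "c \<noteq> 0"
  proof
    assume c0: "c = 0"
    define R' where "R' = R / 2"
    have R': "0 < R'" "R' < R0" using R by (auto simp: R'_def)
    have fle: "norm (f z) \<le> K2 * norm z powr (m + 1/2)" if "norm z \<le> R'" for z
      using hle[of z] that c0 by (simp add: h_def R'_def)
    obtain M' where M': "\<And>z. norm z \<le> R' \<Longrightarrow> norm (f z) \<le> M'" "M' > 0" using norm_bounded_cball[OF R'(2)] by blast
    define K3 where "K3 = 8 * (C * K2) * sqrt R' + 2 * M' / R' ^ Suc m"
    have "norm (f z) \<le> K3 * norm z ^ Suc m" if z: "norm z < R' / 2" for z
    proof (cases "z = 0")
      case True
      then show ?thesis using f0 m by simp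
    next
      case False
      have "norm (f z) \<le> 8 * (C * K2) * norm z powr ((real m + 1/2) + 1/2) * sqrt R' + 2 * M' * (norm z / R') ^ Suc m"
      proof (rule growth_estimate[OF R'(2)])
        show "norm (dbar D z) \<le> C * K2 * norm z powr (real m + 1/2)" if "0 < norm z" "norm z < R'" for z
        proof -
          have "norm (dbar D z) \<le> C * norm (f z)" using that R' by (intro ineq) auto
          also have "\<dots> \<le> C * (K2 * norm z powr (m + 1/2))" using that C by (intro mult_left_mono fle) auto
          finally show ?thesis by simp
        qed
        show "(rcoef f j \<longlongrightarrow> 0) (at_right 0)" if "j \<le> int m" for j
          by (rule rcoef_tendsto_0[of R' K2 "m + 1/2"]) (use R' fle that in auto)
      qed (use False C K2 M' z in auto)
      also have "norm z powr ((real m + 1/2) + 1/2) = norm z ^ Suc m"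
        using False powr_realpow[of "norm z" "Suc m"] by (simp add: add.commute)
      finally show ?thesis by (simp add: K3_def field_simps)
    qed
    then have "vanish (Suc m)" unfolding vanish_def using R' by (intro exI[of _ K3] exI[of _ "R'/2"]) auto
    then show False using k(1) m(2) by simp
  qed
  then show ?thesis using that[of m c "R/2" K2] m(1) R K2 hle unfolding h_def by auto
qed

end

section \<open>The local normal form at a critical point\<close>

text \<open>Schwarz's theorem: two applications of the mean value theorem show that the second
  difference of \<open>u\<close> over a square of side s is s^2 times a mixed partial at a nearby
  point, in either order of the directions. Continuity of the partials finishes.\<close>

lemma C2_mixed_partials_eq:
  fixes u :: "real^2 \<Rightarrow> real" and p :: "2 \<Rightarrow> real^2 \<Rightarrow> real" and q :: "2 \<Rightarrow> 2 \<Rightarrow> real^2 \<Rightarrow> real"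
  assumes \<Omega>: "open \<Omega>" "x \<in> \<Omega>"
    and du: "\<And>y. y \<in> \<Omega> \<Longrightarrow> (u has_derivative (\<lambda>h. \<Sum>i\<in>UNIV. p i y * h $ i)) (at y)"
    and dp: "\<And>i y. y \<in> \<Omega> \<Longrightarrow> (p i has_derivative (\<lambda>h. \<Sum>j\<in>UNIV. q i j y * h $ j)) (at y)"
    and q: "\<And>i j. continuous_on \<Omega> (q i j)"
  shows "q i j x = q j i x"
proof (rule ccontr)
  assume neq: "q i j x \<noteq> q j i x"
  define e where "e = \<bar>q i j x - q j i x\<bar> / 2"
  have e: "e > 0" using neq by (simp add: e_def)
  have "continuous (at x) (q i j)" "continuous (at x) (q j i)"
    using q \<Omega> continuous_on_eq_continuous_at by blast+
  then have "\<exists>d>0. \<forall>y. dist y x < d \<longrightarrow> dist (q i j y) (q i j x) < e"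
    "\<exists>d>0. \<forall>y. dist y x < d \<longrightarrow> dist (q j i y) (q j i x) < e"
    using e by (simp_all add: continuous_at_eps_delta)
  then obtain d1 d2 where d1: "d1 > 0" "\<And>y. dist y x < d1 \<Longrightarrow> dist (q i j y) (q i j x) < e"
    and d2: "d2 > 0" "\<And>y. dist y x < d2 \<Longrightarrow> dist (q j i y) (q j i x) < e"
    by blast
  obtain d3 where d3: "d3 > 0" "ball x d3 \<subseteq> \<Omega>" using \<Omega> open_contains_ball by blast
  \<comment> \<open>Points of the square are at distance at most 2 s from x, so a third of the
    smallest radius is enough.\<close>
  define s where "s = min d1 (min d2 d3) / 3"
  have s: "s > 0" "2 * s < d1" "2 * s < d2" "2 * s < d3" using d1 d2 d3 by (auto simp: s_def)
  have dist: "dist (x + a *\<^sub>R axis k 1 + b *\<^sub>R axis l 1) x \<le> 2 * s" if "0 \<le> a" "a \<le> s" "0 \<le> b" "b \<le> s" for a b and k l :: 2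
  proof -
    have "norm (a *\<^sub>R axis k 1 + b *\<^sub>R axis l (1::real)) \<le> a + b"
      using that by (intro norm_triangle_le) (auto simp: norm_axis_1)
    then show ?thesis using that by (simp add: dist_norm)
  qed
  have in\<Omega>: "x + a *\<^sub>R axis k 1 + b *\<^sub>R axis l 1 \<in> \<Omega>" if "0 \<le> a" "a \<le> s" "0 \<le> b" "b \<le> s" for a b and k l :: 2
    using dist[OF that, of k l] s d3 by (auto simp: dist_commute)
  have chain: "((\<lambda>a. w (y + a *\<^sub>R axis k 1)) has_real_derivative D (axis k 1)) (at a)"
    if "(w has_derivative D) (at (y + a *\<^sub>R axis k 1))" for w :: "real^2 \<Rightarrow> real" and D y a and k :: 2
  proof -
    interpret bounded_linear D using that has_derivative_bounded_linear by blast
    have "((\<lambda>a. y + a *\<^sub>R axis k 1) has_derivative (\<lambda>h. h *\<^sub>R axis k 1)) (at a)"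
      by (auto intro!: derivative_eq_intros)
    from diff_chain_at[OF this that] show ?thesis
      by (simp add: has_field_derivative_def o_def scaleR mult.commute[of _ "D _"] fun_eq_iff)
  qed
  have sum_axis: "(\<Sum>i\<in>UNIV. c i * axis k (1::real) $ i) = c k" for c :: "2 \<Rightarrow> real" and k
    by (simp add: axis_def if_distrib cong: if_cong)
  have main: "\<exists>y. dist y x \<le> 2 * s \<and> u (x + s *\<^sub>R axis k 1 + s *\<^sub>R axis l 1) - u (x + s *\<^sub>R axis k 1) - u (x + s *\<^sub>R axis l 1) + u x = s * s * q k l y" for k l
  proof -
    define G where "G a = u ((x + s *\<^sub>R axis l 1) + a *\<^sub>R axis k 1) - u (x + a *\<^sub>R axis k 1)" for a
    have "\<exists>z>0. z < s \<and> G s - G 0 = (s - 0) * (p k ((x + s *\<^sub>R axis l 1) + z *\<^sub>R axis k 1) - p k (x + z *\<^sub>R axis k 1))"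
    proof (rule MVT2[OF s(1)])
      fix a assume a: "0 \<le> a" "a \<le> s"
      have "(x + s *\<^sub>R axis l 1) + a *\<^sub>R axis k 1 \<in> \<Omega>" "x + a *\<^sub>R axis k 1 \<in> \<Omega>"
        using in\<Omega>[of a s k l] in\<Omega>[of a 0 k l] a s by (auto simp: algebra_simps)
      then show "(G has_real_derivative p k ((x + s *\<^sub>R axis l 1) + a *\<^sub>R axis k 1) - p k (x + a *\<^sub>R axis k 1)) (at a)"
        unfolding G_def by (intro DERIV_diff) (use chain[OF du] sum_axis in auto)
    qed
    then obtain z where z: "0 < z" "z < s" "G s - G 0 = s * (p k ((x + s *\<^sub>R axis l 1) + z *\<^sub>R axis k 1) - p k (x + z *\<^sub>R axis k 1))"
      by auto
    have "\<exists>b>0. b < s \<and> p k ((x + z *\<^sub>R axis k 1) + s *\<^sub>R axis l 1) - p k ((x + z *\<^sub>R axis k 1) + 0 *\<^sub>R axis l 1) = (s - 0) * q k l ((x + z *\<^sub>R axis k 1) + b *\<^sub>R axis l 1)"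
    proof (rule MVT2[OF s(1)])
      fix b assume b: "0 \<le> b" "b \<le> s"
      have "(x + z *\<^sub>R axis k 1) + b *\<^sub>R axis l 1 \<in> \<Omega>" using in\<Omega>[of z b k l] b z by auto
      from chain[OF dp[OF this, of k]]
      show "((\<lambda>b. p k ((x + z *\<^sub>R axis k 1) + b *\<^sub>R axis l 1)) has_real_derivative q k l ((x + z *\<^sub>R axis k 1) + b *\<^sub>R axis l 1)) (at b)"
        unfolding sum_axis .
    qed
    then obtain b where b: "0 < b" "b < s" "p k ((x + z *\<^sub>R axis k 1) + s *\<^sub>R axis l 1) - p k (x + z *\<^sub>R axis k 1) = s * q k l ((x + z *\<^sub>R axis k 1) + b *\<^sub>R axis l 1)"
      by auto
    show ?thesis
    proof (intro exI conjI)
      show "dist (x + z *\<^sub>R axis k 1 + b *\<^sub>R axis l 1) x \<le> 2 * s" using dist[of z b k l] z b by auto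
      have "G s - G 0 = s * (s * q k l (x + z *\<^sub>R axis k 1 + b *\<^sub>R axis l 1))"
        unfolding z(3) b(3)[symmetric] by (simp add: algebra_simps)
      then show "u (x + s *\<^sub>R axis k 1 + s *\<^sub>R axis l 1) - u (x + s *\<^sub>R axis k 1) - u (x + s *\<^sub>R axis l 1) + u x = s * s * q k l (x + z *\<^sub>R axis k 1 + b *\<^sub>R axis l 1)"
        unfolding G_def by (simp add: algebra_simps)
    qed
  qed
  obtain y1 where y1: "dist y1 x \<le> 2 * s" "u (x + s *\<^sub>R axis i 1 + s *\<^sub>R axis j 1) - u (x + s *\<^sub>R axis i 1) - u (x + s *\<^sub>R axis j 1) + u x = s * s * q i j y1"
    using main by blast
  obtain y2 where y2: "dist y2 x \<le> 2 * s" "u (x + s *\<^sub>R axis j 1 + s *\<^sub>R axis i 1) - u (x + s *\<^sub>R axis j 1) - u (x + s *\<^sub>R axis i 1) + u x = s * s * q j i y2"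
    using main by blast
  have "x + s *\<^sub>R axis j 1 + s *\<^sub>R axis i 1 = x + s *\<^sub>R axis i 1 + s *\<^sub>R axis j 1" by simp
  then have "u (x + s *\<^sub>R axis j 1 + s *\<^sub>R axis i 1) = u (x + s *\<^sub>R axis i 1 + s *\<^sub>R axis j 1)" by (rule arg_cong)
  then have "s * s * q i j y1 = s * s * q j i y2" using y1(2) y2(2) by linarith
  then have "q i j y1 = q j i y2" using s by simp
  moreover have "dist (q i j y1) (q i j x) < e" "dist (q j i y2) (q j i x) < e"
    using d1(2)[of y1] d2(2)[of y2] y1(1) y2(1) s by auto
  moreover have "\<bar>q i j x - q j i x\<bar> \<le> \<bar>q i j y1 - q i j x\<bar> + \<bar>q i j y1 - q j i x\<bar>" by arith
  ultimately show False using neq unfolding e_def dist_real_def by simp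
qed

text \<open>In the linear coordinates \<open>\<Lambda>\<close> the function is Re z^n up to higher
  order. The complex number \<open>g z\<close> encodes the gradient, so the last clause is the
  differentiated expansion. It is needed to see that the level set is made of arcs and that no flat
  ball lies nearby.\<close>

definition saddle_normal_form :: "(real^2 \<Rightarrow> real) \<Rightarrow> (real^2) set \<Rightarrow> real^2 \<Rightarrow> nat \<Rightarrow> (complex \<Rightarrow> real^2) \<Rightarrow> bool" where
  "saddle_normal_form u \<Omega> x0 n \<Lambda> \<longleftrightarrow> 2 \<le> n \<and> linear \<Lambda> \<and> bij \<Lambda> \<and>
     (\<exists>g K \<delta>. K > 0 \<and> \<delta> > 0 \<and> (\<forall>z. norm z < \<delta> \<longrightarrow> x0 + \<Lambda> z \<in> \<Omega> \<and>
        \<bar>u (x0 + \<Lambda> z) - u x0 - Re (z ^ n)\<bar> \<le> K * norm z powr (n + 1/2) \<and>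
        ((\<lambda>z. u (x0 + \<Lambda> z)) has_derivative (\<lambda>h. Re (g z * h))) (at z) \<and>
        norm (g z - of_nat n * z ^ (n - 1)) \<le> K * norm z powr (n - 1/2)))"

text \<open>The mean value inequality on the disc of radius |z|, applied to the difference of
  \<open>U\<close> and the real part of the primitive of c z^m, integrates the expansion of the
  gradient and gains one power.\<close>

lemma real_gradient_primitive_estimate:
  fixes U :: "complex \<Rightarrow> real"
  assumes \<delta>: "\<delta> > 0" and K: "K \<ge> 0"
    and dU: "\<And>z. norm z < \<delta> \<Longrightarrow> (U has_derivative (\<lambda>h. Re (f z * h))) (at z)"
    and f: "\<And>z. norm z < \<delta> \<Longrightarrow> norm (f z - c * z ^ m) \<le> K * norm z powr (m + 1/2)"
    and z: "norm z < \<delta>"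
  shows "\<bar>U z - U 0 - Re (c * z ^ Suc m / of_nat (Suc m))\<bar> \<le> K * norm z powr (Suc m + 1/2)"
proof (cases "z = 0")
  case False
  define V where "V z = U z - Re (c * z ^ Suc m / of_nat (Suc m))" for z
  have dV: "(V has_derivative (\<lambda>h. Re ((f w - c * w ^ m) * h))) (at w)" if "norm w < \<delta>" for w
  proof -
    have "((\<lambda>z. c * z ^ Suc m / of_nat (Suc m)) has_field_derivative c * w ^ m) (at w)"
      by (auto intro!: derivative_eq_intros simp: field_simps simp del: of_nat_Suc power_Suc)
    then have "((\<lambda>z. c * z ^ Suc m / of_nat (Suc m)) has_derivative (\<lambda>h. c * w ^ m * h)) (at w)"
      by (simp add: has_field_derivative_def mult.commute[of _ "c * _"] )
    then have "((\<lambda>z. Re (c * z ^ Suc m / of_nat (Suc m))) has_derivative (\<lambda>h. Re (c * w ^ m * h))) (at w)"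
      by (rule has_derivative_Re)
    from has_derivative_diff[OF dU[OF that] this] show ?thesis
      unfolding V_def by (simp add: algebra_simps)
  qed
  have "norm (V z - V 0) \<le> (K * norm z powr (m + 1/2)) * norm (z - 0)"
  proof (rule differentiable_bound[of "cball 0 (norm z)"])
    fix w :: complex assume w: "w \<in> cball 0 (norm z)"
    then have w\<delta>: "norm w < \<delta>" using z by simp
    show "(V has_derivative (\<lambda>h. Re ((f w - c * w ^ m) * h))) (at w within cball 0 (norm z))"
      using dV[OF w\<delta>] has_derivative_at_withinI by blast
    show "onorm (\<lambda>h. Re ((f w - c * w ^ m) * h)) \<le> K * norm z powr (m + 1/2)"
    proof (rule onorm_le)
      fix h
      have "norm (Re ((f w - c * w ^ m) * h)) \<le> norm (f w - c * w ^ m) * norm h"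
        unfolding norm_mult[symmetric] real_norm_def by (rule abs_Re_le_cmod)
      also have "\<dots> \<le> (K * norm z powr (m + 1/2)) * norm h"
      proof (rule mult_right_mono)
        have "norm (f w - c * w ^ m) \<le> K * norm w powr (m + 1/2)" by (rule f[OF w\<delta>])
        also have "\<dots> \<le> K * norm z powr (m + 1/2)" using w K by (intro mult_left_mono powr_mono2) auto
        finally show "norm (f w - c * w ^ m) \<le> K * norm z powr (m + 1/2)" .
      qed simp
      finally show "norm (Re ((f w - c * w ^ m) * h)) \<le> K * norm z powr (m + 1/2) * norm h" .
    qed
  qed auto
  also have "\<dots> = K * norm z powr (Suc m + 1/2)"
    using False powr_add[of "norm z" "m + 1/2" 1] by (simp add: add.commute add.left_commute)
  finally show ?thesis unfolding V_def by simp
qed simp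

lemma sum_2: "(\<Sum>i\<in>(UNIV::2 set). c i) = c 1 + c (2::2)"
  by (simp add: UNIV_2)

text \<open>With U(z) = u(x0 + L z) and L L^T equal to the symmetric part of a(0), twice
  \<open>dbar\<close> of f = U_x - i U_y is the Laplacian of U, that is the sum of a_ij(0) u_ij.
  Subtracting the equation leaves differences a(0) - a(grad u), which are O(|grad u|) = O(|f|).
  Either \<open>f\<close> vanishes near 0 and \<open>u\<close> is constant there, or
  \<open>asymptotics\<close> applies.\<close>

proposition critical_point_dichotomy:
  fixes u :: "real^2 \<Rightarrow> real" and p :: "2 \<Rightarrow> real^2 \<Rightarrow> real" and q :: "2 \<Rightarrow> 2 \<Rightarrow> real^2 \<Rightarrow> real"
    and a :: "2 \<Rightarrow> 2 \<Rightarrow> real^2 \<Rightarrow> real"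
  assumes \<Omega>: "open \<Omega>" "x0 \<in> \<Omega>"
    and du: "\<And>y. y \<in> \<Omega> \<Longrightarrow> (u has_derivative (\<lambda>h. \<Sum>i\<in>UNIV. p i y * h $ i)) (at y)"
    and dp: "\<And>i y. y \<in> \<Omega> \<Longrightarrow> (p i has_derivative (\<lambda>h. \<Sum>j\<in>UNIV. q i j y * h $ j)) (at y)"
    and q: "\<And>i j. continuous_on \<Omega> (q i j)"
    and crit: "\<And>i. p i x0 = 0"
    and a: "\<And>i j. a i j differentiable (at 0)"
    and pos: "\<And>\<xi>::real^2. \<xi> \<noteq> 0 \<Longrightarrow> (\<Sum>i\<in>UNIV. \<Sum>j\<in>UNIV. a i j 0 * \<xi> $ i * \<xi> $ j) > 0"
    and pde: "\<And>x. x \<in> \<Omega> \<Longrightarrow> (\<Sum>i\<in>UNIV. \<Sum>j\<in>UNIV. a i j (\<chi> i. p i x) * q i j x) = 0"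
  shows "(\<exists>\<rho>>0. \<forall>x\<in>ball x0 \<rho>. u x = u x0) \<or> (\<exists>n \<Lambda>. saddle_normal_form u \<Omega> x0 n \<Lambda>)"
proof -
  define P Q S where "P = a 1 1 0" and "Q = (a 1 2 0 + a 2 1 0) / 2" and "S = a 2 2 0"
  have P: "P > 0"
  proof -
    have "axis (1::2) (1::real) \<noteq> 0" by simp
    from pos[OF this] show ?thesis by (simp add: sum_2 P_def axis_def)
  qed
  have "P * (P * S - Q * Q) > 0"
  proof -
    \<comment> \<open>This test vector turns positivity of the form into P (P S - Q^2) > 0, the
      positivity of the determinant.\<close>
    have "vector [-Q, P] \<noteq> (0::real^2)" using P vec_eq_iff[of "vector [-Q, P]" "0::real^2"] by (auto simp: forall_2)
    from pos[OF this] show ?thesis by (simp add: sum_2 P_def Q_def S_def field_simps)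
  qed
  then have PS: "S - Q\<^sup>2 / P > 0" using P by (simp add: zero_less_mult_iff power2_eq_square field_simps)
  \<comment> \<open>The Cholesky factor of the symmetric matrix with entries P, Q, S;
    \<open>L\<close> below is the corresponding lower triangular map.\<close>
  define \<alpha> \<beta> \<gamma> where "\<alpha> = sqrt P" and "\<beta> = Q / sqrt P" and "\<gamma> = sqrt (S - Q\<^sup>2 / P)"
  have abc: "\<alpha> > 0" "\<gamma> > 0" "\<alpha> * \<alpha> = P" "\<alpha> * \<beta> = Q" "\<beta> * \<beta> + \<gamma> * \<gamma> = S"
    using P PS by (auto simp: \<alpha>_def \<beta>_def \<gamma>_def power2_eq_square)
  define L :: "complex \<Rightarrow> real^2" where "L z = vector [\<alpha> * Re z, \<beta> * Re z + \<gamma> * Im z]" for z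
  have L1: "L z $ 1 = \<alpha> * Re z" and L2: "L z $ 2 = \<beta> * Re z + \<gamma> * Im z" for z by (auto simp: L_def)
  have linL: "linear L"
    by (rule linearI) (auto simp: vec_eq_iff forall_2 L1 L2 algebra_simps)
  then have bL: "bounded_linear L" by (simp add: linear_conv_bounded_linear)
  have injL: "inj L"
    unfolding linear_injective_0[OF linL] using abc by (auto simp: vec_eq_iff forall_2 L1 L2 complex_eq_iff)
  have surjL: "surj L"
  proof (rule surjI)
    fix y :: "real^2"
    show "L (Complex (y $ 1 / \<alpha>) ((y $ 2 - \<beta> * (y $ 1 / \<alpha>)) / \<gamma>)) = y"
      using abc by (auto simp: vec_eq_iff forall_2 L1 L2)
  qed
  have dL: "((\<lambda>z. x0 + L z) has_derivative L) (at z)" for z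
    by (auto intro!: derivative_eq_intros bounded_linear_imp_has_derivative bL)
  have cL: "continuous_on A (\<lambda>z. x0 + L z)" for A
    by (intro continuous_intros linear_continuous_on bL)
  have L0: "L 0 = 0" using linL linear_0 by blast
  define f where "f z = Complex (\<alpha> * p 1 (x0 + L z) + \<beta> * p 2 (x0 + L z)) (- (\<gamma> * p 2 (x0 + L z)))" for z
  have grad_f: "norm (\<chi> i. p i (x0 + L z)) \<le> (1 / \<alpha> + \<bar>\<beta>\<bar> / (\<alpha> * \<gamma>) + 1 / \<gamma>) * norm (f z)" for z
  proof -
    have f1: "\<bar>\<alpha> * p 1 (x0 + L z) + \<beta> * p 2 (x0 + L z)\<bar> \<le> norm (f z)" using abs_Re_le_cmod[of "f z"] by (simp add: f_def)
    have "\<bar>\<gamma> * p 2 (x0 + L z)\<bar> \<le> norm (f z)" using abs_Im_le_cmod[of "f z"] by (simp add: f_def)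
    then have p2: "\<bar>p 2 (x0 + L z)\<bar> \<le> norm (f z) / \<gamma>" using abc by (simp add: abs_mult field_simps)
    have "\<alpha> * \<bar>p 1 (x0 + L z)\<bar> = \<bar>(\<alpha> * p 1 (x0 + L z) + \<beta> * p 2 (x0 + L z)) - \<beta> * p 2 (x0 + L z)\<bar>"
      using abc by (simp add: abs_mult)
    also have "\<dots> \<le> norm (f z) + \<bar>\<beta>\<bar> * (norm (f z) / \<gamma>)"
      using f1 mult_left_mono[OF p2, of "\<bar>\<beta>\<bar>"] by (simp add: abs_mult[symmetric])
    finally have "\<bar>p 1 (x0 + L z)\<bar> \<le> (norm (f z) + \<bar>\<beta>\<bar> * (norm (f z) / \<gamma>)) / \<alpha>"
      using abc by (simp add: pos_le_divide_eq mult.commute)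
    moreover have "norm (\<chi> i. p i (x0 + L z)) \<le> \<bar>p 1 (x0 + L z)\<bar> + \<bar>p 2 (x0 + L z)\<bar>"
      using norm_le_l1_cart[of "\<chi> i. p i (x0 + L z)"] by (simp add: sum_2)
    ultimately have "norm (\<chi> i. p i (x0 + L z)) \<le> (norm (f z) + \<bar>\<beta>\<bar> * (norm (f z) / \<gamma>)) / \<alpha> + norm (f z) / \<gamma>"
      using p2 by linarith
    also have "\<dots> = (1 / \<alpha> + \<bar>\<beta>\<bar> / (\<alpha> * \<gamma>) + 1 / \<gamma>) * norm (f z)"
      using abc by (simp add: field_simps)
    finally show ?thesis .
  qed
  define D where "D z w = (let h = L w; d1 = q 1 1 (x0 + L z) * h $ 1 + q 1 2 (x0 + L z) * h $ 2; 
       d2 = q 2 1 (x0 + L z) * h $ 1 + q 2 2 (x0 + L z) * h $ 2 in Complex (\<alpha> * d1 + \<beta> * d2) (- (\<gamma> * d2)))" for z w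
  have openpre: "open {z. x0 + L z \<in> \<Omega>}" 
    using open_vimage[OF \<Omega>(1) cL[of UNIV]] by (simp add: vimage_def)
  have cp: "continuous_on \<Omega> (p i)" for i
    using dp \<Omega> by (meson continuous_at_imp_continuous_on has_derivative_continuous)
  obtain r1 where r1: "r1 > 0" "\<And>z::complex. norm z < r1 \<Longrightarrow> x0 + L z \<in> \<Omega>"
  proof -
    have "0 \<in> {z. x0 + L z \<in> \<Omega>}" using \<Omega> L0 by simp
    then obtain r where "r > 0" "ball 0 r \<subseteq> {z. x0 + L z \<in> \<Omega>}" using openpre open_contains_ball by blast
    then show ?thesis using that[of r] by (auto simp: subset_iff)
  qed
  obtain CA \<delta>a where CA: "CA \<ge> 0" "\<delta>a > 0" "\<And>i j (v::real^2). norm v < \<delta>a \<Longrightarrow> \<bar>a i j v - a i j 0\<bar> \<le> CA * norm v"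
  proof -
    have "\<exists>C d. 0 \<le> C \<and> d > 0 \<and> (\<forall>v::real^2. norm v < d \<longrightarrow> \<bar>a i j v - a i j 0\<bar> \<le> C * norm v)" for i j
    proof -
      obtain A where A: "(a i j has_derivative A) (at 0)" using a unfolding differentiable_def by blast
      interpret A: bounded_linear A using A has_derivative_bounded_linear by blast
      obtain K where K: "K \<ge> 0" "\<And>x. norm (A x) \<le> norm x * K" using A.nonneg_bounded by blast
      from A obtain \<delta> where \<delta>: "\<delta> > 0" "\<And>y. norm (y - 0) < \<delta> \<Longrightarrow> norm (a i j y - a i j 0 - A (y - 0)) \<le> 1 * norm (y - 0)"
        unfolding has_derivative_at_alt by (meson zero_less_one)
      have "\<bar>a i j v - a i j 0\<bar> \<le> (K + 1) * norm v" if "norm v < \<delta>" for v :: "real^2"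
        using K(2)[of v] \<delta>(2)[of v] that by (simp add: algebra_simps)
      then show ?thesis using \<delta>(1) K(1) by (intro exI[of _ "K + 1"] exI[of _ \<delta>]) auto
    qed
    then obtain C d where Cd: "\<And>i j. 0 \<le> C i j" "\<And>i j. d i j > 0" "\<And>i j (v::real^2). norm v < d i j \<Longrightarrow> \<bar>a i j v - a i j 0\<bar> \<le> C i j * norm v" by metis
    show ?thesis
    proof (rule that[of "\<Sum>i\<in>UNIV. \<Sum>j\<in>UNIV. C i j" "Min (range (\<lambda>(i, j). d i j))"])
      show "0 \<le> (\<Sum>i\<in>UNIV. \<Sum>j\<in>UNIV. C i j)" by (intro sum_nonneg Cd)
      show "Min (range (\<lambda>(i, j). d i j)) > 0" using Cd by (subst Min_gr_iff) auto
      fix i j and v :: "real^2" assume v: "norm v < Min (range (\<lambda>(i, j). d i j))"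
      have "Min (range (\<lambda>(i, j). d i j)) \<le> d i j" by (rule Min_le) (auto intro: rev_image_eqI[of "(i,j)"])
      then have "\<bar>a i j v - a i j 0\<bar> \<le> C i j * norm v" using v Cd(3) by force
      also have "C i j \<le> (\<Sum>j\<in>UNIV. C i j)" by (rule member_le_sum) (use Cd in auto)
      also have "\<dots> \<le> (\<Sum>i\<in>UNIV. \<Sum>j\<in>UNIV. C i j)" 
        by (rule member_le_sum[of i UNIV "\<lambda>i. \<Sum>j\<in>UNIV. C i j"]) (use Cd in \<open>auto intro: sum_nonneg\<close>)
      finally show "\<bar>a i j v - a i j 0\<bar> \<le> (\<Sum>i\<in>UNIV. \<Sum>j\<in>UNIV. C i j) * norm v" by (simp add: mult_right_mono)
    qed
  qed
  have cpL: "continuous_on (ball 0 r1) (\<lambda>z. p i (x0 + L z))" and cqL: "continuous_on (ball 0 r1) (\<lambda>z. q i j (x0 + L z))" for i j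
    by (rule continuous_on_compose2[OF cp cL] continuous_on_compose2[OF q cL]; use r1 in force)+
  obtain r2 where r2: "r2 > 0" "r2 < r1" "\<And>z::complex. norm z < r2 \<Longrightarrow> norm (\<chi> i. p i (x0 + L z)) < \<delta>a"
  proof -
    have "continuous_on (ball 0 r1) (\<lambda>z. \<chi> i. p i (x0 + L z))" by (intro continuous_on_vec_lambda cpL)
    then have "continuous (at 0) (\<lambda>z. \<chi> i. p i (x0 + L z))" using r1 by (simp add: continuous_on_eq_continuous_at)
    moreover have "(\<chi> i. p i (x0 + L 0)) = 0" using crit by (simp add: L0 vec_eq_iff)
    ultimately obtain d where "d > 0" "\<And>z::complex. norm z < d \<Longrightarrow> norm (\<chi> i. p i (x0 + L z)) < \<delta>a"
      unfolding continuous_at_eps_delta using CA(2) by (auto simp: dist_norm)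
    then show ?thesis using that[of "min d (r1/2)"] r1 by auto
  qed
  obtain B where B: "B > 0" "\<And>i j (z::complex). norm z < r2 \<Longrightarrow> \<bar>q i j (x0 + L z)\<bar> \<le> B"
  proof -
    have "\<exists>B>0. \<forall>z::complex. norm z < r2 \<longrightarrow> \<bar>q i j (x0 + L z)\<bar> \<le> B" for i j
    proof -
      have "bounded ((\<lambda>z. q i j (x0 + L z)) ` cball 0 r2)"
        by (intro compact_imp_bounded compact_continuous_image continuous_on_subset[OF cqL]) (use r2 in auto)
      then obtain B where "B > 0" "\<forall>y\<in>(\<lambda>z. q i j (x0 + L z)) ` cball 0 r2. norm y \<le> B" unfolding bounded_pos by blast
      then show ?thesis by (intro exI[of _ B]) auto
    qed
    then obtain B where B: "\<And>i j. B i j > 0" "\<And>i j (z::complex). norm z < r2 \<Longrightarrow> \<bar>q i j (x0 + L z)\<bar> \<le> B i j" by metis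
    show ?thesis
    proof (rule that[of "B 1 1 + B 1 2 + B 2 1 + B 2 2"])
      show "0 < B 1 1 + B 1 2 + B 2 1 + B 2 2" using B(1) by (simp add: add_pos_pos)
      fix i j and z :: complex assume z: "norm z < r2"
      have "B i j \<le> B 1 1 + B 1 2 + B 2 1 + B 2 2"
        using exhaust_2[of i] exhaust_2[of j] B(1)[of 1 1] B(1)[of 1 2] B(1)[of 2 1] B(1)[of 2 2] by auto
      then show "\<bar>q i j (x0 + L z)\<bar> \<le> B 1 1 + B 1 2 + B 2 1 + B 2 2" using B(2)[OF z, of i j] by linarith
    qed
  qed
  define E where "E = 1 / \<alpha> + \<bar>\<beta>\<bar> / (\<alpha> * \<gamma>) + 1 / \<gamma>"
  have E: "E \<ge> 0" using abc by (auto simp: E_def intro!: add_nonneg_nonneg)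
  \<comment> \<open>Each of the four terms (i, j) is at most CA E B |f|: \<open>CA\<close> is the
    Lipschitz constant of the coefficients at 0, \<open>E\<close> compares the gradient with
    \<open>f\<close>, and \<open>B\<close> bounds the second derivatives. The factor 4 is halved
    because the sum equals 2 \<open>dbar\<close>.\<close>
  interpret dbar_inequality f D r2 "2 * CA * E * B"
  proof
    fix z :: complex assume z: "z \<in> ball 0 r2"
    then have zo: "x0 + L z \<in> \<Omega>" using r1 r2 by auto
    have d: "((\<lambda>z. p i (x0 + L z)) has_derivative (\<lambda>w. q i 1 (x0 + L z) * L w $ 1 + q i 2 (x0 + L z) * L w $ 2)) (at z)" for i
      using diff_chain_at[OF dL dp[OF zo, of i]] by (simp add: o_def sum_2)
    have "((\<lambda>z. of_real (\<alpha> * p 1 (x0 + L z) + \<beta> * p 2 (x0 + L z)) + \<i> * of_real (- (\<gamma> * p 2 (x0 + L z)))) has_derivative D z) (at z)"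
      unfolding D_def Let_def Complex_eq
      by (rule derivative_eq_intros d refl | simp)+
    then show "(f has_derivative D z) (at z)" unfolding f_def Complex_eq by simp
    have sym: "q 1 2 (x0 + L z) = q 2 1 (x0 + L z)"
      by (rule C2_mixed_partials_eq[OF \<Omega>(1) zo du dp q])
    let ?q = "\<lambda>i j. q i j (x0 + L z)" and ?v = "\<chi> i. p i (x0 + L z)"
    have "2 * dbar D z = of_real (\<alpha> * \<alpha> * ?q 1 1 + \<alpha> * \<beta> * (?q 1 2 + ?q 2 1) + (\<beta> * \<beta> + \<gamma> * \<gamma>) * ?q 2 2)"
      unfolding dbar_def D_def Let_def L1 L2 by (simp add: complex_eq_iff sym algebra_simps)
    also have "\<alpha> * \<alpha> * ?q 1 1 + \<alpha> * \<beta> * (?q 1 2 + ?q 2 1) + (\<beta> * \<beta> + \<gamma> * \<gamma>) * ?q 2 2 = 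
        (\<Sum>i\<in>UNIV. \<Sum>j\<in>UNIV. a i j 0 * ?q i j)"
      unfolding abc P_def Q_def S_def by (simp add: sum_2 sym algebra_simps)
    also have "\<dots> = (\<Sum>i\<in>UNIV. \<Sum>j\<in>UNIV. a i j 0 * ?q i j) - (\<Sum>i\<in>UNIV. \<Sum>j\<in>UNIV. a i j ?v * ?q i j)"
      using pde[OF zo] by simp
    also have "\<dots> = (\<Sum>i\<in>UNIV. \<Sum>j\<in>UNIV. (a i j 0 - a i j ?v) * ?q i j)"
      by (simp add: sum_2 algebra_simps)
    finally have eq: "2 * dbar D z = of_real (\<Sum>i\<in>UNIV. \<Sum>j\<in>UNIV. (a i j 0 - a i j ?v) * ?q i j)" .
    have le: "\<bar>(a i j 0 - a i j ?v) * ?q i j\<bar> \<le> CA * (E * norm (f z)) * B" for i j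
    proof -
      have "\<bar>a i j 0 - a i j ?v\<bar> \<le> CA * norm ?v" using CA(3)[of ?v i j] r2 z by (simp add: abs_minus_commute)
      also have "\<dots> \<le> CA * (E * norm (f z))" using grad_f[of z] CA(1) unfolding E_def by (intro mult_left_mono) auto
      finally show ?thesis unfolding abs_mult using B z CA E by (intro mult_mono) auto
    qed
    have "norm (2 * dbar D z) = \<bar>\<Sum>i\<in>UNIV. \<Sum>j\<in>UNIV. (a i j 0 - a i j ?v) * ?q i j\<bar>"
      unfolding eq norm_of_real ..
    also have "\<dots> \<le> (\<Sum>i\<in>(UNIV::2 set). \<Sum>j\<in>(UNIV::2 set). CA * (E * norm (f z)) * B)"
      by (intro order_trans[OF sum_abs] sum_mono le)
    also have "\<dots> = 4 * (CA * (E * norm (f z)) * B)" by (simp add: sum_2)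
    finally show "norm (dbar D z) \<le> 2 * CA * E * B * norm (f z)" by (simp add: norm_mult mult_ac)
  next
    have "continuous_on (ball 0 r2) (\<lambda>z. D z w)" for w
      unfolding D_def Let_def Complex_eq
      by (intro continuous_intros continuous_on_subset[OF cqL]) (use r2 in auto)
    then show "continuous_on (ball 0 r2) (\<lambda>z. D z 1)" "continuous_on (ball 0 r2) (\<lambda>z. D z \<i>)" by blast+
    show "f 0 = 0" unfolding f_def L0 using crit by (simp add: complex_eq_iff)
  qed (use r2 CA E B in auto)
  define U where "U z = u (x0 + L z)" for z
  have dU: "(U has_derivative (\<lambda>h. Re (f z * h))) (at z)" if "norm z < r2" for z
  proof -
    have "x0 + L z \<in> \<Omega>" using that r1 r2 by auto
    from diff_chain_at[OF dL du[OF this]]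
    have "(U has_derivative (\<lambda>h. p 1 (x0 + L z) * L h $ 1 + p 2 (x0 + L z) * L h $ 2)) (at z)"
      unfolding U_def by (simp add: o_def sum_2)
    moreover have "p 1 (x0 + L z) * L h $ 1 + p 2 (x0 + L z) * L h $ 2 = Re (f z * h)" for h
      unfolding f_def L1 L2 by (simp add: algebra_simps)
    ultimately show ?thesis by simp
  qed
  show ?thesis
  proof (cases "\<exists>\<rho>>0. \<forall>z. norm z < \<rho> \<longrightarrow> f z = 0")
    case True
    then obtain \<rho> where \<rho>: "\<rho> > 0" "\<And>z. norm z < \<rho> \<Longrightarrow> f z = 0" by blast
    define r where "r = min \<rho> r2"
    have r: "r > 0" "r \<le> \<rho>" "r \<le> r2" using \<rho> r2 by (auto simp: r_def)
    have "U z = U 0" if "norm z < r" for z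
    proof (rule has_derivative_zero_unique[of "ball 0 r" U])
      show "(U has_derivative (\<lambda>h. 0)) (at y within ball 0 r)" if "y \<in> ball 0 r" for y
        using dU[of y] \<rho>(2)[of y] that r by (auto intro: has_derivative_at_withinI)
    qed (use that r in auto)
    moreover have "open ((\<lambda>z. x0 + L z) ` ball 0 r)"
      using open_translation[OF open_surjective_linear_image[OF open_ball linL surjL, of 0 r], of x0] by (simp add: image_image)
    moreover have "x0 \<in> (\<lambda>z. x0 + L z) ` ball 0 r" using r L0 by (intro image_eqI[of _ _ 0]) auto
    ultimately obtain e where e: "e > 0" "ball x0 e \<subseteq> (\<lambda>z. x0 + L z) ` ball 0 r"
      and c: "\<And>z::complex. norm z < r \<Longrightarrow> u (x0 + L z) = u x0"
      using open_contains_ball unfolding U_def L0 by (metis add_0_right)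
    have "\<forall>x\<in>ball x0 e. u x = u x0" using e(2) c by force
    with e(1) show ?thesis by blast
  next
    case False
    from asymptotics[OF False] obtain m c K \<delta> where m: "m \<ge> 1" "c \<noteq> 0" "\<delta> > 0" "\<delta> \<le> r2" "K > 0"
      and as: "\<And>z. norm z < \<delta> \<Longrightarrow> norm (f z - c * z ^ m) \<le> K * norm z powr (m + 1/2)" by metis
    define n where "n = Suc m"
    \<comment> \<open>Rescaling by l gives c l^n = n. The leading term c z^n / n of the primitive
      then becomes exactly z^n, and the gradient term becomes n z^(n - 1).\<close>
    obtain l where l: "of_nat n / c = l ^ n" using exists_complex_root[of n "of_nat n / c"] by (auto simp: n_def)
    have "of_nat n / c \<noteq> 0" using m by (simp add: n_def del: of_nat_Suc)
    then have l0: "l \<noteq> 0" using l by (metis n_def power_0_Suc)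
    have cl: "c * l ^ n = of_nat n" using l m by (simp add: field_simps)
    define \<Lambda> where "\<Lambda> z = L (l * z)" for z
    have lin\<Lambda>: "linear \<Lambda>" unfolding \<Lambda>_def
      by (rule linear_compose[of "\<lambda>z. l * z" L, unfolded o_def]) (auto intro: linL linear_times)
    have bij\<Lambda>: "bij \<Lambda>"
    proof -
      have "bij L" using injL surjL by (simp add: bij_def)
      moreover have "bij (\<lambda>z. l * z)" by (rule o_bij[of "\<lambda>z. z / l"]) (use l0 in \<open>auto simp: fun_eq_iff\<close>)
      ultimately show ?thesis unfolding \<Lambda>_def using bij_comp[of "\<lambda>z. l * z" L] by (simp add: o_def)
    qed
    define K' where "K' = K * norm l powr (n + 1/2)"
    have "saddle_normal_form u \<Omega> x0 n \<Lambda>"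
      unfolding saddle_normal_form_def
    proof (intro conjI lin\<Lambda> bij\<Lambda>, goal_cases)
      case 1
      show "2 \<le> n" using m by (simp add: n_def)
    next
      case 2
      show ?case
    proof (rule exI[of _ "\<lambda>z. f (l * z) * l"], rule exI[of _ K'], rule exI[of _ "\<delta> / norm l"], intro conjI allI impI)
      show "0 < K'" "0 < \<delta> / norm l" using m l0 by (auto simp: K'_def)
      fix z :: complex assume "norm z < \<delta> / norm l"
      then have z: "norm (l * z) < \<delta>" using l0 by (simp add: norm_mult field_simps)
      show "x0 + \<Lambda> z \<in> \<Omega>" unfolding \<Lambda>_def using r1 r2 m z by auto
      have dd: "norm y < \<delta> \<Longrightarrow> (U has_derivative (\<lambda>h. Re (f y * h))) (at y)" for y using dU[of y] m by auto
      have "\<bar>U (l * z) - U 0 - Re (c * (l * z) ^ Suc m / of_nat (Suc m))\<bar> \<le> K * norm (l * z) powr (Suc m + 1/2)"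
        by (rule real_gradient_primitive_estimate[OF m(3) _ dd as z]) (use m in auto)
      moreover have "c * (l * z) ^ Suc m / of_nat (Suc m) = z ^ n"
        unfolding n_def[symmetric] power_mult_distrib using cl by (simp add: n_def field_simps del: power_Suc of_nat_Suc)
      moreover have "K * norm (l * z) powr (Suc m + 1/2) = K' * norm z powr (n + 1/2)"
        unfolding K'_def n_def norm_mult by (subst powr_mult) auto
      ultimately show "\<bar>u (x0 + \<Lambda> z) - u x0 - Re (z ^ n)\<bar> \<le> K' * norm z powr (real n + 1 / 2)"
        unfolding U_def \<Lambda>_def L0 by (simp only: add_0_right)
      have "((\<lambda>z. l * z) has_derivative (\<lambda>h. l * h)) (at z)" by (auto intro!: derivative_eq_intros)
      from diff_chain_at[OF this dd[OF z]]
      show "((\<lambda>z. u (x0 + \<Lambda> z)) has_derivative (\<lambda>h. Re (f (l * z) * l * h))) (at z)"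
        unfolding U_def \<Lambda>_def o_def by (simp add: mult.assoc)
      have "f (l * z) * l - of_nat n * z ^ (n - 1) = (f (l * z) - c * (l * z) ^ m) * l"
        unfolding cl[symmetric] by (simp add: n_def algebra_simps power_mult_distrib)
      then have "norm (f (l * z) * l - of_nat n * z ^ (n - 1)) = norm (f (l * z) - c * (l * z) ^ m) * norm l"
        by (simp add: norm_mult)
      also have "\<dots> \<le> K * norm (l * z) powr (m + 1/2) * norm l"
        using as[OF z] by (intro mult_right_mono) auto
      also have "\<dots> = K' * norm z powr (n - 1/2)"
      proof -
        have "norm l powr (n + 1/2) = norm l powr (m + 1/2) * norm l"
          using l0 powr_add[of "norm l" "m + 1/2" 1] by (simp add: n_def add.commute add.left_commute)
        moreover have "real n - 1/2 = m + 1/2" by (simp add: n_def)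
        moreover have "norm (l * z) powr (m + 1/2) = norm l powr (m + 1/2) * norm z powr (m + 1/2)"
          unfolding norm_mult by (subst powr_mult) auto
        ultimately show ?thesis unfolding K'_def by (simp only: mult_ac)
      qed
      finally show "norm (f (l * z) * l - of_nat n * z ^ (n - 1)) \<le> K' * norm z powr (real n - 1 / 2)" .
    qed
    qed
    then show ?thesis by blast
  qed
qed

section \<open>Multiplicity\<close>

text \<open>Arcs issuing from \<open>x0\<close> as an end point. Their number is a local invariant
  of the union, whereas the arcs of \<open>has_multiplicity\<close> pass through the point and can
  be paired in several ways.\<close>

definition star_of_arcs :: "'i set \<Rightarrow> ('i \<Rightarrow> real \<Rightarrow> real^2) \<Rightarrow> real^2 \<Rightarrow> bool" where
  "star_of_arcs I h x0 \<longleftrightarrow> finite I \<and> (\<forall>i\<in>I. arc (h i) \<and> pathstart (h i) = x0) \<and>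
     (\<forall>i\<in>I. \<forall>j\<in>I. i \<noteq> j \<longrightarrow> path_image (h i) \<inter> path_image (h j) = {x0})"

text \<open>Connected sets of positive reals that accumulate at 0 both contain an initial stretch of
  positive numbers.\<close>

lemma connected_Ioc_meet:
  assumes A: "connected A" "A \<subseteq> {0<..}" "\<And>e. e > 0 \<Longrightarrow> \<exists>a\<in>A. a < (e::real)"
    and B: "connected B" "B \<subseteq> {0<..}" "\<And>e. e > 0 \<Longrightarrow> \<exists>b\<in>B. b < e"
  shows "A \<inter> B \<noteq> {}"
proof -
  obtain a b where ab: "a \<in> A" "b \<in> B" using A(3)[of 1] B(3)[of 1] by auto
  then have "min a b > 0" using A(2) B(2) by auto
  then obtain a' b' where a': "a' \<in> A" "a' < min a b" and b': "b' \<in> B" "b' < min a b" using A(3) B(3) by meson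
  have "max a' b' \<in> A" using connected_contains_Icc[OF A(1) a'(1) ab(1)] a' b' by auto
  moreover have "max a' b' \<in> B" using connected_contains_Icc[OF B(1) b'(1) ab(2)] a' b' by auto
  ultimately show ?thesis by blast
qed

text \<open>A short initial piece of an arc, without \<open>x0\<close>, is connected and covered by
  the closed arcs of the other star, which are pairwise disjoint away from \<open>x0\<close>; so it
  lies in one of them. This assignment is injective, because two pieces inside one arc would overlap
  near \<open>x0\<close>.\<close>

lemma star_of_arcs_card_le:
  assumes S: "star_of_arcs I h x0" and S': "star_of_arcs I' h' x0"
    and N: "open N" "x0 \<in> N" and sub: "(\<Union>i\<in>I. path_image (h i)) \<inter> N \<subseteq> (\<Union>i\<in>I'. path_image (h' i))"
  shows "card I \<le> card I'"
proof -
  have fin: "finite I" "finite I'" and arc: "\<And>i. i \<in> I \<Longrightarrow> arc (h i)" "\<And>i. i \<in> I' \<Longrightarrow> arc (h' i)"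
    and st: "\<And>i. i \<in> I \<Longrightarrow> h i 0 = x0" "\<And>i. i \<in> I' \<Longrightarrow> h' i 0 = x0"
    and disj: "\<And>i j. i \<in> I \<Longrightarrow> j \<in> I \<Longrightarrow> i \<noteq> j \<Longrightarrow> path_image (h i) \<inter> path_image (h j) = {x0}"
     "\<And>i j. i \<in> I' \<Longrightarrow> j \<in> I' \<Longrightarrow> i \<noteq> j \<Longrightarrow> path_image (h' i) \<inter> path_image (h' j) = {x0}"
    using S S' unfolding star_of_arcs_def pathstart_def by auto
  have "\<exists>e. 0 < e \<and> e \<le> 1 \<and> h i ` {0..e} \<subseteq> N" if "i \<in> I" for i
  proof -
    have "continuous_on {0..1} (h i)" using arc(1)[OF that] by (simp add: arc_def path_def)
    then have "\<forall>\<^sub>F x in at 0 within {0..1}. h i x \<in> N"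
      using N st(1)[OF that] unfolding continuous_on_def by (metis atLeastAtMost_iff order_refl topological_tendstoD zero_le_one)
    then obtain d where d: "d > 0" "\<And>x. x \<in> {0..1} \<Longrightarrow> x \<noteq> 0 \<Longrightarrow> dist x 0 < d \<Longrightarrow> h i x \<in> N"
      unfolding eventually_at by blast
    have "h i ` {0..min 1 (d/2)} \<subseteq> N"
      using d N st(1)[OF that] by (force simp: min_def split: if_splits)
    then show ?thesis using d(1) by (intro exI[of _ "min 1 (d/2)"]) auto
  qed
  then obtain e where e: "\<And>i. i \<in> I \<Longrightarrow> 0 < e i" "\<And>i. i \<in> I \<Longrightarrow> e i \<le> 1" "\<And>i. i \<in> I \<Longrightarrow> h i ` {0..e i} \<subseteq> N"
    by metis
  define C where "C i = h i ` {0<..e i}" for i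
  have C_img: "C i \<subseteq> path_image (h i)" "x0 \<notin> C i" "C i \<noteq> {}" "connected (C i)" "C i \<subseteq> N" if i: "i \<in> I" for i
  proof -
    have inj: "inj_on (h i) {0..1}" using arc(1)[OF i] by (simp add: arc_def)
    have c: "continuous_on {0..1} (h i)" using arc(1)[OF i] by (simp add: arc_def path_def)
    show "C i \<subseteq> path_image (h i)" unfolding C_def path_image_def using e[OF i] by auto
    show "x0 \<notin> C i"
    proof
      assume "x0 \<in> C i"
      then obtain s where s: "0 < s" "s \<le> e i" "h i s = h i 0" using st(1)[OF i] by (auto simp: C_def)
      then have "s = 0" using inj_onD[OF inj s(3)] e(2)[OF i] by auto
      then show False using s by simp
    qed
    show "C i \<noteq> {}" using e(1)[OF i] by (auto simp: C_def)
    show "connected (C i)" unfolding C_def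
      by (intro connected_continuous_image continuous_on_subset[OF c]) (use e[OF i] in auto)
    show "C i \<subseteq> N" using e(3)[OF i] by (auto simp: C_def)
  qed
  have closed': "closed (path_image (h' l))" if "l \<in> I'" for l
    using arc(2)[OF that] by (simp add: closed_arc_image)
  have "\<exists>l\<in>I'. C i \<subseteq> path_image (h' l)" if i: "i \<in> I" for i
  proof -
    have cov: "C i \<subseteq> (\<Union>l\<in>I'. path_image (h' l))" using sub C_img[OF i] i by blast
    then obtain c l where cl: "c \<in> C i" "l \<in> I'" "c \<in> path_image (h' l)" using C_img(3)[OF i] by blast
    let ?B = "\<Union>k\<in>I' - {l}. path_image (h' k)"
    have "closed ?B" using fin closed' by (intro closed_UN) auto
    moreover have "C i \<subseteq> path_image (h' l) \<union> ?B" using cov by blast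
    moreover have "path_image (h' l) \<inter> ?B \<inter> C i = {}"
    proof (rule ccontr)
      assume "path_image (h' l) \<inter> ?B \<inter> C i \<noteq> {}"
      then obtain y k where y: "y \<in> C i" "y \<in> path_image (h' l)" "k \<in> I'" "k \<noteq> l" "y \<in> path_image (h' k)" by auto
      then have "y = x0" using disj(2)[OF cl(2) y(3)] by auto
      then show False using y(1) C_img(2)[OF i] by simp
    qed
    ultimately have "path_image (h' l) \<inter> C i = {} \<or> ?B \<inter> C i = {}"
      using connected_closedD[OF C_img(4)[OF i] _ _ closed'[OF cl(2)]] by blast
    then have "C i \<subseteq> path_image (h' l)" using cl \<open>C i \<subseteq> path_image (h' l) \<union> ?B\<close> by blast
    then show ?thesis using cl by blast
  qed
  then obtain \<phi> where \<phi>: "\<And>i. i \<in> I \<Longrightarrow> \<phi> i \<in> I'" "\<And>i. i \<in> I \<Longrightarrow> C i \<subseteq> path_image (h' (\<phi> i))" by metis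
  have "inj_on \<phi> I"
  proof (rule inj_onI, rule ccontr)
    fix i j assume ij: "i \<in> I" "j \<in> I" "\<phi> i = \<phi> j" "i \<noteq> j"
    define l where "l = \<phi> i"
    have l: "l \<in> I'" using \<phi> ij by (simp add: l_def)
    have cl: "continuous_on {0..1} (h' l)" "inj_on (h' l) {0..1}" using arc(2)[OF l] by (auto simp: arc_def path_def)
    \<comment> \<open>The parameter along the common arc. It carries both pieces to connected sets
      of positive reals accumulating at 0, which must meet.\<close>
    define \<sigma> where "\<sigma> = the_inv_into {0..1} (h' l)"
    have \<sigma>c: "continuous_on (path_image (h' l)) \<sigma>"
      unfolding \<sigma>_def path_image_def using continuous_on_inv_into[OF cl(1) _ cl(2)] by simp
    have \<sigma>h: "\<sigma> (h' l s) = s" if "s \<in> {0..1}" for s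
      unfolding \<sigma>_def using the_inv_into_f_f[OF cl(2) that] .
    have h\<sigma>: "h' l (\<sigma> y) = y" "\<sigma> y \<in> {0..1}" if "y \<in> path_image (h' l)" for y
      using that f_the_inv_into_f[OF cl(2)] the_inv_into_into[OF cl(2) _ order_refl] unfolding \<sigma>_def path_image_def by blast+
    have \<sigma>x0: "\<sigma> x0 = 0" using \<sigma>h[of 0] st(2)[OF l] by simp
    have sets: "connected (\<sigma> ` C k) \<and> \<sigma> ` C k \<subseteq> {0<..} \<and> (\<forall>r>0. \<exists>a\<in>\<sigma> ` C k. a < r)" if k: "k \<in> I" "\<phi> k = l" for k
    proof (intro conjI allI impI)
      have sub: "C k \<subseteq> path_image (h' l)" using \<phi>(2)[OF k(1)] k by simp
      show "connected (\<sigma> ` C k)" using \<sigma>c C_img(4)[OF k(1)] sub by (meson connected_continuous_image continuous_on_subset)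
      show "\<sigma> ` C k \<subseteq> {0<..}"
      proof clarsimp
        fix y assume y: "y \<in> C k"
        then have "\<sigma> y \<noteq> 0" using h\<sigma>(1)[of y] sub st(2)[OF l] C_img(2)[OF k(1)] by (metis subsetD)
        then show "0 < \<sigma> y" using h\<sigma>(2)[of y] y sub by force
      qed
      fix r :: real assume r: "r > 0"
      have x0l: "x0 \<in> path_image (h' l)" using st(2)[OF l] by (force simp: path_image_def)
      then obtain d where d: "d > 0" "\<And>y. y \<in> path_image (h' l) \<Longrightarrow> dist y x0 < d \<Longrightarrow> dist (\<sigma> y) (\<sigma> x0) < r"
        using \<sigma>c r unfolding continuous_on_iff by metis
      have "continuous_on {0..1} (h k)" using arc(1)[OF k(1)] by (simp add: arc_def path_def)
      then obtain d' where d': "d' > 0" "\<And>s. s \<in> {0..1} \<Longrightarrow> dist s 0 < d' \<Longrightarrow> dist (h k s) (h k 0) < d"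
        using d(1) unfolding continuous_on_iff by (meson atLeastAtMost_iff order_refl zero_le_one)
      define s where "s = min (e k) (d'/2)"
      have s: "0 < s" "s \<le> e k" "s < d'" "s \<le> 1" using e[OF k(1)] d' by (auto simp: s_def)
      have "h k s \<in> C k" using s by (auto simp: C_def)
      moreover have "\<sigma> (h k s) < r"
        using d(2)[of "h k s"] d'(2)[of s] s sub calculation st(1)[OF k(1)] \<sigma>x0 by (auto simp: dist_real_def)
      ultimately show "\<exists>a\<in>\<sigma> ` C k. a < r" by blast
    qed
    have "\<sigma> ` C i \<inter> \<sigma> ` C j \<noteq> {}"
      using sets[OF ij(1)] sets[OF ij(2)] ij(3) by (intro connected_Ioc_meet) (auto simp: l_def)
    then obtain y y' where y: "y \<in> C i" "y' \<in> C j" "\<sigma> y = \<sigma> y'" by blast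
    then have "y = y'" using h\<sigma>(1)[of y] h\<sigma>(1)[of y'] \<phi>(2)[OF ij(1)] \<phi>(2)[OF ij(2)] ij(3) unfolding l_def by (metis subsetD)
    then have "y \<in> path_image (h i) \<inter> path_image (h j)" using y C_img(1)[OF ij(1)] C_img(1)[OF ij(2)] by blast
    then show False using disj(1)[OF ij(1,2,4)] y(1) C_img(2)[OF ij(1)] by auto
  qed
  then show ?thesis using \<phi>(1) fin by (intro card_inj_on_le) auto
qed

text \<open>Each of the m + 1 arcs is cut at \<open>x0\<close> into two halves, the boolean
  selecting the half. This gives 2 (m + 1) arcs issuing from \<open>x0\<close>, and their number
  determines m.\<close>

lemma has_multiplicity_imp_star:
  assumes "has_multiplicity u \<Omega> x0 m"
  obtains U h where "x0 \<in> interior U" "star_of_arcs ({..m} \<times> (UNIV :: bool set)) h x0"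
    "{x \<in> \<Omega> \<inter> U. u x = u x0} = (\<Union>i\<in>{..m} \<times> (UNIV :: bool set). path_image (h i))"
proof -
  obtain U g where U: "x0 \<in> interior U" and eq: "{x \<in> \<Omega> \<inter> U. u x = u x0} = (\<Union>i\<le>m. path_image (g i))"
    and g': "\<forall>i\<le>m. arc (g i) \<and> x0 \<in> path_image (g i) - {pathstart (g i), pathfinish (g i)}"
    and disj': "\<forall>i\<le>m. \<forall>j\<le>m. i \<noteq> j \<longrightarrow> path_image (g i) \<inter> path_image (g j) = {x0}"
    using assms unfolding has_multiplicity_def by - (elim conjE exE, rule that, assumption+)
  from g' have g: "\<And>i. i \<le> m \<Longrightarrow> arc (g i)" "\<And>i. i \<le> m \<Longrightarrow> x0 \<in> path_image (g i) - {pathstart (g i), pathfinish (g i)}"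
    by simp_all
  from disj' have disj: "\<And>i j. i \<le> m \<Longrightarrow> j \<le> m \<Longrightarrow> i \<noteq> j \<Longrightarrow> path_image (g i) \<inter> path_image (g j) = {x0}"
    by simp
  have "\<exists>t. 0 < t \<and> t < 1 \<and> g i t = x0" if i: "i \<le> m" for i
  proof -
    obtain t where "t \<in> {0..1}" "g i t = x0" using g(2)[OF i] unfolding path_image_def by auto
    moreover have "t \<noteq> 0" "t \<noteq> 1" using g(2)[OF i] calculation unfolding pathstart_def pathfinish_def by auto
    ultimately show ?thesis by (intro exI[of _ t]) auto
  qed
  then obtain t where t: "\<And>i. i \<le> m \<Longrightarrow> 0 < t i" "\<And>i. i \<le> m \<Longrightarrow> t i < 1" "\<And>i. i \<le> m \<Longrightarrow> g i (t i) = x0" by metis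
  define h where "h = (\<lambda>(i, b). subpath (t i) (if b then 1 else 0) (g i))"
  have img: "path_image (h (i, True)) = g i ` {t i..1}" "path_image (h (i, False)) = g i ` {0..t i}" if "i \<le> m" for i
    using t[OF that] by (auto simp: h_def path_image_subpath)
  have img2: "path_image (h (i, True)) \<union> path_image (h (i, False)) = path_image (g i)" if "i \<le> m" for i
    using t[OF that] unfolding img[OF that] unfolding path_image_def image_Un[symmetric] by (intro arg_cong[of _ _ "image (g i)"]) auto
  have img3: "path_image (h (i, True)) \<inter> path_image (h (i, False)) = {x0}" if "i \<le> m" for i
  proof -
    have inj: "inj_on (g i) {0..1}" using g(1)[OF that] by (simp add: arc_def)
    have "g i ` {t i..1} \<inter> g i ` {0..t i} = g i ` ({t i..1} \<inter> {0..t i})"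
      using t[OF that] by (intro inj_on_image_Int[OF inj, symmetric]) auto
    also have "{t i..1} \<inter> {0..t i} = {t i}" using t[OF that] by auto
    finally show ?thesis using img[OF that] t(3)[OF that] by simp
  qed
  have subi: "path_image (h (i, b)) \<subseteq> path_image (g i)" if "i \<le> m" for i b
    using img2[OF that] by (cases b) auto
  have x0h: "x0 \<in> path_image (h (i, b))" if "i \<le> m" for i b
    using img3[OF that] by (cases b) auto
  have "star_of_arcs ({..m} \<times> (UNIV :: bool set)) h x0"
    unfolding star_of_arcs_def
  proof (intro conjI ballI impI)
    fix p assume "p \<in> {..m} \<times> (UNIV :: bool set)"
    then obtain i b where p: "p = (i, b)" "i \<le> m" by auto
    show "arc (h p)" unfolding p h_def using g(1)[OF p(2)] t[OF p(2)] by (auto intro!: arc_subpath_arc)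
    show "pathstart (h p) = x0" unfolding p h_def using t(3)[OF p(2)] by auto
    fix q assume "q \<in> {..m} \<times> (UNIV :: bool set)" and pq: "p \<noteq> q"
    then obtain j c where q: "q = (j, c)" "j \<le> m" by auto
    show "path_image (h p) \<inter> path_image (h q) = {x0}"
    proof (cases "i = j")
      case True
      then have "b \<noteq> c" using pq p q by simp
      then show ?thesis unfolding p q True using img3[OF q(2)] by (cases b; cases c) auto
    next
      case False
      then show ?thesis unfolding p q
        using disj[OF p(2) q(2) False] subi[OF p(2), of b] subi[OF q(2), of c] x0h[OF p(2), of b] x0h[OF q(2), of c] by blast
    qed
  qed auto
  moreover have "(\<Union>i\<le>m. path_image (g i)) = (\<Union>i\<in>{..m} \<times> (UNIV :: bool set). path_image (h i))"
  proof -
    have "(\<Union>i\<in>{..m} \<times> (UNIV :: bool set). path_image (h i)) = 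
        (\<Union>i\<le>m. path_image (h (i, True)) \<union> path_image (h (i, False)))"
      unfolding UNIV_bool by blast
    also have "\<dots> = (\<Union>i\<le>m. path_image (g i))" using img2 by (intro SUP_cong) auto
    finally show ?thesis by simp
  qed
  ultimately show ?thesis using that[OF U, of h] eq by simp
qed

lemma has_multiplicity_unique:
  assumes "has_multiplicity u \<Omega> x0 m" "has_multiplicity u \<Omega> x0 m'"
  shows "m = m'"
proof -
  have le: "m \<le> m'" if mm: "has_multiplicity u \<Omega> x0 m" "has_multiplicity u \<Omega> x0 m'" for m m'
  proof -
    obtain U h where U: "x0 \<in> interior U" "star_of_arcs ({..m} \<times> (UNIV :: bool set)) h x0"
      "{x \<in> \<Omega> \<inter> U. u x = u x0} = (\<Union>i\<in>{..m} \<times> (UNIV :: bool set). path_image (h i))"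
      using has_multiplicity_imp_star[OF mm(1)] .
    obtain U' h' where U': "x0 \<in> interior U'" "star_of_arcs ({..m'} \<times> (UNIV :: bool set)) h' x0"
      "{x \<in> \<Omega> \<inter> U'. u x = u x0} = (\<Union>i\<in>{..m'} \<times> (UNIV :: bool set). path_image (h' i))"
      using has_multiplicity_imp_star[OF mm(2)] .
    have "card ({..m} \<times> (UNIV :: bool set)) \<le> card ({..m'} \<times> (UNIV :: bool set))"
    proof (rule star_of_arcs_card_le[OF U(2) U'(2), of "interior U'"])
      show "(\<Union>i\<in>{..m} \<times> (UNIV :: bool set). path_image (h i)) \<inter> interior U' \<subseteq> (\<Union>i\<in>{..m'} \<times> (UNIV :: bool set). path_image (h' i))"
        unfolding U(3)[symmetric] U'(3)[symmetric] using interior_subset by blast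
    qed (use U' in auto)
    then show ?thesis by (simp add: card_cartesian_product)
  qed
  from le[OF assms] le[OF assms(2,1)] show ?thesis by simp
qed

lemma saddle_normal_form_rays:
  assumes "saddle_normal_form u \<Omega> x0 n \<Lambda>"
  obtains \<delta> where "\<delta> > 0" "\<And>z. norm z < \<delta> \<Longrightarrow> x0 + \<Lambda> z \<in> \<Omega>"
    "\<And>r \<theta>. 0 < r \<Longrightarrow> r < \<delta> \<Longrightarrow> cos (real n * \<theta>) = 1 \<Longrightarrow> u x0 < u (x0 + \<Lambda> (of_real r * cis \<theta>))"
    "\<And>r \<theta>. 0 < r \<Longrightarrow> r < \<delta> \<Longrightarrow> cos (real n * \<theta>) = -1 \<Longrightarrow> u (x0 + \<Lambda> (of_real r * cis \<theta>)) < u x0"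
proof -
  obtain K \<delta> where K: "K > 0" "\<delta> > 0" and nf: "\<And>z. norm z < \<delta> \<Longrightarrow> x0 + \<Lambda> z \<in> \<Omega>"
    "\<And>z. norm z < \<delta> \<Longrightarrow> \<bar>u (x0 + \<Lambda> z) - u x0 - Re (z ^ n)\<bar> \<le> K * norm z powr (n + 1/2)"
    using assms unfolding saddle_normal_form_def by blast
  \<comment> \<open>For r < 1/K^2 one has K sqrt r < 1, so the error K r^(n + 1/2) stays strictly
    below the leading term r^n in the extremal directions.\<close>
  define d where "d = min \<delta> (1 / K\<^sup>2)"
  have d: "d > 0" "d \<le> \<delta>" "d \<le> 1 / K\<^sup>2" using K by (auto simp: d_def)
  have main: "\<bar>u (x0 + \<Lambda> (of_real r * cis \<theta>)) - u x0 - r ^ n * cos (real n * \<theta>)\<bar> < r ^ n" if r: "0 < r" "r < d" for r \<theta>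
  proof -
    let ?z = "of_real r * cis \<theta>"
    have nz: "norm ?z = r" using r by (simp add: norm_mult)
    have "Re (?z ^ n) = r ^ n * cos (real n * \<theta>)"
      by (simp add: power_mult_distrib Complex.DeMoivre flip: of_real_power)
    then have "\<bar>u (x0 + \<Lambda> ?z) - u x0 - r ^ n * cos (real n * \<theta>)\<bar> \<le> K * r powr (n + 1/2)"
      using nf(2)[of ?z] r d nz by simp
    also have "\<dots> = r ^ n * (K * sqrt r)" using r by (simp add: powr_add powr_realpow powr_half_sqrt)
    also have "\<dots> < r ^ n * 1"
    proof (intro mult_strict_left_mono)
      have "sqrt r < sqrt (1 / K\<^sup>2)" using r d by (intro real_sqrt_less_mono) auto
      also have "\<dots> = 1 / K" using K by (simp add: real_sqrt_divide)
      finally show "K * sqrt r < 1" using K by (simp add: field_simps)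
    qed (use r in auto)
    finally show ?thesis by simp
  qed
  show ?thesis
  proof (rule that[OF d(1)])
    show "x0 + \<Lambda> z \<in> \<Omega>" if "norm z < d" for z using nf(1) that d by simp
    fix r \<theta> :: real assume r: "0 < r" "r < d"
    show "u x0 < u (x0 + \<Lambda> (of_real r * cis \<theta>))" if "cos (real n * \<theta>) = 1"
      using main[OF r, of \<theta>] that by (simp add: abs_less_iff)
    show "u (x0 + \<Lambda> (of_real r * cis \<theta>)) < u x0" if "cos (real n * \<theta>) = -1"
      using main[OF r, of \<theta>] that by (simp add: abs_less_iff)
  qed
qed

section \<open>The zero set of a perturbation of Re z^n\<close>

lemma cos_small_imp_sin_ge: 
  assumes "\<bar>cos t\<bar> \<le> 1/2" "0 \<le> t" "t \<le> pi"
  shows "sin t \<ge> 1/2"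
proof -
  have s0: "sin t \<ge> 0" using assms sin_ge_zero by simp
  have "(cos t)\<^sup>2 \<le> (1/2)\<^sup>2" using assms by (simp add: abs_le_square_iff[symmetric])
  moreover have "(sin t)\<^sup>2 = 1 - (cos t)\<^sup>2" using sin_cos_squared_add[of t] by linarith
  ultimately have "(sin t)\<^sup>2 \<ge> (1/2)\<^sup>2" by (simp add: power2_eq_square)
  from power2_le_imp_le[OF this s0] show ?thesis .
qed

text \<open>The tolerance 1/4 confines zeros to |cos t| \<le> 1/4, inside the range |cos t| \<le>
  1/2. There sin t \<ge> 1/2, so the error in the angular derivative cannot change its sign.\<close>

locale nodal_set =
  fixes V :: "complex \<Rightarrow> real" and g :: "complex \<Rightarrow> complex" and n :: nat and \<delta> :: real
  assumes n: "2 \<le> n" and \<delta>: "0 < \<delta>" and V0: "V 0 = 0"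
    and V: "norm z \<le> \<delta> \<Longrightarrow> \<bar>V z - Re (z ^ n)\<bar> \<le> norm z ^ n / 4"
    and dV: "norm z \<le> \<delta> \<Longrightarrow> (V has_derivative (\<lambda>h. Re (g z * h))) (at z)"
    and g: "norm z \<le> \<delta> \<Longrightarrow> norm (g z - of_nat n * z ^ (n - 1)) * norm z \<le> norm z ^ n / 4"
begin

text \<open>Polar coordinates in the k-th of 2 n equal sectors, with the angle stretched by n so
  that t in [0, pi] sweeps the sector.\<close>

definition pt :: "nat \<Rightarrow> real \<Rightarrow> real \<Rightarrow> complex" where
  "pt k r t = of_real r * cis ((t + k * pi) / n)"

lemma norm_pt: "norm (pt k r t) = \<bar>r\<bar>"
  by (simp add: pt_def norm_mult)

lemma pt_power: "pt k r t ^ n = of_real (r ^ n * (-1) ^ k) * cis t"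
proof -
  have "cis (t + real k * pi) = cis t * cis (real k * pi)" by (simp add: cis_mult)
  also have "cis (real k * pi) = (-1) ^ k" by (metis Complex.DeMoivre cis_pi)
  finally show ?thesis using n
    by (simp add: pt_def power_mult_distrib Complex.DeMoivre)
qed

text \<open>The sign makes all sectors alike: in each of them \<open>G\<close> is close to r^n cos
  t.\<close>

definition G :: "nat \<Rightarrow> real \<Rightarrow> real \<Rightarrow> real" where
  "G k r t = (-1) ^ k * V (pt k r t)"

lemma contV: "continuous_on (cball 0 \<delta>) V"
  by (rule continuous_at_imp_continuous_on) (auto intro!: has_derivative_continuous dV)

lemma G_approx:
  assumes "0 \<le> r" "r \<le> \<delta>"
  shows "\<bar>G k r t - r ^ n * cos t\<bar> \<le> r ^ n / 4"
proof -
  have "\<bar>V (pt k r t) - r ^ n * (-1) ^ k * cos t\<bar> \<le> r ^ n / 4"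
    using V[of "pt k r t"] assms by (simp add: norm_pt pt_power flip: of_real_power)
  moreover have "G k r t - r ^ n * cos t = (-1) ^ k * (V (pt k r t) - r ^ n * (-1) ^ k * cos t)"
    by (simp add: G_def algebra_simps flip: power_mult_distrib)
  ultimately show ?thesis by (simp add: abs_mult power_abs)
qed

lemma G_deriv:
  assumes "0 < r" "r \<le> \<delta>"
  obtains d where "(G k r has_real_derivative d) (at t)" "\<bar>d + r ^ n * sin t\<bar> \<le> r ^ n / 4 / n"
proof -
  let ?z = "pt k r t"
  have "((\<lambda>t. pt k r t) has_vector_derivative (\<i> * ?z / n)) (at t)"
    unfolding pt_def cis_conv_exp using n
    by (auto intro!: derivative_eq_intros has_vector_derivative_real_field simp: field_simps)
  then have 1: "((\<lambda>t. pt k r t) has_derivative (\<lambda>h. h *\<^sub>R (\<i> * ?z / n))) (at t)"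
    unfolding has_vector_derivative_def .
  have 2: "(V has_derivative (\<lambda>h. Re (g ?z * h))) (at ?z)" using assms by (intro dV) (simp add: norm_pt)
  define d where "d = (-1) ^ k * Re (g ?z * (\<i> * ?z / n))"
  have "((\<lambda>t. V (pt k r t)) has_real_derivative Re (g ?z * (\<i> * ?z / n))) (at t)"
    using diff_chain_at[OF 1 2] unfolding has_field_derivative_def o_def 
    by (rule has_derivative_eq_rhs) (auto simp: fun_eq_iff)
  then have "(G k r has_real_derivative d) (at t)" unfolding G_def d_def by (rule DERIV_cmult)
  moreover have "\<bar>d + r ^ n * sin t\<bar> \<le> r ^ n / 4 / n"
  proof -
    have zn: "?z ^ (n - 1) * ?z = ?z ^ n" using n by (metis One_nat_def Suc_1 Suc_leD Suc_le_lessD power_minus_mult)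
    define E where "E = (g ?z - of_nat n * ?z ^ (n - 1)) * (\<i> * ?z / n)"
    have "g ?z * (\<i> * ?z / n) = E + \<i> * (?z ^ (n - 1) * ?z)"
      unfolding E_def using n by (simp add: field_simps)
    then have "g ?z * (\<i> * ?z / n) = E + \<i> * ?z ^ n" unfolding zn .
    then have "Re (g ?z * (\<i> * ?z / n)) = Re E - r ^ n * (-1) ^ k * sin t"
      unfolding pt_power by (simp flip: of_real_power)
    then have "d = (-1) ^ k * (Re E - r ^ n * (-1) ^ k * sin t)" unfolding d_def by (simp only:)
    then have "d + r ^ n * sin t = (-1) ^ k * Re E"
      by (simp add: algebra_simps flip: power_mult_distrib)
    then have "\<bar>d + r ^ n * sin t\<bar> = \<bar>Re E\<bar>"
      by (simp add: abs_mult power_abs)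
    also have "\<dots> \<le> norm E" by (rule abs_Re_le_cmod)
    also have "norm E = norm (g ?z - of_nat n * ?z ^ (n - 1)) * norm ?z / n" unfolding E_def by (simp add: norm_mult norm_divide)
    also have "\<dots> \<le> r ^ n / 4 / n" using g[of ?z] assms n by (intro divide_right_mono) (auto simp: norm_pt)
    finally show ?thesis .
  qed
  ultimately show ?thesis using that by blast
qed

abbreviation "I0 \<equiv> {pi/3..2*pi/3}"

lemma I0_cos: "t \<in> I0 \<Longrightarrow> \<bar>cos t\<bar> \<le> 1/2" 
proof -
  assume t: "t \<in> I0"
  have "cos t \<le> cos (pi/3)" using t by (intro cos_monotone_0_pi_le) auto
  moreover have "cos t \<ge> cos (2*pi/3)" using t pi_gt_zero by (intro cos_monotone_0_pi_le) auto
  ultimately show ?thesis by (simp add: cos_60 cos_120)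
qed

lemma I0_mem: "\<bar>cos t\<bar> \<le> 1/2 \<Longrightarrow> 0 \<le> t \<Longrightarrow> t \<le> pi \<Longrightarrow> t \<in> I0" 
proof -
  assume t: "\<bar>cos t\<bar> \<le> 1/2" "0 \<le> t" "t \<le> pi"
  have "\<not> t < pi/3"
  proof
    assume "t < pi/3"
    then have "cos (pi/3) < cos t" using t by (intro cos_monotone_0_pi) auto
    then show False using t by (simp add: cos_60)
  qed
  moreover have "\<not> t > 2*pi/3"
  proof
    assume "t > 2*pi/3"
    then have "cos t < cos (2*pi/3)" using t by (intro cos_monotone_0_pi) auto
    then show False using t by (simp add: cos_120)
  qed
  ultimately show ?thesis by auto
qed

lemma G_strict_decreasing:
  assumes "0 < r" "r \<le> \<delta>" "s \<in> I0" "t \<in> I0" "s < t"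
  shows "G k r t < G k r s"
proof (rule DERIV_neg_imp_decreasing[OF assms(5)])
  fix x assume x: "s \<le> x" "x \<le> t"
  obtain d where d: "(G k r has_real_derivative d) (at x)" "\<bar>d + r ^ n * sin x\<bar> \<le> r ^ n / 4 / n"
    using G_deriv[OF assms(1,2)] by blast
  have "sin x \<ge> 1/2" by (rule cos_small_imp_sin_ge[OF I0_cos]) (use x assms in auto)
  then have "r ^ n * sin x \<ge> r ^ n / 2" using assms(1) by (simp add: field_simps)
  moreover have "r ^ n / 4 / n \<le> r ^ n / 4" using assms(1) n by (simp add: divide_le_eq field_simps)
  moreover have "r ^ n > 0" using assms by simp
  ultimately have "d < 0" using d(2) by linarith
  then show "\<exists>y. (G k r has_real_derivative y) (at x) \<and> y < 0" using d(1) by blast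
qed

lemma contG: "continuous_on ({0..\<delta>} \<times> UNIV) (\<lambda>(r, t). G k r t)"
proof -
  have "continuous_on ({0..\<delta>} \<times> UNIV) (\<lambda>p. pt k (fst p) (snd p))"
    unfolding pt_def using n by (intro continuous_intros) auto
  then have "continuous_on ({0..\<delta>} \<times> UNIV) (\<lambda>p. V (pt k (fst p) (snd p)))"
    by (rule continuous_on_compose2[OF contV]) (auto simp: norm_pt)
  then show ?thesis unfolding G_def split_beta by (intro continuous_intros)
qed

text \<open>At the ends of \<open>I0\<close> the leading term is half of r^n in absolute value,
  which beats the error r^n / 4 and forces a sign change; strict monotonicity gives
  uniqueness.\<close>

lemma G_root_ex1:
  assumes r: "0 < r" "r \<le> \<delta>"
  shows "\<exists>!t. t \<in> I0 \<and> G k r t = 0"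
proof -
  have rn: "r ^ n > 0" using r by simp
  have c: "continuous_on I0 (G k r)"
    by (rule continuous_at_imp_continuous_on) (meson G_deriv[OF r] DERIV_isCont)
  have "\<bar>G k r (pi/3) - r ^ n * (1/2)\<bar> \<le> r ^ n / 4" "\<bar>G k r (2*pi/3) - r ^ n * (-1/2)\<bar> \<le> r ^ n / 4"
    using G_approx[of r k "pi/3"] G_approx[of r k "2*pi/3"] r unfolding cos_60 cos_120 by auto
  then have "G k r (pi/3) \<ge> 0" "G k r (2*pi/3) \<le> 0" using rn by arith+
  then obtain t where "pi/3 \<le> t" "t \<le> 2*pi/3" "G k r t = 0"
    using IVT2'[of "G k r" "2*pi/3" 0 "pi/3"] c pi_gt_zero by auto
  moreover have "s = t" if "s \<in> I0" "t \<in> I0" "G k r s = 0" "G k r t = 0" for s t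
    using G_strict_decreasing[OF r that(1,2), of k] G_strict_decreasing[OF r that(2,1), of k] that(3,4) by (cases s t rule: linorder_cases) auto
  ultimately show ?thesis by (metis atLeastAtMost_iff)
qed

definition root :: "nat \<Rightarrow> real \<Rightarrow> real" where
  "root k r = (THE t. t \<in> I0 \<and> G k r t = 0)"

lemma root: "0 < r \<Longrightarrow> r \<le> \<delta> \<Longrightarrow> root k r \<in> I0" "0 < r \<Longrightarrow> r \<le> \<delta> \<Longrightarrow> G k r (root k r) = 0"
  using theI'[OF G_root_ex1[of r k]] unfolding root_def by auto

lemma root_unique: "0 < r \<Longrightarrow> r \<le> \<delta> \<Longrightarrow> t \<in> I0 \<Longrightarrow> G k r t = 0 \<Longrightarrow> t = root k r"
  using G_root_ex1[of r k] root[of r k] by blast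

text \<open>By uniqueness the graph is the zero set of the continuous \<open>G\<close> in a compact
  strip, hence closed, and a closed graph over a compact range means continuity. The radius is kept
  away from 0, where the root is not determined.\<close>

lemma cont_root:
  assumes "0 < a"
  shows "continuous_on {a..\<delta>} (root k)"
proof (rule continuous_from_closed_graph)
  show "compact I0" by simp
  show "root k \<in> {a..\<delta>} \<rightarrow> I0" using root assms by fastforce
  have eq: "(\<lambda>x. (x, root k x)) ` {a..\<delta>} = ({a..\<delta>} \<times> I0) \<inter> (\<lambda>(r, t). G k r t) -` {0}"
    using root root_unique assms by (fastforce simp: image_iff)
  show "closed ((\<lambda>x. (x, root k x)) ` {a..\<delta>})"
    unfolding eq
    by (intro continuous_closed_preimage continuous_on_subset[OF contG] closed_Times) (use assms in auto)
qed

definition branch :: "nat \<Rightarrow> real \<Rightarrow> complex" where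
  "branch k s = pt k (\<delta> * s) (root k (\<delta> * s))"

lemma norm_branch: "0 \<le> s \<Longrightarrow> norm (branch k s) = \<delta> * s"
  using \<delta> by (simp add: branch_def norm_pt)

lemma branch_0 [simp]: "branch k 0 = 0"
  by (simp add: branch_def pt_def)

text \<open>Injectivity is free because the parameter is the radius divided by
  \<open>\<delta>\<close>. Continuity at 0 is checked separately, from the radius alone, since the
  angle is not controlled there.\<close>

lemma arc_branch: "arc (branch k)"
  unfolding arc_def path_def
proof
  show "inj_on (branch k) {0..1}"
  proof (rule inj_onI)
    fix x y assume xy: "x \<in> {0..1}" "y \<in> {0..1}" "branch k x = branch k y"
    then have "\<delta> * x = \<delta> * y" using norm_branch by (metis atLeastAtMost_iff)
    then show "x = y" using \<delta> by simp
  qed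
  show "continuous_on {0..1} (branch k)"
  proof (rule continuous_on_eq_continuous_within[THEN iffD2], rule ballI)
    fix s :: real assume s: "s \<in> {0..1}"
    show "continuous (at s within {0..1}) (branch k)"
    proof (cases "s = 0")
      case True
      have "((\<lambda>x. branch k x) \<longlongrightarrow> 0) (at 0 within {0..1})"
      proof (rule Lim_null_comparison)
        show "\<forall>\<^sub>F x in at 0 within {0..1}. norm (branch k x) \<le> \<delta> * x"
          unfolding eventually_at by (auto simp: norm_branch intro!: exI[of _ 1])
        show "((\<lambda>x. \<delta> * x) \<longlongrightarrow> 0) (at 0 within {0..1})"
          by (rule tendsto_eq_intros | simp)+
      qed
      then show ?thesis unfolding True continuous_within by simp
    next
      case False
      then have s: "0 < s" "s \<le> 1" using s by auto
      have "continuous_on {s/2..1} (\<lambda>x. root k (\<delta> * x))"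
        by (rule continuous_on_compose2[OF cont_root[of "\<delta> * (s/2)"]])
           (use s \<delta> in \<open>auto intro!: continuous_intros mult_left_le simp: field_simps\<close>)
      then have "continuous_on {s/2..1} (branch k)"
        unfolding branch_def pt_def using n by (intro continuous_intros) auto
      then have "continuous (at s within {s/2..1}) (branch k)"
        using s by (simp add: continuous_on_eq_continuous_within)
      moreover have "at s within {s/2..1} = at s within {0..1}"
        by (rule at_within_nhd[of s "{s/2<..}"]) (use s in auto)
      ultimately show ?thesis by simp
    qed
  qed
qed

lemma V_branch: "s \<in> {0..1} \<Longrightarrow> V (branch k s) = 0"
proof (cases "s = 0")
  case False
  assume "s \<in> {0..1}"
  then have "0 < \<delta> * s" "\<delta> * s \<le> \<delta>" using False \<delta> by (auto intro: mult_left_le)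
  from root(2)[OF this, of k] show ?thesis unfolding branch_def G_def by simp
qed (simp add: V0)

text \<open>The integer part of n times the argument, divided by pi, selects the sector. In it the
  tolerance forces the angle into \<open>I0\<close>, where the root is unique.\<close>

lemma zero_imp_branch:
  assumes z: "norm z \<le> \<delta>" "V z = 0"
  obtains k s where "k < 2 * n" "s \<in> {0..1}" "z = branch k s"
proof (cases "z = 0")
  case True
  then show ?thesis using that[of 0 0] n by simp
next
  case False
  define r where "r = norm z"
  define \<theta> where "\<theta> = n * Arg2pi z"
  have r: "0 < r" "r \<le> \<delta>" using z False by (auto simp: r_def)
  have \<theta>: "0 \<le> \<theta>" "\<theta> < n * (2 * pi)" using Arg2pi[of z] n by (auto simp: \<theta>_def)
  have zeq: "z = of_real r * cis (\<theta> / n)" 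
    using Arg2pi[of z] n by (simp add: \<theta>_def r_def cis_conv_exp is_Arg_def mult.commute)
  define k where "k = nat \<lfloor>\<theta> / pi\<rfloor>"
  define t where "t = \<theta> - k * pi"
  have kf: "real k \<le> \<theta> / pi" "\<theta> / pi < real k + 1" using \<theta> pi_gt_zero unfolding k_def 
    by (auto simp: of_nat_nat)
  have t: "0 \<le> t" "t \<le> pi" using kf pi_gt_zero by (auto simp: t_def field_simps)
  have zpt: "z = pt k r t" unfolding pt_def t_def using zeq by simp
  have k: "k < 2 * n"
  proof -
    have "\<theta> / pi < 2 * n" using \<theta>(2) pi_gt_zero by (simp add: field_simps)
    then have "real k < real (2 * n)" using kf(1) by simp
    then show ?thesis by simp
  qed
  have G0: "G k r t = 0" unfolding G_def using z zpt by simp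
  have "\<bar>r ^ n * cos t\<bar> \<le> r ^ n / 4" using G_approx[of r k t] G0 r by simp
  then have "r ^ n * \<bar>cos t\<bar> \<le> r ^ n * (1/4)" using r by (simp add: abs_mult)
  then have "\<bar>cos t\<bar> \<le> 1/4" using r by (simp only: mult_le_cancel_left_pos zero_less_power)
  then have "t \<in> I0" using t by (intro I0_mem) auto
  then have "t = root k r" using root_unique[OF r] G0 by blast
  then have "z = branch k (r / \<delta>)" unfolding branch_def using zpt \<delta> by simp
  then show ?thesis using that[of k "r/\<delta>"] k r \<delta> by simp
qed

text \<open>A common point has one radius, and its two angles differ by a multiple of 2 pi. As both
  roots lie in \<open>I0\<close>, they differ by less than pi; so they agree, and k - l is a
  multiple of 2 n.\<close>

lemma branch_disjoint:
  assumes kl: "k < 2 * n" "l < 2 * n" "k \<noteq> l"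
  shows "path_image (branch k) \<inter> path_image (branch l) = {0}"
proof
  show "{0} \<subseteq> path_image (branch k) \<inter> path_image (branch l)"
    unfolding path_image_def by (auto intro!: image_eqI[of _ _ 0])
  show "path_image (branch k) \<inter> path_image (branch l) \<subseteq> {0}"
  proof clarify
    fix z assume "z \<in> path_image (branch k)" "z \<in> path_image (branch l)" 
    then obtain s s' where s: "s \<in> {0..1}" "s' \<in> {0..1}" "z = branch k s" "z = branch l s'" unfolding path_image_def by auto
    have "\<delta> * s = \<delta> * s'" using s norm_branch[of s k] norm_branch[of s' l] by auto
    then have ss: "s' = s" using \<delta> by simp
    show "z = 0"
    proof (rule ccontr)
      assume "z \<noteq> 0"
      then have "s \<noteq> 0" using s by auto
      then have r: "0 < \<delta> * s" "\<delta> * s \<le> \<delta>" using s(1) \<delta> by (auto intro: mult_left_le)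
      define t t' where "t = root k (\<delta> * s)" and "t' = root l (\<delta> * s)"
      have tI: "t \<in> I0" "t' \<in> I0" using root(1)[OF r] by (auto simp: t_def t'_def)
      have "pt k (\<delta> * s) t = pt l (\<delta> * s) t'" using s ss unfolding branch_def t_def t'_def by simp
      then have "cis ((t + k * pi) / n) = cis ((t' + l * pi) / n)" unfolding pt_def using r \<open>s \<noteq> 0\<close> \<delta> by simp
      then have "cis ((t + k * pi) / n - (t' + l * pi) / n) = 1" by (simp add: cis_divide[symmetric])
      then obtain m :: int where "(t + k * pi) / n - (t' + l * pi) / n = of_int m * (2 * pi)"
        by (auto simp: cis_conv_exp exp_eq_1 mult_ac)
      then have "((t + k * pi) - (t' + l * pi)) / n = of_int m * (2 * pi)" by (simp only: diff_divide_distrib)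
      then have "(t + k * pi) - (t' + l * pi) = of_int m * (2 * pi) * n" using n by (simp add: divide_eq_eq)
      then have "t - t' = of_int (2 * int n * m - int k + int l) * pi"
        by (simp add: algebra_simps)
      moreover define j where "j = 2 * int n * m - int k + int l"
      ultimately have j: "t - t' = of_int j * pi" by simp
      have "t - t' < pi" "t' - t < pi" using tI pi_gt_zero unfolding atLeastAtMost_iff by linarith+
      then have "\<bar>of_int j * pi\<bar> < 1 * pi" unfolding j[symmetric] by (simp add: abs_less_iff)
      then have "\<bar>real_of_int j\<bar> < 1" by (simp add: abs_mult)
      then have "j = 0" by linarith
      then have lk: "int k - int l = 2 * int n * m" by (simp add: j_def)
      have "\<bar>int k - int l\<bar> < 2 * int n" using kl by auto
      then have "\<bar>m\<bar> < 1" unfolding lk using n by (simp add: abs_mult)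
      then show False using lk kl(3) by simp
    qed
  qed
qed

lemma nodal_arcs:
  "\<exists>h. (\<forall>i<n. arc (h i)) \<and> (\<forall>i<n. 0 \<in> path_image (h i) - {pathstart (h i), pathfinish (h i)}) \<and>
    (\<forall>i<n. \<forall>j<n. i \<noteq> j \<longrightarrow> path_image (h i) \<inter> path_image (h j) = {0}) \<and>
    {z. norm z \<le> \<delta> \<and> V z = 0} = (\<Union>i<n. path_image (h i))"
proof -
  \<comment> \<open>Opposite branches are joined into one arc through 0, so that the 2 n branches
    give n arcs. The pairing i with i + n is one convenient choice.\<close>
  define h where "h i = reversepath (branch i) +++ branch (i + n)" for i
  have ends: "pathstart (branch k) = 0" "pathfinish (branch k) = branch k 1" for k by (auto simp: pathstart_def pathfinish_def)
  have img: "path_image (h i) = path_image (branch i) \<union> path_image (branch (i + n))" for i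
    unfolding h_def by (subst path_image_join) (auto simp: ends)
  have b1: "branch k 1 \<noteq> 0" for k using norm_branch[of 1 k] \<delta> by auto
  have zb: "0 \<in> path_image (branch k)" for k unfolding path_image_def by (auto intro!: image_eqI[of _ _ 0])
  show ?thesis
  proof (rule exI[of _ h], intro conjI allI impI)
    fix i assume i: "i < n"
    show "arc (h i)" unfolding h_def
      using branch_disjoint[of i "i + n"] i n
      by (intro arc_join arc_reversepath arc_branch) (auto simp: ends)
  next
    fix i assume i: "i < n"
    show "0 \<in> path_image (h i) - {pathstart (h i), pathfinish (h i)}"
      unfolding img using zb b1 by (auto simp: h_def ends) 
  next
    fix i j assume i: "i < n" and j: "j < n" "i \<noteq> j"
    have "path_image (branch a) \<inter> path_image (branch b) = {0}" if "a \<in> {i, i + n}" "b \<in> {j, j + n}" for a b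
      using that i j by (intro branch_disjoint) auto
    then show "path_image (h i) \<inter> path_image (h j) = {0}"
      unfolding img Int_Un_distrib Int_Un_distrib2 by auto
  next
    show "{z. norm z \<le> \<delta> \<and> V z = 0} = (\<Union>i<n. path_image (h i))"
    proof (intro set_eqI iffI)
      fix z assume "z \<in> {z. norm z \<le> \<delta> \<and> V z = 0}"
      then obtain k s where k: "k < 2 * n" "s \<in> {0..1}" "z = branch k s" using zero_imp_branch by blast
      then have z: "z \<in> path_image (branch k)" by (auto simp: path_image_def)
      show "z \<in> (\<Union>i<n. path_image (h i))"
      proof (cases "k < n")
        case True
        then show ?thesis using z img by auto
      next
        case False
        then have "k = (k - n) + n" "k - n < n" using k by auto
        then show ?thesis using z img by (metis UN_I UnI2 lessThan_iff)
      qed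
    next
      fix z assume "z \<in> (\<Union>i<n. path_image (h i))"
      then obtain k where "z \<in> path_image (branch k)" using img by auto
      then obtain s where s: "s \<in> {0..1}" "z = branch k s" by (auto simp: path_image_def)
      then show "z \<in> {z. norm z \<le> \<delta> \<and> V z = 0}"
        using norm_branch[of s k] V_branch[of s k] \<delta> by (auto intro: mult_left_le)
    qed
  qed
qed

end

proposition saddle_has_multiplicity:
  assumes "saddle_normal_form u \<Omega> x0 n \<Lambda>"
  shows "has_multiplicity u \<Omega> x0 (n - 1)"
proof -
  have n: "2 \<le> n" and \<Lambda>: "linear \<Lambda>" "bij \<Lambda>" using assms unfolding saddle_normal_form_def by auto
  obtain g K \<delta> where K: "K > 0" "\<delta> > 0" and nf: "\<And>z. norm z < \<delta> \<Longrightarrow> x0 + \<Lambda> z \<in> \<Omega>"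
    "\<And>z. norm z < \<delta> \<Longrightarrow> \<bar>u (x0 + \<Lambda> z) - u x0 - Re (z ^ n)\<bar> \<le> K * norm z powr (n + 1/2)"
    "\<And>z. norm z < \<delta> \<Longrightarrow> ((\<lambda>z. u (x0 + \<Lambda> z)) has_derivative (\<lambda>h. Re (g z * h))) (at z)"
    "\<And>z. norm z < \<delta> \<Longrightarrow> norm (g z - of_nat n * z ^ (n - 1)) \<le> K * norm z powr (n - 1/2)"
    using assms unfolding saddle_normal_form_def by blast
  \<comment> \<open>On this disc K sqrt |z| \<le> 1/4, which turns the error terms of the normal
    form into the tolerance of \<open>nodal_set\<close>.\<close>
  define d where "d = min (\<delta>/2) (1 / (4 * K)\<^sup>2)"
  have d: "d > 0" "d < \<delta>" "d \<le> 1 / (4 * K)\<^sup>2" using K by (auto simp: d_def)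
  have small: "K * norm z powr (n + 1/2) \<le> norm z ^ n / 4" if "norm z \<le> d" for z :: complex
  proof (cases "z = 0")
    case False
    have "sqrt (norm z) \<le> sqrt (1 / (4 * K)\<^sup>2)" using that d by (intro real_sqrt_le_mono) auto
    also have "\<dots> = 1 / (4 * K)" using K real_sqrt_abs[of "4 * K"] by (simp only: real_sqrt_divide real_sqrt_one)
    finally have "K * sqrt (norm z) \<le> 1/4" using K by (simp add: field_simps)
    then have "norm z ^ n * (K * sqrt (norm z)) \<le> norm z ^ n * (1/4)" by (intro mult_left_mono) auto
    then show ?thesis using False by (simp add: powr_add powr_realpow powr_half_sqrt mult_ac)
  qed (use n in auto)
  define V where "V z = u (x0 + \<Lambda> z) - u x0" for z
  have L0: "\<Lambda> 0 = 0" using \<Lambda>(1) linear_0 by blast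
  interpret nodal_set V g n d
  proof
    fix z :: complex assume z: "norm z \<le> d"
    then have z': "norm z < \<delta>" using d by simp
    show "\<bar>V z - Re (z ^ n)\<bar> \<le> norm z ^ n / 4" using nf(2)[OF z'] small[OF z] by (simp add: V_def)
    show "(V has_derivative (\<lambda>h. Re (g z * h))) (at z)"
      unfolding V_def using has_derivative_diff[OF nf(3)[OF z'] has_derivative_const] by simp
    have "norm (g z - of_nat n * z ^ (n - 1)) * norm z \<le> (K * norm z powr (n - 1/2)) * norm z"
      using nf(4)[OF z'] by (rule mult_right_mono) simp
    also have "\<dots> = K * norm z powr (n + 1/2)"
    proof (cases "z = 0")
      case False
      have "norm z powr ((real n - 1/2) + 1) = norm z powr (n - 1/2) * norm z powr 1" by (rule powr_add)
      moreover have "(real n - 1/2) + 1 = n + 1/2" by simp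
      ultimately show ?thesis using False by simp
    qed simp
    also have "\<dots> \<le> norm z ^ n / 4" by (rule small[OF z])
    finally show "norm (g z - of_nat n * z ^ (n - 1)) * norm z \<le> norm z ^ n / 4" .
  qed (use n d(1) L0 in \<open>auto simp: V_def\<close>)
  obtain h where h': "(\<forall>i<n. arc (h i)) \<and> (\<forall>i<n. 0 \<in> path_image (h i) - {pathstart (h i), pathfinish (h i)}) \<and>
    (\<forall>i<n. \<forall>j<n. i \<noteq> j \<longrightarrow> path_image (h i) \<inter> path_image (h j) = {0}) \<and>
    {z. norm z \<le> d \<and> V z = 0} = (\<Union>i<n. path_image (h i))"
    using nodal_arcs ..
  from h' have h: "\<And>i. i < n \<Longrightarrow> arc (h i)" "\<And>i. i < n \<Longrightarrow> 0 \<in> path_image (h i) - {pathstart (h i), pathfinish (h i)}"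
    "\<And>i j. i < n \<Longrightarrow> j < n \<Longrightarrow> i \<noteq> j \<Longrightarrow> path_image (h i) \<inter> path_image (h j) = {0}"
    "{z. norm z \<le> d \<and> V z = 0} = (\<Union>i<n. path_image (h i))"
    by simp_all
  define T where "T z = x0 + \<Lambda> z" for z
  have injT: "inj T" using \<Lambda>(2) by (auto simp: T_def inj_def bij_def)
  have imgT: "path_image (T \<circ> p) = T ` path_image p" for p by (auto simp: path_image_def image_comp)
  have Tc: "T \<circ> p = (+) x0 \<circ> (\<Lambda> \<circ> p)" for p by (auto simp: T_def fun_eq_iff)
  have T0: "T 0 = x0" by (simp add: T_def L0)
  show ?thesis
    unfolding has_multiplicity_def
  proof (intro conjI exI[of _ "T ` cball 0 d"] exI[of _ "\<lambda>i. T \<circ> h i"] allI impI)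
    show "1 \<le> n - 1" using n by simp
    have "open (T ` ball 0 d)"
      unfolding T_def using open_translation[OF open_surjective_linear_image[OF open_ball \<Lambda>(1), of 0 d], of x0] \<Lambda>(2)
      by (simp add: image_image bij_def)
    then show "x0 \<in> interior (T ` cball 0 d)"
    proof (rule interiorI)
      show "x0 \<in> T ` ball 0 d" using d(1) T0 by (intro image_eqI[of _ _ 0]) auto
    qed auto
    have "{x \<in> \<Omega> \<inter> T ` cball 0 d. u x = u x0} = T ` {z. norm z \<le> d \<and> V z = 0}"
      using nf(1) d by (auto simp: T_def V_def)
    also have "\<dots> = (\<Union>i<n. path_image (T \<circ> h i))" unfolding h(4) imgT by auto
    also have "{..<n} = {..n - 1}" using n by auto
    finally show "{x \<in> \<Omega> \<inter> T ` cball 0 d. u x = u x0} = (\<Union>i\<le>n - 1. path_image (T \<circ> h i))" .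
  next
    fix i assume "i \<le> n - 1"
    then have i: "i < n" using n by simp
    show "arc (T \<circ> h i)" unfolding Tc arc_translation_eq
      using \<Lambda> h(1)[OF i] by (simp add: arc_linear_image_eq bij_def)
    show "x0 \<in> path_image (T \<circ> h i) - {pathstart (T \<circ> h i), pathfinish (T \<circ> h i)}"
      using h(2)[OF i] injT T0 unfolding imgT pathstart_compose pathfinish_compose
      by (auto simp: inj_def)
    fix j assume "j \<le> n - 1" "i \<noteq> j"
    then have j: "j < n" "i \<noteq> j" using n by auto
    show "path_image (T \<circ> h i) \<inter> path_image (T \<circ> h j) = {x0}"
      unfolding imgT image_Int[OF injT, symmetric] h(3)[OF i j] using T0 by simp
  qed
qed

section \<open>Counting saddles in a Jordan domain\<close>

text \<open>The hyperedges \<open>A x\<close> on \<open>B\<close> are contracted one after the other; \<open>g\<close> is a choice of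
  representatives after the contractions. The labelling \<open>f\<close> shows that the other edges do not connect two
  vertices of \<open>A x\<close>, so that there are no cycles.\<close>

lemma hypergraph_forest:
  fixes A :: "'x \<Rightarrow> 'b set"
  assumes F: "finite F" and B: "finite B" and A: "\<And>x. x \<in> F \<Longrightarrow> A x \<subseteq> B" "\<And>x. x \<in> F \<Longrightarrow> A x \<noteq> {}"
    and last: "\<And>G. G \<subseteq> F \<Longrightarrow> G \<noteq> {} \<Longrightarrow> \<exists>x\<in>G. \<exists>f :: 'b \<Rightarrow> 'c. inj_on f (A x) \<and> 
        (\<forall>y\<in>G - {x}. \<forall>b\<in>A y. \<forall>b'\<in>A y. f b = f b')"
  shows "\<exists>g. g ` B \<subseteq> B \<and> (\<forall>f :: 'b \<Rightarrow> 'c. (\<forall>y\<in>F. \<forall>b\<in>A y. \<forall>b'\<in>A y. f b = f b') \<longrightarrow> (\<forall>b\<in>B. f (g b) = f b)) \<and>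
      card (g ` B) + (\<Sum>x\<in>F. card (A x) - 1) \<le> card B"
  using F A last
proof (induction "card F" arbitrary: F)
  case 0
  then show ?case by (intro exI[of _ id]) auto
next
  case (Suc k)
  then have "F \<noteq> {}" by auto
  then obtain x f where x: "x \<in> F" and inj: "inj_on (f :: 'b \<Rightarrow> 'c) (A x)"
    and const: "\<And>y b b'. y \<in> F - {x} \<Longrightarrow> b \<in> A y \<Longrightarrow> b' \<in> A y \<Longrightarrow> f b = f b'"
    using Suc.prems(4)[of F] by blast
  have "card (F - {x}) = k" using Suc.hyps(2) x Suc.prems(1) by simp
  moreover have "finite (F - {x})" "\<And>y. y \<in> F - {x} \<Longrightarrow> A y \<subseteq> B" "\<And>y. y \<in> F - {x} \<Longrightarrow> A y \<noteq> {}"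
    using Suc.prems by auto
  moreover have "\<exists>x\<in>G. \<exists>f :: 'b \<Rightarrow> 'c. inj_on f (A x) \<and> (\<forall>y\<in>G - {x}. \<forall>b\<in>A y. \<forall>b'\<in>A y. f b = f b')"
    if "G \<subseteq> F - {x}" "G \<noteq> {}" for G using that by (intro Suc.prems(4)) auto
  ultimately obtain g where g: "g ` B \<subseteq> B"
    "\<And>f' :: 'b \<Rightarrow> 'c. (\<forall>y\<in>F - {x}. \<forall>b\<in>A y. \<forall>b'\<in>A y. f' b = f' b') \<Longrightarrow> (\<forall>b\<in>B. f' (g b) = f' b)"
    "card (g ` B) + (\<Sum>x\<in>F - {x}. card (A x) - 1) \<le> card B"
    using Suc.hyps(1)[of "F - {x}"] by auto
  have fg: "f (g b) = f b" if "b \<in> B" for b using g(2)[of f] const that by blast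
  have AB: "A x \<subseteq> B" using Suc.prems(2) x by blast
  \<comment> \<open>\<open>f\<close> is unchanged by the earlier contractions and separates the
    vertices of \<open>A x\<close>. Hence these still have distinct representatives, and merging
    them below lowers the count by the full \<open>card (A x) - 1\<close>.\<close>
  have injg: "inj_on g (A x)"
    using inj fg AB by (metis (no_types, lifting) inj_on_def subsetD)
  obtain a where a: "a \<in> A x" using Suc.prems(3) x by blast
  define h where "h b = (if g b \<in> g ` A x then g a else g b)" for b
  have finA: "finite (A x)" using AB B finite_subset by blast
  have himg: "h ` B \<subseteq> (g ` B - g ` A x) \<union> {g a}" unfolding h_def by auto
  have "card (h ` B) \<le> card ((g ` B - g ` A x) \<union> {g a})"
    by (rule card_mono[OF _ himg]) (use B in auto)
  also have "\<dots> \<le> card (g ` B - g ` A x) + 1" by (rule order_trans[OF card_Un_le]) simp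
  also have "card (g ` B - g ` A x) = card (g ` B) - card (A x)"
    using AB finA by (subst card_Diff_subset) (auto simp: card_image[OF injg])
  finally have "card (h ` B) \<le> card (g ` B) - card (A x) + 1" .
  moreover have "card (A x) \<le> card (g ` B)"
    unfolding card_image[OF injg, symmetric] using AB B by (intro card_mono) auto
  moreover have "card (A x) \<ge> 1" using a finA by (metis One_nat_def Suc_leI card_gt_0_iff empty_iff)
  ultimately have "card (h ` B) + (card (A x) - 1) \<le> card (g ` B)" by linarith
  then have "card (h ` B) + (\<Sum>x\<in>F. card (A x) - 1) \<le> card B"
    using g(3) sum.remove[OF Suc.prems(1) x, of "\<lambda>x. card (A x) - 1"] by linarith
  moreover have "h ` B \<subseteq> B" using himg g(1) a AB by auto
  moreover have "\<forall>b\<in>B. f' (h b) = f' b" if f': "\<forall>y\<in>F. \<forall>b\<in>A y. \<forall>b'\<in>A y. f' b = f' b'" for f' :: "'b \<Rightarrow> 'c"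
  proof
    fix b assume b: "b \<in> B"
    have fg': "f' (g b) = f' b" if "b \<in> B" for b using g(2)[of f'] f' that by blast
    show "f' (h b) = f' b"
    proof (cases "g b \<in> g ` A x")
      case True
      then obtain c where c: "c \<in> A x" "g b = g c" by auto
      have "f' (h b) = f' (g a)" using True by (simp add: h_def)
      also have "\<dots> = f' a" using fg' a AB by blast
      also have "\<dots> = f' c" using f' x a c by blast
      also have "\<dots> = f' (g c)" using fg'[of c] c AB by auto
      also have "\<dots> = f' b" using c fg'[OF b] by simp
      finally show ?thesis .
    next
      case False
      then show ?thesis using fg'[OF b] by (simp add: h_def)
    qed
  qed
  ultimately show ?case by (intro exI[of _ h]) blast
qed

text \<open>The curve together with its outside is connected, unbounded and disjoint from
  \<open>S\<close>, so no bounded component of the complement of \<open>S\<close> can leave the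
  inside of the curve.\<close>

lemma inside_subset_inside:
  fixes c :: "real \<Rightarrow> complex"
  assumes "simple_path c" "pathfinish c = pathstart c" and S: "S \<subseteq> inside (path_image c)"
  shows "inside S \<subseteq> inside (path_image c)"
proof -
  note J = Jordan_inside_outside[OF assms(1,2)]
  let ?U = "outside (path_image c) \<union> path_image c"
  have "?U = closure (outside (path_image c))"
    using J by (metis closure_Un_frontier)
  then have con: "connected ?U" using J by (simp add: connected_imp_connected_closure)
  have unb: "\<not> bounded ?U" using J by (metis bounded_Un)
  have "inside (path_image c) \<inter> outside (path_image c) = {}" "inside (path_image c) \<union> outside (path_image c) = - path_image c"
    using J by auto
  then have "(inside (path_image c) - S) \<union> ?U = - S" using S by blast
  from inside_subset[OF con unb this] show ?thesis by blast
qed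

text \<open>A short subarc around \<open>b\<close> stays in a small ball; Janiszewski's theorem is applied to the Jordan curve
  and to the union of the sphere and the complementary subarc.\<close>

lemma inside_locally_connected_at_boundary:
  fixes p :: "real \<Rightarrow> complex"
  assumes p: "simple_path p" "pathfinish p = pathstart p" and b: "b \<in> path_image p" and e: "e > 0"
  obtains d where "d > 0" "\<And>y z. y \<in> ball b d \<inter> inside (path_image p) \<Longrightarrow> z \<in> ball b d \<inter> inside (path_image p) \<Longrightarrow>
     connected_component (ball b e \<inter> inside (path_image p)) y z"
proof -
  let ?D = "inside (path_image p)"
  have conD: "connected ?D" and frD: "frontier ?D = path_image p" using Jordan_inside_outside[OF p] by blast+
  have Dp: "?D \<inter> path_image p = {}" by (rule inside_no_overlap)
  obtain t0 where t0: "t0 \<in> {0..1}" "p t0 = b" using b unfolding path_image_def by auto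
  \<comment> \<open>The parametrisation is rotated to start and end at b. The complementary subarc
    is then the image of a single middle interval.\<close>
  define q where "q = shiftpath t0 p"
  have q: "simple_path q" "pathstart q = b" "pathfinish q = b" "path_image q = path_image p"
    using t0 p by (auto simp: q_def simple_path_shiftpath pathstart_shiftpath pathfinish_shiftpath path_image_shiftpath)
  have cq: "continuous_on {0..1} q" using q(1) by (simp add: simple_path_def path_def)
  have "\<exists>\<eta>>0. \<forall>s\<in>{0..1}. dist s u < \<eta> \<longrightarrow> dist (q s) b < e" if "u = 0 \<or> u = 1" for u :: real
  proof -
    have "u \<in> {0..1}" "q u = b" using that q by (auto simp: pathstart_def pathfinish_def)
    then show ?thesis using cq e unfolding continuous_on_iff by metis
  qed
  from this[of 0] this[of 1] obtain \<eta>0 \<eta>1 where \<eta>01: "\<eta>0 > 0" "\<And>s. s \<in> {0..1} \<Longrightarrow> dist s 0 < \<eta>0 \<Longrightarrow> dist (q s) b < e"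
     "\<eta>1 > 0" "\<And>s. s \<in> {0..1} \<Longrightarrow> dist s 1 < \<eta>1 \<Longrightarrow> dist (q s) b < e" by auto
  define \<eta> where "\<eta> = min (1/2) (min \<eta>0 \<eta>1 / 2)"
  have \<eta>: "0 < \<eta>" "\<eta> \<le> 1/2" "\<eta> < \<eta>0" "\<eta> < \<eta>1" using \<eta>01(1,3) by (auto simp: \<eta>_def)
  define R where "R = q ` {\<eta>..1 - \<eta>}"
  have cR: "compact R" "connected R"
    unfolding R_def using \<eta> by (auto intro!: compact_continuous_image connected_continuous_image continuous_on_subset[OF cq])
  have bR: "b \<notin> R"
  proof
    assume "b \<in> R"
    then obtain s where s: "\<eta> \<le> s" "s \<le> 1 - \<eta>" "q s = b" by (auto simp: R_def)
    have "q s = q 0" using s q by (simp add: pathstart_def)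
    moreover have "\<And>x y. x \<in> {0..1} \<Longrightarrow> y \<in> {0..1} \<Longrightarrow> q x = q y \<Longrightarrow> x = y \<or> x = 0 \<and> y = 1 \<or> x = 1 \<and> y = 0"
      using q(1) unfolding simple_path_def loop_free_def by blast
    moreover have "s \<in> {0..1}" "0 \<in> {0..1::real}" using s \<eta> by auto
    ultimately have "s = 0 \<or> s = 1" by metis
    then show False using s \<eta> by auto
  qed
  have near: "path_image p - R \<subseteq> ball b e"
  proof
    fix y assume y: "y \<in> path_image p - R"
    then have "y \<in> q ` {0..1}" using q(4) by (simp add: path_image_def)
    then obtain s where s: "s \<in> {0..1}" "y = q s" by blast
    then have "s < \<eta> \<or> s > 1 - \<eta>" using y by (force simp: R_def)
    then have "dist (q s) b < e" using \<eta>01 \<eta> s(1) by (auto simp: dist_real_def)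
    then show "y \<in> ball b e" using s by (simp add: dist_commute)
  qed
  have Rp: "R \<subseteq> path_image p" using q(4) \<eta> unfolding R_def path_image_def by fastforce
  have "open (- R)" using cR compact_imp_closed by blast
  then obtain d0 where d0: "d0 > 0" "ball b d0 \<subseteq> - R" using bR open_contains_ball by blast
  define d where "d = min d0 e"
  have d: "d > 0" "ball b d \<subseteq> - R" "d \<le> e" using d0 e by (auto simp: d_def)
  show ?thesis
  proof (rule that[OF d(1)])
    fix y z assume y: "y \<in> ball b d \<inter> ?D" and z: "z \<in> ball b d \<inter> ?D"
    let ?T = "sphere b e \<union> R"
    have "connected_component (- (path_image p \<union> ?T)) y z"
    proof (rule Janiszewski)
      show "compact (path_image p)" using p(1) by (simp add: compact_simple_path_image)
      show "closed ?T" by (intro closed_Un closed_sphere compact_imp_closed cR)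
      have "path_image p \<inter> ?T = R" using near Rp by auto
      then show "connected (path_image p \<inter> ?T)" using cR by simp
      show "connected_component (- path_image p) y z"
        unfolding connected_component_def using conD Dp y z by blast
      show "connected_component (- ?T) y z"
        unfolding connected_component_def using y z d by (intro exI[of _ "ball b d"]) auto
    qed
    then obtain X where X: "connected X" "X \<subseteq> - (path_image p \<union> ?T)" "y \<in> X" "z \<in> X"
      unfolding connected_component_def by blast
    have "X \<subseteq> ball b e"
    proof (rule ccontr)
      assume "\<not> X \<subseteq> ball b e"
      then have "X \<inter> frontier (ball b e) \<noteq> {}" 
        using X y d by (intro connected_Int_frontier) (auto intro: exI[of _ y])
      then show False using X(2) e by auto
    qed
    moreover have "X \<subseteq> ?D"
    proof (rule ccontr)
      assume "\<not> X \<subseteq> ?D"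
      then have "X \<inter> frontier ?D \<noteq> {}" 
        using X y by (intro connected_Int_frontier) auto
      then show False using X(2) frD by auto
    qed
    ultimately show "connected_component (ball b e \<inter> ?D) y z"
      unfolding connected_component_def using X by (intro exI[of _ X]) auto
  qed
qed

section \<open>Jordan curves with a corner at a saddle\<close>

definition rays :: "real \<Rightarrow> real \<Rightarrow> real \<Rightarrow> complex set" where
  "rays \<alpha> \<beta> e = {of_real r * cis \<alpha> |r. 0 \<le> r \<and> r < e} \<union> {of_real r * cis \<beta> |r. 0 \<le> r \<and> r < e}"

lemma segment_0_mem: "y \<in> closed_segment 0 (of_real r * cis \<alpha>) \<Longrightarrow> 0 \<le> r \<Longrightarrow> \<exists>s. 0 \<le> s \<and> s \<le> r \<and> y = of_real s * cis \<alpha>"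
proof -
  assume y: "y \<in> closed_segment 0 (of_real r * cis \<alpha>)" and r: "0 \<le> r"
  obtain u where u: "0 \<le> u" "u \<le> 1" "y = u *\<^sub>R (of_real r * cis \<alpha>)" using y by (auto simp: in_segment)
  have "u * r \<le> r" using u r by (simp add: mult_left_le_one_le)
  then show ?thesis using u r by (intro exI[of _ "u * r"]) (simp add: scaleR_conv_of_real)
qed

lemma segment_0_of: "0 \<le> s \<Longrightarrow> s \<le> r \<Longrightarrow> of_real s * cis \<alpha> \<in> closed_segment 0 (of_real r * cis \<alpha>)"
  by (cases "r = 0") (auto simp: in_segment scaleR_conv_of_real intro!: exI[of _ "s / r"])

lemma rays_eq_imp:
  assumes "of_real s * cis \<alpha> = of_real r * cis \<beta>" "0 < s" "0 \<le> r"
  shows "s = r" "cis \<alpha> = cis \<beta>"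
proof -
  have "norm (of_real s * cis \<alpha>) = norm (of_real r * cis \<beta>)" using assms by simp
  then show "s = r" using assms(2,3) by (simp add: norm_mult)
  then show "cis \<alpha> = cis \<beta>" using assms by simp
qed

text \<open>An arc inside the given path is cut down to the stretch between its last visit to the
  first segment and the next visit to the second. Closing it with two radial segments creates no
  further intersections. Near 0 only the radial segments remain, because the path avoids a ball
  around 0.\<close>

lemma loop_through_origin:
  assumes \<sigma>: "path \<sigma>" "0 \<notin> path_image \<sigma>" "pathstart \<sigma> = of_real r * cis \<alpha>" "pathfinish \<sigma> = of_real r * cis \<beta>"
    and r: "r > 0" and ab: "cis \<alpha> \<noteq> cis \<beta>"
  obtains J e where "simple_path J" "pathfinish J = pathstart J" "0 < e" "e \<le> r"
    "path_image J \<subseteq> path_image \<sigma> \<union> closed_segment 0 (of_real r * cis \<alpha>) \<union> closed_segment 0 (of_real r * cis \<beta>)"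
    "path_image J \<inter> ball 0 e = rays \<alpha> \<beta> e"
proof -
  define P0 Q0 where "P0 = of_real r * cis \<alpha>" and "Q0 = of_real r * cis \<beta>"
  let ?S\<alpha> = "closed_segment 0 P0" and ?S\<beta> = "closed_segment 0 Q0"
  have PQ: "P0 \<noteq> Q0" using r ab by (simp add: P0_def Q0_def)
  have inter: "y = 0" if y: "y \<in> ?S\<alpha>" "y \<in> ?S\<beta>" for y
  proof (rule ccontr)
    assume "y \<noteq> 0"
    obtain s where s: "0 \<le> s" "y = of_real s * cis \<alpha>" using segment_0_mem[of y r \<alpha>] y r by (auto simp: P0_def)
    obtain s' where s': "0 \<le> s'" "y = of_real s' * cis \<beta>" using segment_0_mem[of y r \<beta>] y r by (auto simp: Q0_def)
    have "s > 0" using s \<open>y \<noteq> 0\<close> by (cases "s = 0") auto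
    then show False using rays_eq_imp(2)[of s \<alpha> s' \<beta>] s s' ab by auto
  qed
  obtain a where a: "arc a" "path_image a \<subseteq> path_image \<sigma>" "pathstart a = P0" "pathfinish a = Q0"
    using path_contains_arc[OF \<sigma>(1,3,4)] PQ unfolding P0_def Q0_def by blast
  have ca: "continuous_on {0..1} a" and inja: "inj_on a {0..1}" using a(1) by (auto simp: arc_def path_def)
  have a0: "a t \<noteq> 0" if "t \<in> {0..1}" for t using that a(2) \<sigma>(2) by (force simp: path_image_def)
  \<comment> \<open>Its maximum \<open>t1\<close> is the last parameter on the first segment. The
    minimum \<open>t2\<close> of \<open>Y\<close>, restricted to later parameters, is then the first
    hit of the second segment.\<close>
  define X where "X = {0..1} \<inter> a -` ?S\<alpha>"
  have cX: "compact X" unfolding X_def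
    using continuous_closed_preimage[OF ca closed_atLeastAtMost closed_segment] bounded_subset[OF bounded_closed_interval]
    unfolding compact_eq_bounded_closed by (meson inf_le1)
  have "0 \<in> X" using a(3) by (auto simp: X_def pathstart_def)
  then obtain t1 where t1: "t1 \<in> X" "\<And>t. t \<in> X \<Longrightarrow> t \<le> t1" using compact_attains_sup[OF cX] by blast
  define Y where "Y = {t1..1} \<inter> a -` ?S\<beta>"
  have t101: "0 \<le> t1" "t1 \<le> 1" "a t1 \<in> ?S\<alpha>" using t1 by (auto simp: X_def)
  have cY: "compact Y" unfolding Y_def
    using continuous_closed_preimage[OF continuous_on_subset[OF ca] closed_atLeastAtMost closed_segment, of t1 1 0 Q0] t101
      bounded_subset[OF bounded_closed_interval]
    unfolding compact_eq_bounded_closed by (meson inf_le1 atLeastatMost_subset_iff order_refl)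
  have "1 \<in> Y" using a(4) t101 by (auto simp: Y_def pathfinish_def)
  then obtain t2 where t2: "t2 \<in> Y" "\<And>t. t \<in> Y \<Longrightarrow> t2 \<le> t" using compact_attains_inf[OF cY] by blast
  have t201: "t1 \<le> t2" "t2 \<le> 1" "a t2 \<in> ?S\<beta>" using t2 by (auto simp: Y_def)
  have "t1 \<noteq> t2" using inter[of "a t1"] t101 t201 a0[of t1] by auto
  then have t12: "t1 < t2" using t201 by simp
  define P Q where "P = a t1" and "Q = a t2"
  define a' where "a' = subpath t1 t2 a"
  have a': "arc a'" "pathstart a' = P" "pathfinish a' = Q" "path_image a' = a ` {t1..t2}"
    using t12 t101 t201 a(1) by (auto simp: a'_def P_def Q_def path_image_subpath intro!: arc_subpath_arc)
  have P0': "P \<noteq> 0" "Q \<noteq> 0" using a0 t101 t201 by (auto simp: P_def Q_def)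
  have segP: "closed_segment 0 P \<subseteq> ?S\<alpha>" "closed_segment 0 Q \<subseteq> ?S\<beta>"
    using t101 t201 by (auto simp: P_def Q_def closed_segment_subset)
  have i1: "path_image a' \<inter> ?S\<alpha> \<subseteq> {P}"
  proof
    fix y assume y: "y \<in> path_image a' \<inter> ?S\<alpha>"
    then obtain t where t: "t1 \<le> t" "t \<le> t2" "y = a t" unfolding a'(4) by auto
    then have "t \<in> X" using y t101 t201 by (auto simp: X_def)
    then show "y \<in> {P}" using t1(2)[of t] t by (simp add: P_def)
  qed
  have i2: "path_image a' \<inter> ?S\<beta> \<subseteq> {Q}"
  proof
    fix y assume y: "y \<in> path_image a' \<inter> ?S\<beta>"
    then obtain t where t: "t1 \<le> t" "t \<le> t2" "y = a t" unfolding a'(4) by auto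
    then have "t \<in> Y" using y t101 t201 by (auto simp: Y_def)
    then show "y \<in> {Q}" using t2(2)[of t] t by (simp add: Q_def)
  qed
  define J where "J = (linepath 0 P +++ a') +++ linepath Q 0"
  have arc1: "arc (linepath 0 P +++ a')"
    using P0' a' i1 segP by (intro arc_join) auto
  have pi1: "path_image (linepath 0 P +++ a') = closed_segment 0 P \<union> path_image a'"
    by (subst path_image_join) (auto simp: a')
  have simp: "simple_path J"
    unfolding J_def
  proof (rule simple_path_join_loop[OF arc1])
    show "arc (linepath Q 0)" using P0' by auto
    have "closed_segment 0 P \<inter> closed_segment Q 0 \<subseteq> {0}" 
      using inter segP by (auto simp: closed_segment_commute)
    moreover have "path_image a' \<inter> closed_segment Q 0 \<subseteq> {Q}" 
      using i2 segP by (auto simp: closed_segment_commute)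
    ultimately show "path_image (linepath 0 P +++ a') \<inter> path_image (linepath Q 0) \<subseteq> {pathstart (linepath 0 P +++ a'), pathstart (linepath Q 0)}"
      unfolding pi1 by auto
  qed (auto simp: a')
  have piJ: "path_image J = closed_segment 0 P \<union> path_image a' \<union> closed_segment 0 Q"
    unfolding J_def by (subst path_image_join) (auto simp: a' pi1 closed_segment_commute)
  have a's: "path_image a' \<subseteq> path_image \<sigma>" using a(2) t101 t201 unfolding a'(4) by (auto simp: path_image_def)
  have "open (- path_image \<sigma>)" using \<sigma>(1) by (simp add: closed_path_image open_Compl)
  then obtain e0 where e0: "e0 > 0" "ball 0 e0 \<subseteq> - path_image \<sigma>" using \<sigma>(2) open_contains_ball by blast
  define e where "e = min e0 (min r (min (norm P) (norm Q)))"
  have e: "0 < e" "e \<le> r" "e \<le> e0" "e \<le> norm P" "e \<le> norm Q" using e0 r P0' by (auto simp: e_def)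
  obtain rP where rP: "0 \<le> rP" "P = of_real rP * cis \<alpha>" using segment_0_mem[of P r \<alpha>] t101 r by (auto simp: P0_def P_def)
  obtain rQ where rQ: "0 \<le> rQ" "Q = of_real rQ * cis \<beta>" using segment_0_mem[of Q r \<beta>] t201 r by (auto simp: Q0_def Q_def)
  have nP: "norm P = rP" "norm Q = rQ" using rP rQ by (auto simp: norm_mult)
  have "path_image J \<inter> ball 0 e = rays \<alpha> \<beta> e"
  proof (intro set_eqI iffI)
    fix y assume y: "y \<in> path_image J \<inter> ball 0 e"
    then have ny: "norm y < e" by simp
    then have "y \<in> ball 0 e0" using e(3) by simp
    then have "y \<notin> path_image a'" using a's e0(2) by blast
    then consider "y \<in> closed_segment 0 P" | "y \<in> closed_segment 0 Q" using y piJ by blast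
    then show "y \<in> rays \<alpha> \<beta> e"
    proof cases
      case 1
      then obtain s where "0 \<le> s" "y = of_real s * cis \<alpha>" using segment_0_mem[of y rP \<alpha>] rP by auto
      then show ?thesis using ny by (auto simp: rays_def norm_mult)
    next
      case 2
      then obtain s where "0 \<le> s" "y = of_real s * cis \<beta>" using segment_0_mem[of y rQ \<beta>] rQ by auto
      then show ?thesis using ny by (auto simp: rays_def norm_mult)
    qed
  next
    fix y assume "y \<in> rays \<alpha> \<beta> e"
    then obtain s \<theta> where s: "0 \<le> s" "s < e" "y = of_real s * cis \<theta>" "\<theta> = \<alpha> \<or> \<theta> = \<beta>" unfolding rays_def by blast
    then have "y \<in> closed_segment 0 P \<union> closed_segment 0 Q"
      using segment_0_of[of s rP \<alpha>] segment_0_of[of s rQ \<beta>] e nP rP rQ by auto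
    then show "y \<in> path_image J \<inter> ball 0 e" unfolding piJ using s by (auto simp: norm_mult)
  qed
  moreover have "path_image J \<subseteq> path_image \<sigma> \<union> ?S\<alpha> \<union> ?S\<beta>" unfolding piJ using a's segP by auto
  moreover have "pathfinish J = pathstart J" unfolding J_def by simp
  ultimately show ?thesis using that[OF simp _ e(1,2)] unfolding P0_def Q0_def by blast
qed

definition sector :: "real \<Rightarrow> real \<Rightarrow> real \<Rightarrow> complex set" where
  "sector \<alpha> \<beta> e = {of_real r * cis \<theta> |r \<theta>. 0 < r \<and> r < e \<and> \<alpha> < \<theta> \<and> \<theta> < \<beta>}"

lemma connected_sector: "connected (sector \<alpha> \<beta> e)"
proof -
  have "sector \<alpha> \<beta> e = (\<lambda>p. of_real (fst p) * cis (snd p)) ` ({0<..<e} \<times> {\<alpha><..<\<beta>})"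
    unfolding sector_def by force
  then show ?thesis
    by (auto intro!: connected_continuous_image continuous_intros connected_Times)
qed

lemma cis_eq_imp:
  assumes "cis \<theta> = cis \<phi>" "\<bar>\<theta> - \<phi>\<bar> < 2 * pi" shows "\<theta> = \<phi>"
proof -
  have "cis (\<theta> - \<phi>) = 1" using assms(1) by (simp add: cis_divide[symmetric])
  then obtain k :: int where k: "\<theta> - \<phi> = of_int k * (2 * pi)" by (auto simp: cis_conv_exp exp_eq_1 mult_ac)
  then have "\<bar>of_int k\<bar> * (2 * pi) < 1 * (2 * pi)" using assms(2) by (simp add: abs_mult)
  then have "\<bar>real_of_int k\<bar> < 1" by (simp only: mult_less_cancel_right) auto
  then have "k = 0" by linarith
  then show ?thesis using k by simp
qed

lemma sector_disjoint_rays: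
  assumes "0 \<le> \<alpha>" "\<alpha> < \<beta>" "\<beta> < 2 * pi"
  shows "sector \<alpha> \<beta> e \<inter> rays \<alpha> \<beta> e = {}" "sector \<beta> (\<alpha> + 2 * pi) e \<inter> rays \<alpha> \<beta> e = {}"
proof -
  have gen: "sector \<gamma> \<gamma>' e \<inter> rays \<alpha> \<beta> e = {}" 
    if "\<And>\<theta>. \<gamma> < \<theta> \<Longrightarrow> \<theta> < \<gamma>' \<Longrightarrow> cis \<theta> \<noteq> cis \<alpha> \<and> cis \<theta> \<noteq> cis \<beta>" for \<gamma> \<gamma>'
  proof (rule ccontr)
    assume "sector \<gamma> \<gamma>' e \<inter> rays \<alpha> \<beta> e \<noteq> {}"
    then obtain r \<theta> s \<phi> where *: "0 < r" "\<gamma> < \<theta>" "\<theta> < \<gamma>'" "0 \<le> s" "\<phi> = \<alpha> \<or> \<phi> = \<beta>" "of_real r * cis \<theta> = of_real s * cis \<phi>"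
      unfolding sector_def rays_def by auto
    then show False using rays_eq_imp(2)[of r \<theta> s \<phi>] that[of \<theta>] by auto
  qed
  show "sector \<alpha> \<beta> e \<inter> rays \<alpha> \<beta> e = {}"
    by (rule gen) (use assms in \<open>auto dest!: cis_eq_imp\<close>)
  have "cis \<theta> \<noteq> cis \<alpha> \<and> cis \<theta> \<noteq> cis \<beta>" if "\<beta> < \<theta>" "\<theta> < \<alpha> + 2 * pi" for \<theta>
    using that assms by (auto dest!: cis_eq_imp)
  then show "sector \<beta> (\<alpha> + 2 * pi) e \<inter> rays \<alpha> \<beta> e = {}" by (rule gen)
qed

lemma ball_subset_sectors:
  assumes "0 \<le> \<alpha>" "\<alpha> < \<beta>" "\<beta> < 2 * pi"
  shows "ball 0 e \<subseteq> rays \<alpha> \<beta> e \<union> sector \<alpha> \<beta> e \<union> sector \<beta> (\<alpha> + 2 * pi) e"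
proof
  fix z :: complex assume z: "z \<in> ball 0 e"
  define \<theta> where "\<theta> = Arg2pi z"
  have \<theta>: "0 \<le> \<theta>" "\<theta> < 2 * pi" "z = of_real (norm z) * cis \<theta>" 
    using Arg2pi[of z] by (auto simp: \<theta>_def is_Arg_def cis_conv_exp)
  show "z \<in> rays \<alpha> \<beta> e \<union> sector \<alpha> \<beta> e \<union> sector \<beta> (\<alpha> + 2 * pi) e"
  proof (cases "z = 0")
    case True
    then show ?thesis using z by (force simp: rays_def)
  next
    case False
    consider "\<theta> = \<alpha> \<or> \<theta> = \<beta>" | "\<alpha> < \<theta>" "\<theta> < \<beta>" | "\<beta> < \<theta>" | "\<theta> < \<alpha>" using assms by linarith
    then show ?thesis
    proof cases
      case 1
      then show ?thesis using \<theta>(3) z unfolding rays_def by auto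
    next
      case 2
      then have "z \<in> sector \<alpha> \<beta> e" unfolding sector_def using \<theta>(3) z False
        by (intro CollectI exI[of _ "norm z"] exI[of _ \<theta>]) auto
      then show ?thesis by blast
    next
      case 3
      then have "z \<in> sector \<beta> (\<alpha> + 2 * pi) e" unfolding sector_def using \<theta> z False assms
        by (intro CollectI exI[of _ "norm z"] exI[of _ \<theta>]) auto
      then show ?thesis by blast
    next
      case 4
      have "cis (\<theta> + 2 * pi) = cis \<theta>" by (simp add: cis_mult[symmetric])
      then have "z = of_real (norm z) * cis (\<theta> + 2 * pi)" using \<theta>(3) by simp
      then have "z \<in> sector \<beta> (\<alpha> + 2 * pi) e" unfolding sector_def using z False assms 4 \<theta>(1)
        by (intro CollectI exI[of _ "norm z"] exI[of _ "\<theta> + 2 * pi"]) auto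
      then show ?thesis by blast
    qed
  qed
qed

text \<open>A Jordan curve is the frontier of its inside, so inside points occur in the small ball
  where the curve consists of two rays. They lie in one of the two sectors; each sector is connected
  and misses the curve, so the whole sector is inside.\<close>

lemma sector_inside_loop:
  fixes J :: "real \<Rightarrow> complex"
  assumes J: "simple_path J" "pathfinish J = pathstart J" and e: "0 < e"
    and \<alpha>: "0 \<le> \<alpha>" "\<alpha> < \<beta>" "\<beta> < 2 * pi"
    and T: "linear \<Lambda>" "bij \<Lambda>"
    and loc: "path_image J \<inter> (\<lambda>z. x + \<Lambda> z) ` ball 0 e = (\<lambda>z. x + \<Lambda> z) ` rays \<alpha> \<beta> e"
  shows "(\<lambda>z. x + \<Lambda> z) ` sector \<alpha> \<beta> e \<subseteq> inside (path_image J) \<or> 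
    (\<lambda>z. x + \<Lambda> z) ` sector \<beta> (\<alpha> + 2 * pi) e \<subseteq> inside (path_image J)"
proof -
  let ?I = "inside (path_image J)" and ?O = "outside (path_image J)"
  have JC: "open ?I" "open ?O" "?I \<inter> ?O = {}" "?I \<union> ?O = - path_image J" "frontier ?I = path_image J"
    using Jordan_inside_outside[OF J] by simp_all
  let ?T = "\<lambda>z. x + \<Lambda> z"
  let ?S1 = "sector \<alpha> \<beta> e" and ?S2 = "sector \<beta> (\<alpha> + 2 * pi) e"
  have injT: "inj ?T" using T(2) by (auto simp: inj_def bij_def)
  have cT: "continuous_on S ?T" for S using T(1) by (intro continuous_intros linear_continuous_on) (simp add: linear_conv_bounded_linear)
  have opT: "open (?T ` ball 0 e)"
    using open_translation[OF open_surjective_linear_image[OF open_ball T(1), of 0 e], of x] T(2)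
    by (simp add: image_image bij_def)
  have subball: "?S1 \<subseteq> ball 0 e" "?S2 \<subseteq> ball 0 e" unfolding sector_def by (auto simp: norm_mult)
  have disj: "?T ` S \<inter> path_image J = {}" if "S \<subseteq> ball 0 e" "S \<inter> rays \<alpha> \<beta> e = {}" for S
  proof -
    have "?T ` S \<inter> path_image J \<subseteq> ?T ` S \<inter> ?T ` rays \<alpha> \<beta> e" using loc that(1) by blast
    also have "\<dots> = ?T ` (S \<inter> rays \<alpha> \<beta> e)" using injT by (simp add: image_Int)
    finally show ?thesis using that(2) by simp
  qed
  have side: "?T ` S \<subseteq> inside (path_image J) \<or> ?T ` S \<subseteq> outside (path_image J)" 
    if "S \<subseteq> ball 0 e" "S \<inter> rays \<alpha> \<beta> e = {}" "connected S" for S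
  proof -
    have "connected (?T ` S)" using that(3) cT connected_continuous_image by blast
    moreover have "?T ` S \<subseteq> inside (path_image J) \<union> outside (path_image J)" using disj[OF that(1,2)] JC(4) by blast
    ultimately show ?thesis using JC(1-3) connectedD[of "?T ` S" ?I ?O] by blast
  qed
  define q where "q = ?T (of_real (e/2) * cis \<alpha>)"
  have "of_real (e/2) * cis \<alpha> \<in> rays \<alpha> \<beta> e" unfolding rays_def using e by (intro UnI1 CollectI exI[of _ "e/2"]) auto
  then have q: "q \<in> path_image J" "q \<in> ?T ` ball 0 e" using loc unfolding q_def by blast+
  then have "q \<in> closure ?I" using JC(5) by (metis frontier_def DiffD1)
  then have "?T ` ball 0 e \<inter> ?I \<noteq> {}" using open_Int_closure_eq_empty[OF opT, of ?I] q(2) by blast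
  then obtain y where y: "y \<in> ?I" "y \<in> ?T ` ball 0 e" by blast
  then obtain z where z: "z \<in> ball 0 e" "y = ?T z" by blast
  have "y \<notin> path_image J" using y(1) JC(4) by blast
  then have "z \<notin> rays \<alpha> \<beta> e" using z loc by blast
  then have "z \<in> ?S1 \<or> z \<in> ?S2" using ball_subset_sectors[OF \<alpha>, of e] z by blast
  moreover have "y \<notin> outside (path_image J)" using y(1) JC(3) by blast
  ultimately show ?thesis
    using side[OF subball(1) sector_disjoint_rays(1)[OF \<alpha>] connected_sector] 
      side[OF subball(2) sector_disjoint_rays(2)[OF \<alpha>] connected_sector] z(2) by blast
qed

section \<open>Saddles, ascending sectors and pits\<close>

lemma connected_component_set_closure:
  assumes "z \<in> closure (connected_component_set S a)" "z \<in> S"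
  shows "z \<in> connected_component_set S a"
proof -
  let ?C = "connected_component_set S a"
  have "a \<in> S"
  proof (rule ccontr)
    assume "a \<notin> S"
    then have "?C = {}" by (simp only: connected_component_eq_empty) simp
    then show False using assms(1) by (simp only: closure_empty empty_iff)
  qed
  then have a: "a \<in> ?C" by simp
  have "connected (insert z ?C)"
    by (rule connected_intermediate_closure[OF connected_connected_component[of S a]])
       (use assms(1) closure_subset[of ?C] in blast)+
  then have "insert z ?C \<subseteq> ?C"
    using a assms(2) connected_component_subset by (intro connected_component_maximal) auto
  then show ?thesis by blast
qed

definition ray :: "complex \<Rightarrow> (complex \<Rightarrow> complex) \<Rightarrow> real \<Rightarrow> real \<Rightarrow> complex" where
  "ray x \<Lambda> \<theta> r = x + \<Lambda> (of_real r * cis \<theta>)"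

text \<open>Of the normal form only the sign of w - w(x) along the 2 n extremal directions is kept.
  The counting is purely topological from here on.\<close>

definition saddle :: "(complex \<Rightarrow> real) \<Rightarrow> complex set \<Rightarrow> complex \<Rightarrow> nat \<Rightarrow> (complex \<Rightarrow> complex) \<Rightarrow> real \<Rightarrow> bool" where
  "saddle w D x n \<Lambda> \<delta> \<longleftrightarrow> 2 \<le> n \<and> linear \<Lambda> \<and> bij \<Lambda> \<and> 0 < \<delta> \<and> (\<forall>z. norm z < \<delta> \<longrightarrow> x + \<Lambda> z \<in> D) \<and>
     (\<forall>r \<theta>. 0 < r \<longrightarrow> r < \<delta> \<longrightarrow> cos (real n * \<theta>) = 1 \<longrightarrow> w x < w (ray x \<Lambda> \<theta> r)) \<and>
     (\<forall>r \<theta>. 0 < r \<longrightarrow> r < \<delta> \<longrightarrow> cos (real n * \<theta>) = -1 \<longrightarrow> w (ray x \<Lambda> \<theta> r) < w x)"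

definition up_angle :: "nat \<Rightarrow> nat \<Rightarrow> real" where "up_angle n k = 2 * pi * real k / real n"
definition down_angle :: "nat \<Rightarrow> nat \<Rightarrow> real" where "down_angle n k = (2 * real k + 1) * pi / real n"

lemma cos_up_angle: "n > 0 \<Longrightarrow> cos (real n * up_angle n k) = 1"
  using cos_int_2pin[of "int k"] by (simp add: up_angle_def mult_ac)

lemma cos_down_angle: "n > 0 \<Longrightarrow> cos (real n * down_angle n k) = -1"
proof -
  assume "n > 0"
  then have "real n * down_angle n k = 2 * real k * pi + pi" by (simp add: down_angle_def) (simp add: algebra_simps)
  moreover have "cos (2 * real k * pi) = 1" using cos_int_2pin[of "int k"] by (simp add: mult_ac)
  ultimately show ?thesis by (simp only: cos_periodic_pi)
qed

lemma up_angle_less_down_angle: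
  assumes "n > 0" "j \<le> k" shows "up_angle n j < down_angle n k"
proof -
  have "2 * real j * pi < (2 * real k + 1) * pi"
    using assms(2) by (intro mult_strict_right_mono) auto
  then have "2 * real j * pi / real n < (2 * real k + 1) * pi / real n"
    using assms(1) by (intro divide_strict_right_mono) auto
  then show ?thesis unfolding up_angle_def down_angle_def by (simp only: mult_ac)
qed

lemma down_angle_less_up_angle:
  assumes "n > 0" "k < j" shows "down_angle n k < up_angle n j"
proof -
  have "real k + 1 \<le> real j" using assms(2) by simp
  then have "(2 * real k + 1) * pi < 2 * real j * pi"
    by (intro mult_strict_right_mono) auto
  then have "(2 * real k + 1) * pi / real n < 2 * real j * pi / real n"
    using assms(1) by (intro divide_strict_right_mono) auto
  then show ?thesis unfolding up_angle_def down_angle_def by (simp only: mult_ac)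
qed

lemma up_angle_self: "n > 0 \<Longrightarrow> up_angle n n = 2 * pi"
  by (simp add: up_angle_def)

text \<open>Rotation by pi/n exchanges ascending and descending directions, so statements about
  superlevel sets can be reused for sublevel sets.\<close>

lemma saddle_uminus:
  assumes "saddle w D x n \<Lambda> \<delta>"
  shows "saddle (\<lambda>z. - w z) D x n (\<lambda>z. \<Lambda> (z * cis (pi / n))) \<delta>"
proof -
  have n: "2 \<le> n" and \<Lambda>: "linear \<Lambda>" "bij \<Lambda>" using assms by (auto simp: saddle_def)
  let ?R = "\<lambda>z. z * cis (pi / n)"
  have "linear ?R" by (rule linearI) (auto simp: algebra_simps)
  from linear_compose[OF this \<Lambda>(1)] have lin: "linear (\<lambda>z. \<Lambda> (?R z))" by (simp add: o_def)
  have "bij ?R" by (rule o_bij[of "\<lambda>z. z * cis (- (pi / n))"]) (auto simp: fun_eq_iff mult.assoc cis_mult)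
  from bij_comp[OF this \<Lambda>(2)] have bij: "bij (\<lambda>z. \<Lambda> (?R z))" by (simp add: o_def)
  have ray: "ray x (\<lambda>z. \<Lambda> (?R z)) \<theta> r = ray x \<Lambda> (\<theta> + pi / n) r" for \<theta> r
    by (simp add: ray_def mult.assoc cis_mult)
  have "cos (real n * (\<theta> + pi / n)) = - cos (real n * \<theta>)" for \<theta>
  proof -
    have "real n * (\<theta> + pi / n) = real n * \<theta> + pi" using n by (simp add: algebra_simps)
    then show ?thesis by simp
  qed
  note cosn = this
  have "x + \<Lambda> (?R z) \<in> D" if "norm z < \<delta>" for z
    using assms that unfolding saddle_def by (simp add: norm_mult)
  then show ?thesis using assms lin bij cosn unfolding saddle_def ray by simp
qed

text \<open>\<open>K\<close> is the hole together with the inner boundary curve.\<close>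

locale jordan_domain_function =
  fixes p :: "real \<Rightarrow> complex" and w :: "complex \<Rightarrow> real" and K :: "complex set" and H :: real
  assumes p: "simple_path p" "pathfinish p = pathstart p"
    and w: "continuous_on (closure (inside (path_image p))) w"
    and K: "compact K" "connected K" "K \<noteq> {}" "K \<subseteq> inside (path_image p)" and wK: "\<And>x. x \<in> K \<Longrightarrow> w x = H"
    and not_max: "\<And>x e. x \<in> inside (path_image p) - K \<Longrightarrow> e > 0 \<Longrightarrow> \<exists>y\<in>ball x e. w x < w y"
    and not_min: "\<And>x e. x \<in> inside (path_image p) - K \<Longrightarrow> e > 0 \<Longrightarrow> \<exists>y\<in>ball x e. w y < w x"
begin

abbreviation "D \<equiv> inside (path_image p)"
abbreviation "\<gamma> \<equiv> path_image p"

definition up :: "real \<Rightarrow> complex set" where "up c = {z \<in> D. c < w z}"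
definition lo :: "real \<Rightarrow> complex set" where "lo c = {z \<in> D. w z < c}"

lemma D: "open D" "connected D" "bounded D" "frontier D = \<gamma>" "D \<inter> \<gamma> = {}" "closure D = D \<union> \<gamma>"
proof -
  show "open D" "connected D" "bounded D" "frontier D = \<gamma>" using Jordan_inside_outside[OF p] by simp_all
  show "D \<inter> \<gamma> = {}" by (rule inside_no_overlap)
  show "closure D = D \<union> \<gamma>" using closure_Un_frontier[of D] \<open>frontier D = \<gamma>\<close> by simp
qed

lemma wD: "continuous_on D w"
  using w continuous_on_subset closure_subset by blast

lemma open_up: "open (up c)"
proof -
  have "open (D \<inter> w -` {c<..})" using continuous_open_preimage[OF wD D(1)] by simp
  moreover have "D \<inter> w -` {c<..} = up c" by (auto simp: up_def)
  ultimately show ?thesis by simp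
qed

lemma open_lo: "open (lo c)"
proof -
  have "open (D \<inter> w -` {..<c})" using continuous_open_preimage[OF wD D(1)] by simp
  moreover have "D \<inter> w -` {..<c} = lo c" by (auto simp: lo_def)
  ultimately show ?thesis by simp
qed

lemma uminus: "jordan_domain_function p (\<lambda>z. - w z) K (- H)"
  using p w K wK not_max not_min by unfold_locales (auto intro: continuous_intros)

text \<open>On the compact closure of the component \<open>w\<close> attains its minimum, below c
  and hence inside the component. Local minima are excluded off \<open>K\<close>, so the minimum is
  H and is taken on \<open>K\<close>; being connected with value H < c, all of \<open>K\<close>
  belongs to the component.\<close>

lemma pit_contains_K:
  assumes a: "a \<in> lo c" and cl: "closure (connected_component_set (lo c) a) \<subseteq> D"
  shows "K \<subseteq> connected_component_set (lo c) a" "H < c" "\<And>z. z \<in> connected_component_set (lo c) a \<Longrightarrow> H \<le> w z"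
proof -
  define Q where "Q = connected_component_set (lo c) a"
  have cl: "closure Q \<subseteq> D" using cl unfolding Q_def .
  have aQ: "a \<in> Q" using a by (simp add: Q_def)
  have clQ: "\<And>z. z \<in> Q \<Longrightarrow> z \<in> closure Q" using closure_subset[of Q] by (rule subsetD)
  have "bounded Q" by (rule bounded_subset[OF D(3)]) (use cl clQ in blast)
  then have cpt: "compact (closure Q)" by simp
  have ne: "closure Q \<noteq> {}" using clQ[OF aQ] by (metis empty_iff)
  have "continuous_on (closure Q) w" by (rule continuous_on_subset[OF wD cl])
  from continuous_attains_inf[OF cpt ne this]
  obtain z0 where z0: "z0 \<in> closure Q" "\<And>z. z \<in> closure Q \<Longrightarrow> w z0 \<le> w z" by blast
  have "w z0 \<le> w a" by (rule z0(2)[OF clQ[OF aQ]])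
  then have "z0 \<in> lo c" using a z0(1) cl by (auto simp: lo_def)
  then have z0Q: "z0 \<in> Q" using connected_component_set_closure z0(1) unfolding Q_def by blast
  have "z0 \<in> K"
  proof (rule ccontr)
    assume "z0 \<notin> K"
    have "open Q" unfolding Q_def by (rule open_connected_component[OF open_lo])
    then obtain e where e: "e > 0" "ball z0 e \<subseteq> Q" using z0Q open_contains_ball by blast
    obtain y where y: "y \<in> ball z0 e" "w y < w z0" using not_min[of z0 e] \<open>z0 \<notin> K\<close> \<open>z0 \<in> lo c\<close> e(1) by (auto simp: lo_def)
    have "w z0 \<le> w y" using z0(2) clQ e(2) y(1) by blast
    then show False using y(2) by simp
  qed
  then have Hz: "w z0 = H" using wK by blast
  then have H: "H < c" using \<open>z0 \<in> lo c\<close> by (simp add: lo_def)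
  have "K \<subseteq> lo c" using K(4) wK H by (auto simp: lo_def)
  then have "K \<subseteq> connected_component_set (lo c) z0" using \<open>z0 \<in> K\<close> K(2) by (intro connected_component_maximal)
  moreover have "connected_component_set (lo c) a = connected_component_set (lo c) z0"
    using connected_component_eq[of z0 "lo c" a] z0Q unfolding Q_def by simp
  ultimately show "K \<subseteq> connected_component_set (lo c) a" by simp
  show "H < c" by (rule H)
  show "H \<le> w z" if "z \<in> connected_component_set (lo c) a" for z
    using z0(2)[of z] Hz clQ that unfolding Q_def by simp
qed

text \<open>A connected set of points below c cannot cross a curve on which \<open>w\<close> is at
  least c. Its closure stays in the curve and its inside, which lie in \<open>D\<close>.\<close>

lemma inside_loop_pit:
  assumes J: "simple_path J" "pathfinish J = pathstart J" "path_image J \<subseteq> D" "path_image J \<inter> lo c = {}"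
    and a: "a \<in> lo c" "a \<in> inside (path_image J)"
  shows "connected_component_set (lo c) a \<subseteq> inside (path_image J)"
    "closure (connected_component_set (lo c) a) \<subseteq> D"
proof -
  define Q where "Q = connected_component_set (lo c) a"
  have aQ: "a \<in> Q" using a(1) by (simp add: Q_def)
  have conQ: "connected Q" by (simp add: Q_def)
  have fr: "frontier (inside (path_image J)) = path_image J" using Jordan_inside_outside[OF J(1,2)] by simp
  have QJ: "Q \<inter> path_image J = {}" using J(4) connected_component_subset[of "lo c" a] unfolding Q_def by blast
  have sub: "Q \<subseteq> inside (path_image J)"
  proof (rule ccontr)
    assume "\<not> Q \<subseteq> inside (path_image J)"
    then have "Q \<inter> frontier (inside (path_image J)) \<noteq> {}"
      using a(2) aQ by (intro connected_Int_frontier conQ) blast+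
    then show False using fr QJ by simp
  qed
  have "closure Q \<subseteq> closure (inside (path_image J))" using sub by (rule closure_mono)
  also have "\<dots> \<subseteq> path_image J \<union> inside (path_image J)"
    using J(1) by (intro closure_inside_subset) (simp add: closed_simple_path_image)
  also have "\<dots> \<subseteq> D" using J(3) inside_subset_inside[OF p J(3)] by blast
  finally have "closure Q \<subseteq> D" .
  with sub show "connected_component_set (lo c) a \<subseteq> inside (path_image J)"
    "closure (connected_component_set (lo c) a) \<subseteq> D" unfolding Q_def by blast+
qed

lemma ray_in_D:
  assumes "saddle w D x n \<Lambda> \<delta>" "0 \<le> r" "r < \<delta>"
  shows "ray x \<Lambda> \<theta> r \<in> D"
proof -
  have "norm (of_real r * cis \<theta>) < \<delta>" using assms(2,3) by (simp add: norm_mult)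
  then show ?thesis using assms(1) unfolding saddle_def ray_def by blast
qed

lemma ray_0: "saddle w D x n \<Lambda> \<delta> \<Longrightarrow> ray x \<Lambda> \<theta> 0 = x"
  by (simp add: saddle_def ray_def linear_0)

lemma ray_up: "saddle w D x n \<Lambda> \<delta> \<Longrightarrow> 0 < r \<Longrightarrow> r < \<delta> \<Longrightarrow> ray x \<Lambda> (up_angle n k) r \<in> up (w x)"
  using ray_in_D[of x n \<Lambda> \<delta> r] cos_up_angle[of n k] by (simp add: saddle_def up_def)

lemma ray_lo: "saddle w D x n \<Lambda> \<delta> \<Longrightarrow> 0 < r \<Longrightarrow> r < \<delta> \<Longrightarrow> ray x \<Lambda> (down_angle n k) r \<in> lo (w x)"
  using ray_in_D[of x n \<Lambda> \<delta> r] cos_down_angle[of n k] by (simp add: saddle_def lo_def)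

lemma continuous_on_ray:
  assumes "linear \<Lambda>"
  shows "continuous_on S (ray x \<Lambda> \<theta>)"
proof -
  have "bounded_linear \<Lambda>" using assms by (simp add: linear_conv_bounded_linear)
  moreover have "continuous_on S (\<lambda>r. complex_of_real r * cis \<theta>)" by (intro continuous_intros)
  ultimately have "continuous_on S (\<lambda>r. \<Lambda> (complex_of_real r * cis \<theta>))" by (rule bounded_linear.continuous_on)
  then show ?thesis unfolding ray_def by (intro continuous_on_add continuous_on_const)
qed

lemma ray_connected:
  assumes "saddle w D x n \<Lambda> \<delta>" "\<And>r. 0 < r \<Longrightarrow> r < \<delta> \<Longrightarrow> ray x \<Lambda> \<theta> r \<in> S" "0 < r" "r < \<delta>" "0 < s" "s < \<delta>"
  shows "connected_component S (ray x \<Lambda> \<theta> r) (ray x \<Lambda> \<theta> s)"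
proof -
  have "connected (ray x \<Lambda> \<theta> ` {0<..<\<delta>})"
    using assms(1) by (intro connected_continuous_image continuous_on_ray) (auto simp: saddle_def)
  moreover have "ray x \<Lambda> \<theta> ` {0<..<\<delta>} \<subseteq> S" using assms(2) by auto
  ultimately show ?thesis unfolding connected_component_def using assms(3-) by (intro exI[of _ "ray x \<Lambda> \<theta> ` {0<..<\<delta>}"]) auto
qed

text \<open>A path joining two ascending sectors away from the saddle is closed up along their rays
  to a Jordan curve through the saddle. On one side of its corner lie the descending rays with index
  from i to j - 1, on the other side all the rest; one whole group starts inside. \<open>G\<close>
  allows passage through other saddles of the level.\<close>

lemma coincidence_loop:
  assumes s: "saddle w D x n \<Lambda> \<delta>" and ij: "i < j" "j < n" and x: "x \<notin> G" 
    and path: "path_component (up (w x) \<union> G) (ray x \<Lambda> (up_angle n i) (\<delta>/2)) (ray x \<Lambda> (up_angle n j) (\<delta>/2))"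
  obtains J where "simple_path J" "pathfinish J = pathstart J" "path_image J \<subseteq> insert x (up (w x) \<union> G)"
    "(\<forall>k\<in>{i..<j}. \<exists>r. 0 < r \<and> r < \<delta> \<and> ray x \<Lambda> (down_angle n k) r \<in> inside (path_image J)) \<or>
     (\<forall>k\<in>{..<n} - {i..<j}. \<exists>r. 0 < r \<and> r < \<delta> \<and> ray x \<Lambda> (down_angle n k) r \<in> inside (path_image J))"
proof -
  have n: "2 \<le> n" and \<Lambda>: "linear \<Lambda>" "bij \<Lambda>" and \<delta>: "0 < \<delta>" using s by (auto simp: saddle_def)
  define \<alpha> \<beta> where "\<alpha> = up_angle n i" and "\<beta> = up_angle n j"
  have ab: "0 \<le> \<alpha>" "\<alpha> < \<beta>" "\<beta> < 2 * pi"
    using ij n by (auto simp: \<alpha>_def \<beta>_def up_angle_def field_simps)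
  define T where "T z = x + \<Lambda> z" for z
  define Ti where "Ti y = inv \<Lambda> (y - x)" for y
  have TTi: "T (Ti y) = y" "Ti (T y) = y" for y using \<Lambda>(2) by (auto simp: T_def Ti_def bij_def surj_f_inv_f)
  have Tray: "T (of_real r * cis \<theta>) = ray x \<Lambda> \<theta> r" for r \<theta> by (simp add: T_def ray_def)
  have linTi: "linear (inv \<Lambda>)" using inj_linear_imp_inv_linear[OF \<Lambda>(1)] \<Lambda>(2) by (simp add: bij_def)
  have cT: "continuous_on S T" for S unfolding T_def
    using \<Lambda>(1) by (intro continuous_intros bounded_linear.continuous_on[of \<Lambda>]) (simp_all add: linear_conv_bounded_linear)
  have cTi: "continuous_on S Ti" for S unfolding Ti_def
    using linTi by (intro bounded_linear.continuous_on[of "inv \<Lambda>"] continuous_intros) (simp add: linear_conv_bounded_linear)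
  have injT: "inj T" using TTi by (metis injI)
  obtain \<tau> where \<tau>: "path \<tau>" "path_image \<tau> \<subseteq> up (w x) \<union> G" "pathstart \<tau> = ray x \<Lambda> \<alpha> (\<delta>/2)" "pathfinish \<tau> = ray x \<Lambda> \<beta> (\<delta>/2)"
    using path unfolding path_component_def \<alpha>_def \<beta>_def by blast
  define \<sigma> where "\<sigma> = Ti \<circ> \<tau>"
  have im\<sigma>: "path_image \<sigma> = Ti ` path_image \<tau>" by (simp add: \<sigma>_def path_image_compose)
  have "path \<sigma>" unfolding \<sigma>_def by (intro path_continuous_image \<tau>(1) cTi)
  moreover have "0 \<notin> path_image \<sigma>"
  proof
    assume "0 \<in> path_image \<sigma>"
    then obtain y where "y \<in> path_image \<tau>" "Ti y = 0" unfolding im\<sigma> by auto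
    moreover have "T 0 = x" using \<Lambda>(1) by (simp add: T_def linear_0)
    ultimately have "x \<in> path_image \<tau>" using TTi(1)[of y] by simp
    then show False using \<tau>(2) x by (auto simp: up_def)
  qed
  moreover have "pathstart \<sigma> = of_real (\<delta>/2) * cis \<alpha>" "pathfinish \<sigma> = of_real (\<delta>/2) * cis \<beta>"
    unfolding \<sigma>_def pathstart_compose pathfinish_compose \<tau> Tray[symmetric] TTi by simp_all
  moreover have "cis \<alpha> \<noteq> cis \<beta>" using cis_eq_imp[of \<alpha> \<beta>] ab by auto
  ultimately obtain J0 e where J0: "simple_path J0" "pathfinish J0 = pathstart J0" "0 < e" "e \<le> \<delta>/2"
    "path_image J0 \<subseteq> path_image \<sigma> \<union> closed_segment 0 (of_real (\<delta>/2) * cis \<alpha>) \<union> closed_segment 0 (of_real (\<delta>/2) * cis \<beta>)"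
    "path_image J0 \<inter> ball 0 e = rays \<alpha> \<beta> e"
    using loop_through_origin[of \<sigma> "\<delta>/2" \<alpha> \<beta>] \<delta> by (metis half_gt_zero)
  define J where "J = T \<circ> J0"
  have imJ: "path_image J = T ` path_image J0" by (simp add: J_def path_image_compose)
  have simJ: "simple_path J" unfolding J_def
    using J0(1) by (rule simple_path_continuous_image) (use cT injT in \<open>auto intro: inj_on_subset\<close>)
  have loopJ: "pathfinish J = pathstart J" using J0(2) by (simp add: J_def pathstart_compose pathfinish_compose)
  have segup: "T ` closed_segment 0 (of_real (\<delta>/2) * cis (up_angle n k)) \<subseteq> insert x (up (w x))" for k
  proof clarify
    fix z assume "z \<in> closed_segment 0 (of_real (\<delta>/2) * cis (up_angle n k))" "T z \<notin> up (w x)"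
    then obtain r where r: "0 \<le> r" "r \<le> \<delta>/2" "z = of_real r * cis (up_angle n k)"
      using segment_0_mem[of z "\<delta>/2"] \<delta> by auto
    then have "T z = ray x \<Lambda> (up_angle n k) r" by (simp add: Tray)
    then have "r = 0" using ray_up[OF s, of r k] r \<delta> \<open>T z \<notin> up (w x)\<close> by force
    then show "T z = x" using r(3) \<Lambda>(1) by (simp add: T_def linear_0)
  qed
  have "T ` path_image \<sigma> = path_image \<tau>" unfolding im\<sigma> image_image TTi by simp
  then have subJ: "path_image J \<subseteq> insert x (up (w x) \<union> G)"
    using J0(5) segup[of i] segup[of j] \<tau>(2) unfolding imJ \<alpha>_def \<beta>_def by blast
  have "path_image J \<inter> T ` ball 0 e = T ` rays \<alpha> \<beta> e"
    unfolding imJ J0(6)[symmetric] using image_Int[OF injT] by simp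
  then have side: "T ` sector \<alpha> \<beta> e \<subseteq> inside (path_image J) \<or> T ` sector \<beta> (\<alpha> + 2 * pi) e \<subseteq> inside (path_image J)"
    using sector_inside_loop[OF simJ loopJ J0(3) ab \<Lambda>, of x] unfolding T_def by blast
  have r: "0 < e/2" "e/2 < e" "e/2 < \<delta>" using J0 \<delta> by auto
  have s1: "ray x \<Lambda> (down_angle n k) (e/2) \<in> T ` sector \<alpha> \<beta> e" if k: "k \<in> {i..<j}" for k
  proof -
    have "\<alpha> < down_angle n k" "down_angle n k < \<beta>"
      using n k unfolding \<alpha>_def \<beta>_def by (auto intro: up_angle_less_down_angle down_angle_less_up_angle)
    then have "of_real (e/2) * cis (down_angle n k) \<in> sector \<alpha> \<beta> e"
      unfolding sector_def using r by blast
    then show ?thesis unfolding Tray[symmetric] by (rule imageI)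
  qed
  have s2: "ray x \<Lambda> (down_angle n k) (e/2) \<in> T ` sector \<beta> (\<alpha> + 2 * pi) e" if k: "k \<in> {..<n} - {i..<j}" for k
  proof (cases "j \<le> k")
    case True
    have "\<beta> < down_angle n k" "down_angle n k < up_angle n n"
      using n k True unfolding \<beta>_def by (auto intro: up_angle_less_down_angle down_angle_less_up_angle)
    then have "\<beta> < down_angle n k" "down_angle n k < 2 * pi" using n by (simp_all add: up_angle_self)
    then have "\<beta> < down_angle n k" "down_angle n k < \<alpha> + 2 * pi" using ab by auto
    then have "of_real (e/2) * cis (down_angle n k) \<in> sector \<beta> (\<alpha> + 2 * pi) e"
      unfolding sector_def using r by blast
    then show ?thesis unfolding Tray[symmetric] by (rule imageI)
  next
    case False
    then have "k < i" using k by auto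
    then have "0 < down_angle n k" "down_angle n k < \<alpha>"
      using n down_angle_less_up_angle[of n k i] unfolding \<alpha>_def by (auto simp: down_angle_def)
    \<comment> \<open>Angles smaller than \<alpha> are raised by a full turn, to fit the second
      sector, which runs from \<beta> to \<alpha> + 2 pi.\<close>
    then have *: "\<beta> < down_angle n k + 2 * pi" "down_angle n k + 2 * pi < \<alpha> + 2 * pi" using ab by auto
    have "of_real (e/2) * cis (down_angle n k + 2 * pi) \<in> sector \<beta> (\<alpha> + 2 * pi) e"
      unfolding sector_def using r * by blast
    moreover have "cis (down_angle n k + 2 * pi) = cis (down_angle n k)" by (simp add: cis_mult[symmetric])
    ultimately show ?thesis unfolding Tray[symmetric] by (metis imageI)
  qed
  show ?thesis
  proof (rule that[OF simJ loopJ subJ])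
    show "(\<forall>k\<in>{i..<j}. \<exists>r. 0 < r \<and> r < \<delta> \<and> ray x \<Lambda> (down_angle n k) r \<in> inside (path_image J)) \<or>
     (\<forall>k\<in>{..<n} - {i..<j}. \<exists>r. 0 < r \<and> r < \<delta> \<and> ray x \<Lambda> (down_angle n k) r \<in> inside (path_image J))"
      using side s1 s2 r by blast
  qed
qed

text \<open>The sublevel component entered along the k-th descending ray. The half radius is only a
  base point; by \<open>pit_eq\<close> any point of the ray gives the same set.\<close>

definition pit :: "complex \<Rightarrow> nat \<Rightarrow> (complex \<Rightarrow> complex) \<Rightarrow> real \<Rightarrow> nat \<Rightarrow> complex set" where
  "pit x n \<Lambda> \<delta> k = connected_component_set (lo (w x)) (ray x \<Lambda> (down_angle n k) (\<delta>/2))"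

lemma pit_eq:
  assumes s: "saddle w D x n \<Lambda> \<delta>" and r: "0 < r" "r < \<delta>"
  shows "pit x n \<Lambda> \<delta> k = connected_component_set (lo (w x)) (ray x \<Lambda> (down_angle n k) r)"
  unfolding pit_def
  by (intro connected_component_eq, rule CollectI, intro ray_connected[OF s] ray_lo[OF s]) (use r in auto)

lemma ray_in_pit:
  assumes s: "saddle w D x n \<Lambda> \<delta>" and r: "0 < r" "r < \<delta>"
  shows "ray x \<Lambda> (down_angle n k) r \<in> pit x n \<Lambda> \<delta> k"
  unfolding pit_eq[OF assms] using ray_lo[OF s r] by simp

lemma closure_pit:
  assumes s: "saddle w D x n \<Lambda> \<delta>" 
  shows "x \<in> closure (pit x n \<Lambda> \<delta> k)"
proof -
  have \<delta>: "\<delta> > 0" and \<Lambda>: "linear \<Lambda>" using s by (auto simp: saddle_def)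
  have "continuous_on {0..\<delta>} (ray x \<Lambda> (down_angle n k))" by (rule continuous_on_ray[OF \<Lambda>])
  then have "((ray x \<Lambda> (down_angle n k)) \<longlongrightarrow> ray x \<Lambda> (down_angle n k) 0) (at 0 within {0..\<delta>})"
    using \<delta> by (simp add: continuous_on_def)
  then have "((ray x \<Lambda> (down_angle n k)) \<longlongrightarrow> x) (at_right 0)"
    unfolding ray_0[OF s] using \<delta> by (simp add: at_within_Icc_at_right)
  moreover have "\<forall>\<^sub>F r in at_right 0. ray x \<Lambda> (down_angle n k) r \<in> closure (pit x n \<Lambda> \<delta> k)"
    using \<delta> ray_in_pit[OF s] closure_subset unfolding eventually_at_right_field by blast
  ultimately show ?thesis
    by (intro Lim_in_closed_set[of "closure (pit x n \<Lambda> \<delta> k)"]) auto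
qed

text \<open>Equal pits would give, for -w, a loop through x that encloses the start of an ascending
  ray of w. Then \<open>pit_contains_K\<close> for -w yields w x < H.\<close>

lemma pits_distinct:
  assumes s: "saddle w D x n \<Lambda> \<delta>" and H: "H < w x" and kl: "k < n" "l < n" "k \<noteq> l"
  shows "pit x n \<Lambda> \<delta> k \<noteq> pit x n \<Lambda> \<delta> l"
proof -
  have main: False if kl: "k < l" "l < n" and eq: "pit x n \<Lambda> \<delta> k = pit x n \<Lambda> \<delta> l" for k l
  proof -
    interpret neg: jordan_domain_function p "\<lambda>z. - w z" K "- H" by (rule uminus)
    define \<Lambda>' where "\<Lambda>' z = \<Lambda> (z * cis (pi / n))" for z
    have s': "saddle (\<lambda>z. - w z) D x n \<Lambda>' \<delta>" unfolding \<Lambda>'_def by (rule saddle_uminus[OF s])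
    have n: "2 \<le> n" and \<delta>: "0 < \<delta>" using s by (auto simp: saddle_def)
    have uplo: "neg.up (- w x) = lo (w x)" by (auto simp: neg.up_def lo_def)
    have rays: "ray x \<Lambda>' (up_angle n j) r = ray x \<Lambda> (down_angle n j) r" for j r
    proof -
      have "cis (up_angle n j) * cis (pi / n) = cis (down_angle n j)"
        using n by (simp add: cis_mult up_angle_def down_angle_def field_simps)
      then show ?thesis by (simp add: ray_def \<Lambda>'_def mult.assoc)
    qed
    have "connected_component (lo (w x)) (ray x \<Lambda> (down_angle n k) (\<delta>/2)) (ray x \<Lambda> (down_angle n l) (\<delta>/2))"
      using ray_in_pit[OF s, of "\<delta>/2" l] eq \<delta> unfolding pit_def by auto
    then have pc: "path_component (neg.up (- w x) \<union> {}) (ray x \<Lambda>' (up_angle n k) (\<delta>/2)) (ray x \<Lambda>' (up_angle n l) (\<delta>/2))"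
      unfolding uplo rays using open_path_connected_component[OF open_lo] by simp
    obtain J where J: "simple_path J" "pathfinish J = pathstart J" "path_image J \<subseteq> insert x (neg.up (- w x) \<union> {})"
      "(\<forall>i\<in>{k..<l}. \<exists>r. 0 < r \<and> r < \<delta> \<and> ray x \<Lambda>' (down_angle n i) r \<in> inside (path_image J)) \<or>
       (\<forall>i\<in>{..<n} - {k..<l}. \<exists>r. 0 < r \<and> r < \<delta> \<and> ray x \<Lambda>' (down_angle n i) r \<in> inside (path_image J))"
      using neg.coincidence_loop[OF s' kl _ pc] by blast
    have "k \<in> {k..<l}" "l \<in> {..<n} - {k..<l}" using kl by auto
    then obtain i r where ir: "0 < r" "r < \<delta>" "ray x \<Lambda>' (down_angle n i) r \<in> inside (path_image J)"
      using J(4) by blast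
    have xD: "x \<in> D" using ray_in_D[OF s, of 0 0] \<delta> ray_0[OF s] by simp
    have JD: "path_image J \<subseteq> D" using J(3) xD by (auto simp: neg.up_def)
    have Jlo: "path_image J \<inter> neg.lo (- w x) = {}" using J(3) by (auto simp: neg.up_def neg.lo_def)
    have "- H < - w x"
      using neg.pit_contains_K(2)[OF neg.ray_lo[OF s' ir(1,2)] neg.inside_loop_pit(2)[OF J(1,2) JD Jlo neg.ray_lo[OF s' ir(1,2)] ir(3)]] .
    then show False using H by simp
  qed
  show ?thesis using kl main[of k l] main[of l k] by (cases k l rule: linorder_cases) auto
qed

text \<open>Every pit entered inside the loop contains \<open>K\<close>. As distinct pits are
  disjoint, only one descending ray starts inside, so the group of indices in
  \<open>coincidence_loop\<close> is a singleton.\<close>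

lemma coincidence_pit:
  assumes s: "saddle w D x n \<Lambda> \<delta>" and ij: "i < j" "j < n" and x: "x \<notin> G" and G: "\<And>z. z \<in> G \<Longrightarrow> z \<in> D \<and> w z = w x"
    and path: "path_component (up (w x) \<union> G) (ray x \<Lambda> (up_angle n i) (\<delta>/2)) (ray x \<Lambda> (up_angle n j) (\<delta>/2))"
  obtains J t where "simple_path J" "pathfinish J = pathstart J" "path_image J \<subseteq> insert x (up (w x) \<union> G)" "path_image J \<subseteq> D"
    "path_image J \<inter> lo (w x) = {}" "H < w x" "t < n" "t = i \<or> t = j" "K \<subseteq> pit x n \<Lambda> \<delta> t" "pit x n \<Lambda> \<delta> t \<subseteq> inside (path_image J)"
    "\<And>z. z \<in> pit x n \<Lambda> \<delta> t \<Longrightarrow> H \<le> w z"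
proof -
  have n: "2 \<le> n" and \<delta>: "0 < \<delta>" using s by (auto simp: saddle_def)
  obtain J where J: "simple_path J" "pathfinish J = pathstart J" "path_image J \<subseteq> insert x (up (w x) \<union> G)"
    "(\<forall>k\<in>{i..<j}. \<exists>r. 0 < r \<and> r < \<delta> \<and> ray x \<Lambda> (down_angle n k) r \<in> inside (path_image J)) \<or>
     (\<forall>k\<in>{..<n} - {i..<j}. \<exists>r. 0 < r \<and> r < \<delta> \<and> ray x \<Lambda> (down_angle n k) r \<in> inside (path_image J))"
    using coincidence_loop[OF s ij x path] by blast
  have xD: "x \<in> D" using ray_in_D[OF s, of 0 0] \<delta> ray_0[OF s] by simp
  have JD: "path_image J \<subseteq> D" using J(3) xD G by (auto simp: up_def)
  have Jlo: "path_image J \<inter> lo (w x) = {}" using J(3) G by (auto simp: up_def lo_def)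
  have inn: "K \<subseteq> pit x n \<Lambda> \<delta> k" "H < w x" "pit x n \<Lambda> \<delta> k \<subseteq> inside (path_image J)" "\<And>z. z \<in> pit x n \<Lambda> \<delta> k \<Longrightarrow> H \<le> w z"
    if k: "\<exists>r. 0 < r \<and> r < \<delta> \<and> ray x \<Lambda> (down_angle n k) r \<in> inside (path_image J)" for k
  proof -
    obtain r where r: "0 < r" "r < \<delta>" "ray x \<Lambda> (down_angle n k) r \<in> inside (path_image J)" using k by blast
    note lo = ray_lo[OF s r(1,2), of k]
    note ins = inside_loop_pit[OF J(1,2) JD Jlo lo r(3)]
    note pk = pit_contains_K[OF lo ins(2)]
    show "K \<subseteq> pit x n \<Lambda> \<delta> k" "H < w x" "pit x n \<Lambda> \<delta> k \<subseteq> inside (path_image J)" "\<And>z. z \<in> pit x n \<Lambda> \<delta> k \<Longrightarrow> H \<le> w z"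
      unfolding pit_eq[OF s r(1,2)] using pk ins by blast+
  qed
  obtain S where S: "S = {i..<j} \<or> S = {..<n} - {i..<j}" "\<And>k. k \<in> S \<Longrightarrow> \<exists>r. 0 < r \<and> r < \<delta> \<and> ray x \<Lambda> (down_angle n k) r \<in> inside (path_image J)"
    using J(4) by blast
  have Sn: "S \<subseteq> {..<n}" using S(1) ij by auto
  have single: "k = l" if "k \<in> S" "l \<in> S" for k l
  proof (rule ccontr)
    assume "k \<noteq> l"
    obtain z where z: "z \<in> K" using K(3) by blast
    have "z \<in> pit x n \<Lambda> \<delta> k" "z \<in> pit x n \<Lambda> \<delta> l" using inn(1)[OF S(2)] that z by blast+
    then have "pit x n \<Lambda> \<delta> k = pit x n \<Lambda> \<delta> l" unfolding pit_def by (metis connected_component_eq)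
    moreover have "H < w x" using inn(2)[OF S(2)[OF that(1)]] .
    ultimately show False using pits_distinct[OF s] that Sn \<open>k \<noteq> l\<close> by blast
  qed
  \<comment> \<open>The group \<open>{i..<j}\<close> contains i and the complementary group contains
    j. The single enclosed pit therefore carries one of these two indices.\<close>
  have "i \<in> S \<or> j \<in> S" using S(1) ij by auto
  then obtain t where t: "t \<in> S" "t = i \<or> t = j" by blast
  show ?thesis
    using that[OF J(1-3) JD Jlo _ _ t(2), of] inn[OF S(2)[OF t(1)]] t Sn by blast
qed

end

section \<open>Peaks of superlevel components\<close>

context jordan_domain_function begin

text \<open>\<open>Some b\<close> stands for a point of the boundary curve, \<open>None\<close> for the hole.\<close>

definition owned :: "real \<Rightarrow> complex set \<Rightarrow> complex option \<Rightarrow> bool" where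
  "owned c V \<beta> \<longleftrightarrow> (case \<beta> of Some b \<Rightarrow> b \<in> \<gamma> \<and> c < w b \<and> b \<in> closure V | None \<Rightarrow> K \<subseteq> V)"

abbreviation up_comp :: "real \<Rightarrow> complex \<Rightarrow> complex set" where
  "up_comp c a \<equiv> connected_component_set (up c) a"

text \<open>Near b continuity puts all points of \<open>D\<close> above c, and the local
  connectedness of \<open>D\<close> at its boundary joins those close enough to b within that
  neighbourhood.\<close>

lemma up_near_boundary:
  assumes b: "b \<in> \<gamma>" "c < w b"
  obtains d where "d > 0" "\<And>y z. y \<in> ball b d \<inter> D \<Longrightarrow> z \<in> ball b d \<inter> D \<Longrightarrow> connected_component (up c) y z"
proof -
  have "b \<in> closure D" using b(1) D(6) by simp
  then obtain e where e: "e > 0" "\<And>y. y \<in> closure D \<Longrightarrow> dist y b < e \<Longrightarrow> dist (w y) (w b) < w b - c"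
    using w b(2) unfolding continuous_on_iff by (metis diff_gt_0_iff_gt)
  obtain d where d: "d > 0" "\<And>y z. y \<in> ball b d \<inter> D \<Longrightarrow> z \<in> ball b d \<inter> D \<Longrightarrow> connected_component (ball b e \<inter> D) y z"
    using inside_locally_connected_at_boundary[OF p b(1) e(1)] by blast
  have "ball b e \<inter> D \<subseteq> up c"
  proof
    fix y assume y: "y \<in> ball b e \<inter> D"
    then have "dist (w y) (w b) < w b - c" using e(2)[of y] D(6) by (simp add: dist_commute)
    then show "y \<in> up c" using y by (auto simp: up_def dist_real_def)
  qed
  then show ?thesis using that[OF d(1)] d(2) connected_component_of_subset by blast
qed

text \<open>All of \<open>D\<close> near b lies in one component. Hence a maximum of w over the
  boundary points of the closure is a local maximum relative to the whole curve.\<close>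

lemma up_comp_boundary:
  assumes b: "b \<in> \<gamma>" "c < w b" "b \<in> closure (up_comp c a)"
  shows "\<forall>\<^sub>F y in at b within \<gamma>. y \<in> closure (up_comp c a)"
proof -
  define V where "V = up_comp c a"
  obtain d where d: "d > 0" "\<And>y z. y \<in> ball b d \<inter> D \<Longrightarrow> z \<in> ball b d \<inter> D \<Longrightarrow> connected_component (up c) y z"
    using up_near_boundary[OF b(1,2)] by blast
  have VD: "V \<subseteq> D" unfolding V_def using connected_component_subset[of "up c" a] by (auto simp: up_def)
  have "ball b d \<inter> V \<noteq> {}" using b(3) d(1) open_Int_closure_eq_empty[OF open_ball, of b d V] unfolding V_def[symmetric]
    by (metis IntI centre_in_ball empty_iff)
  then obtain v where v: "v \<in> ball b d" "v \<in> V" by blast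
  have sub: "ball b d \<inter> D \<subseteq> V"
  proof
    fix y assume "y \<in> ball b d \<inter> D"
    then have "connected_component (up c) v y" using d(2) v VD by blast
    then show "y \<in> V" using v(2) unfolding V_def by (metis connected_component_trans mem_Collect_eq)
  qed
  have "y \<in> closure V" if y: "y \<in> \<gamma>" "dist y b < d" for y
  proof -
    have "y \<in> ball b d \<inter> closure D" using y D(6) by (simp add: dist_commute)
    then have "y \<in> closure (ball b d \<inter> D)" using open_Int_closure_subset[OF open_ball] by blast
    then show ?thesis using closure_mono[OF sub] by blast
  qed
  then show ?thesis unfolding eventually_at V_def[symmetric] using d(1) by blast
qed

text \<open>Two components owning the same boundary point come arbitrarily close to it and are
  joined there by \<open>up_near_boundary\<close>; two components owning the hole share the points
  of \<open>K\<close>.\<close>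

lemma owned_unique:
  assumes "owned c (up_comp c a) \<beta>" "owned c (up_comp c a') \<beta>"
  shows "up_comp c a = up_comp c a'"
proof -
  define V V' where "V = up_comp c a" and "V' = up_comp c a'"
  have VD: "V \<subseteq> D" "V' \<subseteq> D" unfolding V_def V'_def using connected_component_subset[of "up c"] by (auto simp: up_def)
  have "\<exists>v\<in>V. \<exists>v'\<in>V'. connected_component (up c) v v'"
  proof (cases \<beta>)
    case None
    then have "K \<subseteq> V" "K \<subseteq> V'" using assms unfolding owned_def V_def V'_def by auto
    then obtain z where z: "z \<in> V" "z \<in> V'" using K(3) by blast
    then have "z \<in> up c" unfolding V_def using connected_component_subset by blast
    then show ?thesis using z connected_component_refl by blast
  next
    case (Some b)
    then have b: "b \<in> \<gamma>" "c < w b" "b \<in> closure V" "b \<in> closure V'" using assms unfolding owned_def V_def V'_def by auto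
    obtain d where d: "d > 0" "\<And>y z. y \<in> ball b d \<inter> D \<Longrightarrow> z \<in> ball b d \<inter> D \<Longrightarrow> connected_component (up c) y z"
      using up_near_boundary[OF b(1,2)] by blast
    have "ball b d \<inter> V \<noteq> {}" "ball b d \<inter> V' \<noteq> {}"
      using b(3,4) d(1) open_Int_closure_eq_empty[OF open_ball, of b d] by (metis IntI centre_in_ball empty_iff)+
    then show ?thesis using d(2) VD by blast
  qed
  then obtain v v' where v: "v \<in> V" "v' \<in> V'" "connected_component (up c) v v'" by blast
  have "V = up_comp c v" using v(1) connected_component_eq[of v "up c" a] unfolding V_def by simp
  moreover have "V' = up_comp c v'" using v(2) connected_component_eq[of v' "up c" a'] unfolding V'_def by simp
  moreover have "up_comp c v' = up_comp c v" using v(3) connected_component_eq[of v' "up c" v] by simp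
  ultimately show ?thesis unfolding V_def V'_def by simp
qed

lemma owned_mono: "owned c' V \<beta> \<Longrightarrow> c \<le> c' \<Longrightarrow> V \<subseteq> W \<Longrightarrow> owned c W \<beta>"
  unfolding owned_def using closure_mono[of V W] by (auto split: option.splits)

text \<open>If the closure has a boundary point above c, the highest such point is a local maximum
  of the boundary values. Otherwise w attains its maximum over the closure in the component itself,
  where only points of \<open>K\<close> are possible.\<close>

lemma peak_exists:
  assumes a: "a \<in> up c"
  shows "(\<exists>b\<in>local_max_points w \<gamma>. owned c (up_comp c a) (Some b)) \<or>
     (owned c (up_comp c a) None \<and> (\<forall>z\<in>up_comp c a. w z \<le> H))"
proof -
  define V where "V = up_comp c a"
  have aV: "a \<in> V" using a by (simp add: V_def)
  have clV: "\<And>z. z \<in> V \<Longrightarrow> z \<in> closure V" using closure_subset[of V] by (rule subsetD)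
  have Vup: "V \<subseteq> up c" unfolding V_def by (rule connected_component_subset)
  then have VD: "V \<subseteq> D" by (auto simp: up_def)
  have clVD: "closure V \<subseteq> closure D" using VD by (rule closure_mono)
  have "bounded V" using D(3) VD by (rule bounded_subset)
  then have cptV: "compact (closure V)" by simp
  have contV: "continuous_on (closure V) w" by (rule continuous_on_subset[OF w clVD])
  show ?thesis
  proof (cases "\<exists>q\<in>closure V \<inter> \<gamma>. c < w q")
    case True
    then obtain q where q: "q \<in> closure V \<inter> \<gamma>" "c < w q" by blast
    have "compact \<gamma>" using p(1) by (simp add: compact_simple_path_image)
    then have cpt: "compact (closure V \<inter> \<gamma>)" using cptV by (intro compact_Int)
    have ne: "closure V \<inter> \<gamma> \<noteq> {}" using q(1) by blast
    have "continuous_on (closure V \<inter> \<gamma>) w" by (rule continuous_on_subset[OF contV]) blast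
    from continuous_attains_sup[OF cpt ne this]
    obtain b where b: "b \<in> closure V" "b \<in> \<gamma>" "\<And>y. y \<in> closure V \<Longrightarrow> y \<in> \<gamma> \<Longrightarrow> w y \<le> w b" by blast
    have wb: "c < w b" using q b(3)[of q] by auto
    have "\<forall>\<^sub>F y in at b within \<gamma>. y \<in> closure V"
      using up_comp_boundary[OF b(2) wb] b(1) unfolding V_def by blast
    moreover have "\<forall>\<^sub>F y in at b within \<gamma>. y \<in> \<gamma>" by (simp add: eventually_at_filter)
    ultimately have "\<forall>\<^sub>F y in at b within \<gamma>. w y \<le> w b" by eventually_elim (rule b(3))
    then have "b \<in> local_max_points w \<gamma>" using b(2) by (simp add: local_max_points_def)
    moreover have "owned c V (Some b)" using b wb by (simp add: owned_def)
    ultimately show ?thesis unfolding V_def by blast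
  next
    case False
    have ne: "closure V \<noteq> {}" using clV[OF aV] by (metis empty_iff)
    from continuous_attains_sup[OF cptV ne contV]
    obtain z0 where z0: "z0 \<in> closure V" "\<And>z. z \<in> closure V \<Longrightarrow> w z \<le> w z0" by blast
    have "c < w a" using a by (simp add: up_def)
    also have "w a \<le> w z0" by (rule z0(2)[OF clV[OF aV]])
    finally have wz0: "c < w z0" .
    then have "z0 \<notin> \<gamma>" using False z0(1) by blast
    then have "z0 \<in> D" using z0(1) clVD D(6) by blast
    then have z0up: "z0 \<in> up c" using wz0 by (simp add: up_def)
    then have z0V: "z0 \<in> V" using connected_component_set_closure z0(1) unfolding V_def by blast
    have "z0 \<in> K"
    proof (rule ccontr)
      assume "z0 \<notin> K"
      have "open V" unfolding V_def by (rule open_connected_component[OF open_up])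
      then obtain e where e: "e > 0" "ball z0 e \<subseteq> V" using z0V open_contains_ball by blast
      obtain y where y: "y \<in> ball z0 e" "w z0 < w y" using not_max[of z0 e] \<open>z0 \<notin> K\<close> \<open>z0 \<in> D\<close> e(1) by blast
      have "w y \<le> w z0" using z0(2) clV e(2) y(1) by blast
      then show False using y(2) by simp
    qed
    then have Hz: "w z0 = H" using wK by blast
    have "K \<subseteq> up c" using K(4) wK Hz wz0 by (auto simp: up_def)
    then have "K \<subseteq> up_comp c z0" using \<open>z0 \<in> K\<close> K(2) by (intro connected_component_maximal)
    moreover have "up_comp c z0 = V" using connected_component_eq[of z0 "up c" a] z0V unfolding V_def by simp
    ultimately have "owned c V None" by (simp add: owned_def)
    moreover have "\<forall>z\<in>V. w z \<le> H" using z0(2) clV Hz by simp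
    ultimately show ?thesis unfolding V_def by blast
  qed
qed

text \<open>A boundary maximum is preferred, so \<open>None\<close> occurs only for components whose
  maximum is attained on the hole.\<close>

definition peak :: "real \<Rightarrow> complex set \<Rightarrow> complex option" where
  "peak c V = (if \<exists>b\<in>local_max_points w \<gamma>. owned c V (Some b) 
     then Some (SOME b. b \<in> local_max_points w \<gamma> \<and> owned c V (Some b)) else None)"

lemma peak:
  assumes "a \<in> up c"
  shows "owned c (up_comp c a) (peak c (up_comp c a))" "peak c (up_comp c a) \<in> insert None (Some ` local_max_points w \<gamma>)"
proof -
  have "owned c (up_comp c a) (peak c (up_comp c a)) \<and> peak c (up_comp c a) \<in> insert None (Some ` local_max_points w \<gamma>)"
  proof (cases "\<exists>b\<in>local_max_points w \<gamma>. owned c (up_comp c a) (Some b)")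
    case True
    then have "\<exists>b. b \<in> local_max_points w \<gamma> \<and> owned c (up_comp c a) (Some b)" by blast
    from someI_ex[OF this] True show ?thesis unfolding peak_def by simp
  next
    case False
    then have "owned c (up_comp c a) None" using peak_exists[OF assms] by blast
    then show ?thesis using False unfolding peak_def by simp
  qed
  then show "owned c (up_comp c a) (peak c (up_comp c a))" "peak c (up_comp c a) \<in> insert None (Some ` local_max_points w \<gamma>)" by blast+
qed

lemma peak_Some:
  assumes "\<exists>b\<in>local_max_points w \<gamma>. owned c V (Some b)"
  shows "peak c V \<in> Some ` local_max_points w \<gamma>"
proof -
  have "\<exists>b. b \<in> local_max_points w \<gamma> \<and> owned c V (Some b)" using assms by blast
  from someI_ex[OF this] assms show ?thesis unfolding peak_def by simp
qed

text \<open>The path component of \<open>Y\<close> containing a superlevel component that owns the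
  vertex. By \<open>owned_unique\<close> the choice does not matter once an owner exists.\<close>

definition label :: "real \<Rightarrow> complex set \<Rightarrow> complex option \<Rightarrow> complex set" where
  "label c Y \<beta> = path_component_set Y (SOME z. z \<in> up c \<and> owned c (up_comp c z) \<beta>)"

lemma label_eq:
  assumes Y: "up c \<subseteq> Y" and z: "z \<in> up c" "owned c (up_comp c z) \<beta>"
  shows "label c Y \<beta> = path_component_set Y z"
proof -
  define z' where "z' = (SOME z. z \<in> up c \<and> owned c (up_comp c z) \<beta>)"
  have "\<exists>z. z \<in> up c \<and> owned c (up_comp c z) \<beta>" using z by blast
  from someI_ex[OF this] have z': "z' \<in> up c" "owned c (up_comp c z') \<beta>" unfolding z'_def by blast+
  have "up_comp c z = up_comp c z'" by (rule owned_unique[OF z(2) z'(2)])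
  then have "connected_component (up c) z z'" using z'(1) by (metis connected_component_refl mem_Collect_eq)
  then have "path_component (up c) z z'" using open_path_connected_component[OF open_up] by simp
  then have "path_component Y z z'" using Y path_component_of_subset by blast
  then have "path_component_set Y z = path_component_set Y z'" by (metis path_component_eq mem_Collect_eq)
  then show ?thesis unfolding label_def z'_def[symmetric] by simp
qed

end

section \<open>Exceptional saddles and the forest count\<close>

locale saddle_family = jordan_domain_function +
  fixes F :: "complex set" and n :: "complex \<Rightarrow> nat" and \<Lambda> :: "complex \<Rightarrow> complex \<Rightarrow> complex" and \<delta> :: "complex \<Rightarrow> real"
  assumes F: "finite F" and sad: "x \<in> F \<Longrightarrow> saddle w D x (n x) (\<Lambda> x) (\<delta> x)"
begin

definition upt :: "complex \<Rightarrow> nat \<Rightarrow> complex" where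
  "upt x k = ray x (\<Lambda> x) (up_angle (n x) k) (\<delta> x / 2)"

definition vpeak :: "complex \<Rightarrow> nat \<Rightarrow> complex option" where
  "vpeak x k = peak (w x) (up_comp (w x) (upt x k))"

definition level :: "complex \<Rightarrow> complex set" where
  "level x = {y \<in> F. w y = w x}"

definition coinc :: "complex \<Rightarrow> complex set \<Rightarrow> nat \<Rightarrow> nat \<Rightarrow> bool" where
  "coinc x G i j \<longleftrightarrow> path_component (up (w x) \<union> G) (upt x i) (upt x j)"

text \<open>An exceptional saddle: two of its ascending sectors meet strictly above its level, up to other saddles
  of the same level.\<close>

definition exc :: "complex \<Rightarrow> bool" where
  "exc x \<longleftrightarrow> (\<exists>i j. i < j \<and> j < n x \<and> coinc x (level x - {x}) i j)"

abbreviation "vpit x \<equiv> pit x (n x) (\<Lambda> x) (\<delta> x)"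

lemma \<delta>_pos: "x \<in> F \<Longrightarrow> 0 < \<delta> x" and n_ge: "x \<in> F \<Longrightarrow> 2 \<le> n x"
  using sad by (auto simp: saddle_def)

lemma FD: "x \<in> F \<Longrightarrow> x \<in> D"
  using ray_in_D[OF sad, of x 0 0] ray_0[OF sad, of x 0] \<delta>_pos[of x] by simp

lemma upt_up: "x \<in> F \<Longrightarrow> upt x k \<in> up (w x)"
  unfolding upt_def using \<delta>_pos[of x] by (intro ray_up[OF sad]) auto

lemma level_D: "z \<in> level x \<Longrightarrow> z \<in> D \<and> w z = w x"
  using FD by (auto simp: level_def)

lemma coinc_mono: "coinc x G i j \<Longrightarrow> G \<subseteq> G' \<Longrightarrow> coinc x G' i j"
  unfolding coinc_def using path_component_of_subset[of "up (w x) \<union> G" "up (w x) \<union> G'"] by blast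

lemma coinc_pit:
  assumes x: "x \<in> F" and ij: "i < j" "j < n x" and G: "x \<notin> G" "G \<subseteq> level x" and co: "coinc x G i j"
  shows "\<exists>J t. simple_path J \<and> pathfinish J = pathstart J \<and> path_image J \<subseteq> insert x (up (w x) \<union> G) \<and> path_image J \<subseteq> D \<and>
    path_image J \<inter> lo (w x) = {} \<and> H < w x \<and> t < n x \<and> (t = i \<or> t = j) \<and> K \<subseteq> vpit x t \<and> vpit x t \<subseteq> inside (path_image J) \<and>
    (\<forall>z\<in>vpit x t. H \<le> w z)"
proof -
  have G': "\<And>z. z \<in> G \<Longrightarrow> z \<in> D \<and> w z = w x" using G(2) level_D by blast
  show ?thesis
    by (rule coincidence_pit[OF sad[OF x] ij G(1) G' co[unfolded coinc_def upt_def]]) blast+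
qed

lemma special_pit_unique:
  assumes x: "x \<in> F" and H: "H < w x" and "s < n x" "t < n x" "K \<subseteq> vpit x s" "K \<subseteq> vpit x t"
  shows "s = t"
proof (rule ccontr)
  assume "s \<noteq> t"
  obtain z where "z \<in> K" using K(3) by blast
  then have "z \<in> vpit x s" "z \<in> vpit x t" using assms by blast+
  then have "vpit x s = vpit x t" unfolding pit_def by (metis connected_component_eq)
  then show False using pits_distinct[OF sad[OF x] H assms(3,4) \<open>s \<noteq> t\<close>] by simp
qed

lemma other_index:
  assumes "x \<in> F" "t < n x" obtains l where "l < n x" "l \<noteq> t"
  using n_ge[OF assms(1)] by (cases "t = 0") (auto intro: that[of 1] that[of 0])

lemma vpit_open: "open (vpit x k)"
  unfolding pit_def by (rule open_connected_component[OF open_lo])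

lemma vpit_lo: "vpit x k \<subseteq> lo (w x)"
  unfolding pit_def by (rule connected_component_subset)

lemma ray_near:
  assumes x: "x \<in> F" and N: "open N" "x \<in> N"
  obtains r where "0 < r" "r < \<delta> x" "ray x (\<Lambda> x) \<theta> r \<in> N"
proof -
  have c: "continuous_on {0..\<delta> x} (ray x (\<Lambda> x) \<theta>)" 
    using sad[OF x] by (intro continuous_on_ray) (simp add: saddle_def)
  then have "((ray x (\<Lambda> x) \<theta>) \<longlongrightarrow> ray x (\<Lambda> x) \<theta> 0) (at 0 within {0..\<delta> x})"
    using \<delta>_pos[OF x] by (simp add: continuous_on_def)
  then have "((ray x (\<Lambda> x) \<theta>) \<longlongrightarrow> x) (at_right 0)"
    unfolding ray_0[OF sad[OF x]] using \<delta>_pos[OF x] by (simp add: at_within_Icc_at_right)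
  then have "\<forall>\<^sub>F r in at_right 0. ray x (\<Lambda> x) \<theta> r \<in> N" using N by (rule topological_tendstoD)
  then obtain b where b: "0 < b" "\<And>r. 0 < r \<Longrightarrow> r < b \<Longrightarrow> ray x (\<Lambda> x) \<theta> r \<in> N" unfolding eventually_at_right_field by blast
  have "0 < min b (\<delta> x) / 2" "min b (\<delta> x) / 2 < b" "min b (\<delta> x) / 2 < \<delta> x" using b(1) \<delta>_pos[OF x] by auto
  then show ?thesis using that b(2) by blast
qed

text \<open>All descending rays of a saddle enclosed by the loop start inside, so all its pits
  contain \<open>K\<close>. In the applications this contradicts \<open>special_pit_unique\<close>,
  since a saddle has at least two pits.\<close>

lemma pit_in_loop_contains_K:
  assumes J: "simple_path J" "pathfinish J = pathstart J" "path_image J \<subseteq> D" "path_image J \<inter> lo (w y) = {}"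
    and x: "x \<in> F" and lo: "lo (w x) \<subseteq> lo (w y)" and N: "open N" "N \<subseteq> inside (path_image J)" "x \<in> N"
  shows "K \<subseteq> vpit x l" "H < w x"
proof -
  obtain r where r: "0 < r" "r < \<delta> x" "ray x (\<Lambda> x) (down_angle (n x) l) r \<in> N"
    using ray_near[OF x N(1,3)] by blast
  note rl = ray_lo[OF sad[OF x] r(1,2), of l]
  have "path_image J \<inter> lo (w x) = {}" using J(4) lo by blast
  note ins = inside_loop_pit[OF J(1-3) this rl subsetD[OF N(2) r(3)]]
  from pit_contains_K[OF rl ins(2)] show "K \<subseteq> vpit x l" "H < w x"
    unfolding pit_eq[OF sad[OF x] r(1,2)] by blast+
qed

text \<open>A coincidence at y that avoids x gives a loop whose enclosed pit contains
  \<open>K\<close> and so equals the special pit of x. Then x is in the closure of that pit but not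
  on the loop, hence enclosed, and every pit of x would contain \<open>K\<close>.\<close>

lemma exc_same_level:
  assumes x: "x \<in> F" "exc x" and y: "y \<in> F" "y \<noteq> x" "w y = w x" and ij: "i < j" "j < n y"
  shows "\<not> coinc y (level y - {x, y}) i j"
proof
  assume co: "coinc y (level y - {x, y}) i j"
  obtain i' j' where "i' < j'" "j' < n x" "coinc x (level x - {x}) i' j'" using x(2) unfolding exc_def by blast
  from coinc_pit[OF x(1) this(1,2) _ _ this(3)]
  obtain t where t: "H < w x" "t < n x" "K \<subseteq> vpit x t" by blast
  from coinc_pit[OF y(1) ij _ _ co] obtain J s where J: "simple_path J" "pathfinish J = pathstart J"
    "path_image J \<subseteq> insert y (up (w y) \<union> (level y - {x, y}))" "path_image J \<subseteq> D" "path_image J \<inter> lo (w y) = {}"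
    "s < n y" "K \<subseteq> vpit y s" "vpit y s \<subseteq> inside (path_image J)" by blast
  have xJ: "x \<notin> path_image J" using J(3) y by (auto simp: up_def)
  obtain z where z: "z \<in> K" using K(3) by blast
  have "z \<in> vpit x t" "z \<in> vpit y s" using z t J by blast+
  then have "vpit x t = vpit y s" unfolding pit_def y(3) by (metis connected_component_eq)
  then have "x \<in> closure (vpit y s)" using closure_pit[OF sad[OF x(1)], of t] by simp
  moreover have "closure (vpit y s) \<subseteq> path_image J \<union> inside (path_image J)"
    using closure_mono[OF J(8)] closure_inside_subset[OF closed_simple_path_image[OF J(1)]] by blast
  ultimately have xin: "x \<in> inside (path_image J)" using xJ by blast
  have op: "open (inside (path_image J))" using Jordan_inside_outside[OF J(1,2)] by simp
  obtain l where l: "l < n x" "l \<noteq> t" using other_index[OF x(1) t(2)] by blast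
  have "K \<subseteq> vpit x l"
    by (rule pit_in_loop_contains_K(1)[OF J(1,2,4,5) x(1) _ op order_refl xin]) (simp add: y(3))
  then show False using special_pit_unique[OF x(1) t(1) l(1) t(2) _ t(3)] l(2) by blast
qed

text \<open>Used in both directions, so exceptional saddles share one level. If y were lower, its
  special pit together with y would lie in the special pit of x, inside the loop at x; then every
  pit of y would contain \<open>K\<close>.\<close>

lemma exc_levels_le:
  assumes x: "x \<in> F" "exc x" and y: "y \<in> F" "exc y"
  shows "w x \<le> w y"
proof (rule ccontr)
  assume "\<not> w x \<le> w y"
  then have lt: "w y < w x" by simp
  obtain i j where "i < j" "j < n x" "coinc x (level x - {x}) i j" using x(2) unfolding exc_def by blast
  from coinc_pit[OF x(1) this(1,2) _ _ this(3)]
  obtain J t where J: "simple_path J" "pathfinish J = pathstart J" "path_image J \<subseteq> D" "path_image J \<inter> lo (w x) = {}"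
    "K \<subseteq> vpit x t" "vpit x t \<subseteq> inside (path_image J)" by blast
  obtain i' j' where "i' < j'" "j' < n y" "coinc y (level y - {y}) i' j'" using y(2) unfolding exc_def by blast
  from coinc_pit[OF y(1) this(1,2) _ _ this(3)]
  obtain s where s: "H < w y" "s < n y" "K \<subseteq> vpit y s" by blast
  obtain z where z: "z \<in> K" using K(3) by blast
  have zx: "z \<in> vpit x t" "z \<in> vpit y s" using z J s by blast+
  have Qx: "vpit x t = connected_component_set (lo (w x)) z" using zx(1) unfolding pit_def by (metis connected_component_eq)
  have lolo: "lo (w y) \<subseteq> lo (w x)" using lt by (auto simp: lo_def)
  have cn: "connected (vpit y s)" by (simp add: pit_def)
  have "y \<in> closure (vpit y s)" by (rule closure_pit[OF sad[OF y(1)]])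
  then have "connected (insert y (vpit y s))"
    by (intro connected_intermediate_closure[OF cn]) (use closure_subset[of "vpit y s"] in blast)+
  moreover have "insert y (vpit y s) \<subseteq> lo (w x)" using vpit_lo[of y s] lolo FD[OF y(1)] lt by (auto simp: lo_def)
  ultimately have "insert y (vpit y s) \<subseteq> vpit x t"
    unfolding Qx using zx(2) by (intro connected_component_maximal) auto
  then have "y \<in> vpit x t" by blast
  obtain l where l: "l < n y" "l \<noteq> s" using other_index[OF y(1) s(2)] by blast
  have "K \<subseteq> vpit y l"
    by (rule pit_in_loop_contains_K(1)[OF J(1-4) y(1) lolo vpit_open J(6) \<open>y \<in> vpit x t\<close>])
  then show False using special_pit_unique[OF y(1) s(1) l(1) s(2) _ s(3)] l(2) by blast
qed

text \<open>The special pit has w \<ge> H, while a component peaking only at the hole has w \<le> H.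
  Their intersection is an open neighbourhood of \<open>K\<close> on which w = H, and a point of it
  outside \<open>K\<close> violates \<open>not_max\<close>.\<close>

lemma exc_no_K_peak:
  assumes x: "x \<in> F" "exc x" and a: "a \<in> up c"
  shows "\<exists>b\<in>local_max_points w \<gamma>. owned c (up_comp c a) (Some b)"
proof (rule ccontr)
  assume "\<not> ?thesis"
  then have V: "K \<subseteq> up_comp c a" "\<And>z. z \<in> up_comp c a \<Longrightarrow> w z \<le> H"
    using peak_exists[OF a] by (auto simp: owned_def)
  obtain i j where "i < j" "j < n x" "coinc x (level x - {x}) i j" using x(2) unfolding exc_def by blast
  from coinc_pit[OF x(1) this(1,2) _ _ this(3)]
  obtain t where t: "K \<subseteq> vpit x t" "\<And>z. z \<in> vpit x t \<Longrightarrow> H \<le> w z" by blast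
  define W where "W = up_comp c a \<inter> vpit x t"
  have W: "open W" "K \<subseteq> W" "\<And>z. z \<in> W \<Longrightarrow> w z = H"
    unfolding W_def using open_connected_component[OF open_up] vpit_open V t by (auto intro!: antisym)
  \<comment> \<open>A nonempty compact set is not open in the plane.\<close>
  have "W \<noteq> K"
  proof
    assume "W = K"
    then have "open K" "closed K" using W(1) K(1) compact_imp_closed by auto
    then have "K = {} \<or> K = UNIV" using clopen by blast
    then show False using K(1,3) by auto
  qed
  then obtain z where z: "z \<in> W" "z \<notin> K" using W(2) by blast
  obtain e where e: "e > 0" "ball z e \<subseteq> W" using W(1) z(1) open_contains_ball by blast
  have "z \<in> D" using z(1) vpit_lo[of x t] by (auto simp: W_def lo_def)
  then obtain y where "y \<in> ball z e" "w z < w y" using not_max[of z e] z(2) e(1) by blast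
  then show False using W(3) e(2) z(1) by (metis less_irrefl subsetD)
qed

lemma path_to_upt:
  assumes x: "x \<in> F" and Y: "up (w x) \<subseteq> Y" "x \<in> Y"
  shows "path_component Y x (upt x k)"
proof -
  define g where "g t = ray x (\<Lambda> x) (up_angle (n x) k) (\<delta> x / 2 * t)" for t
  have "continuous_on {0..1} g"
    unfolding g_def using sad[OF x]
    by (intro continuous_on_compose2[OF continuous_on_ray[of "\<Lambda> x" UNIV]]) (auto simp: saddle_def intro!: continuous_intros)
  moreover have "g t \<in> Y" if "t \<in> {0..1}" for t
  proof (cases "t = 0")
    case True
    then show ?thesis using Y(2) by (simp add: g_def ray_0[OF sad[OF x]])
  next
    case False
    then have "0 < \<delta> x / 2 * t" "\<delta> x / 2 * t < \<delta> x" using that \<delta>_pos[OF x] 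
      by (auto intro: le_less_trans[of _ "\<delta> x / 2 * 1"])
    then show ?thesis using ray_up[OF sad[OF x]] Y(1) unfolding g_def by blast
  qed
  ultimately show ?thesis unfolding path_component_def
    by (intro exI[of _ g]) (auto simp: path_def path_image_def pathstart_def pathfinish_def g_def upt_def ray_0[OF sad[OF x]])
qed

lemma label_vpeak:
  assumes x: "x \<in> F" and c: "c \<le> w x" and Y: "up c \<subseteq> Y"
  shows "label c Y (vpeak x k) = path_component_set Y (upt x k)"
proof (rule label_eq[OF Y])
  have sub: "up (w x) \<subseteq> up c" using c by (auto simp: up_def)
  show "upt x k \<in> up c" using upt_up[OF x, of k] sub by blast
  have "owned (w x) (up_comp (w x) (upt x k)) (vpeak x k)"
    unfolding vpeak_def by (rule peak(1)[OF upt_up[OF x]])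
  then show "owned c (up_comp c (upt x k)) (vpeak x k)"
    by (rule owned_mono[OF _ c]) (rule connected_component_mono[OF sub])
qed

text \<open>All ascending rays start at the saddle, so its sectors lie in one path component of any
  \<open>Y\<close> that contains the saddle and its superlevel set.\<close>

lemma label_vpeak_const:
  assumes x: "x \<in> F" and c: "c \<le> w x" and Y: "up c \<subseteq> Y" "w x = c \<Longrightarrow> x \<in> Y"
  shows "label c Y (vpeak x k) = label c Y (vpeak x l)"
proof -
  have sub: "up (w x) \<subseteq> Y" using c Y(1) by (auto simp: up_def)
  have "x \<in> Y" using Y c FD[OF x] by (cases "w x = c") (auto simp: up_def)
  from path_to_upt[OF x sub this] have "path_component_set Y (upt x i) = path_component_set Y x" for i
    using path_component_eq[of "upt x i" Y x] by simp
  then show ?thesis unfolding label_vpeak[OF x c Y(1)] by simp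
qed

text \<open>Every coincidence at an exceptional saddle involves the index of the one pit containing the hole, so
  removing this index leaves sectors that pairwise do not meet.\<close>

definition dropped :: "complex \<Rightarrow> nat set" where
  "dropped x = (if exc x then {t. t < n x \<and> K \<subseteq> vpit x t} else {})"

lemma exc_H: "x \<in> F \<Longrightarrow> exc x \<Longrightarrow> H < w x"
  unfolding exc_def using coinc_pit[of x _ _ "level x - {x}"] by blast

lemma not_coinc_dropped:
  assumes x: "x \<in> F" "exc x" and ij: "i < j" "j < n x" "i \<notin> dropped x" "j \<notin> dropped x" and G: "x \<notin> G" "G \<subseteq> level x"
  shows "\<not> coinc x G i j"
proof
  assume "coinc x G i j"
  from coinc_pit[OF x(1) ij(1,2) G this] obtain t where "t < n x" "t = i \<or> t = j" "K \<subseteq> vpit x t" by blast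
  then show False using ij(3,4) x(2) by (auto simp: dropped_def)
qed

lemma card_dropped: "x \<in> F \<Longrightarrow> card (dropped x) \<le> 1"
proof (cases "exc x")
  case True
  assume x: "x \<in> F"
  have "\<exists>t. dropped x \<subseteq> {t}"
  proof (cases "dropped x = {}")
    case False
    then obtain t where t: "t \<in> dropped x" by blast
    then have "dropped x \<subseteq> {t}"
      using special_pit_unique[OF x exc_H[OF x True]] True by (auto simp: dropped_def)
    then show ?thesis by blast
  qed auto
  then obtain t where "dropped x \<subseteq> {t}" by blast
  then show ?thesis using card_mono[of "{t}" "dropped x"] by simp
qed (simp add: dropped_def)

theorem sum_saddles_le:
  assumes M: "finite (local_max_points w \<gamma>)"
  shows "(\<Sum>x\<in>F. n x - 1) \<le> card (local_max_points w \<gamma>)"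
proof (cases "F = {}")
  case False
  let ?M = "local_max_points w \<gamma>"
  \<comment> \<open>If several points are exceptional, they share a level and one of them, processed last there, accounts for all.\<close>
  define E where "E = (if \<exists>x\<in>F. exc x then {SOME x. x \<in> F \<and> exc x} else {})"
  have E: "x \<in> F \<and> exc x" if "x \<in> E" for x
  proof -
    have ex: "\<exists>x\<in>F. exc x" using that by (auto simp: E_def split: if_splits)
    then have "\<exists>x. x \<in> F \<and> exc x" by blast
    from someI_ex[OF this] show ?thesis using that ex by (simp add: E_def)
  qed
  have E_ex: "E \<noteq> {}" if "x \<in> F" "exc x" for x using that by (auto simp: E_def)
  have E_unique: "x = y" if "x \<in> E" "y \<in> E" for x y using that by (auto simp: E_def split: if_splits)
  define I where "I x = {..<n x} - (if x \<in> E then dropped x else {})" for x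
  define A where "A x = vpeak x ` I x" for x
  \<comment> \<open>For x outside \<open>E\<close>, a coincidence makes x exceptional, hence at the
    level of the chosen y in \<open>E\<close>. As \<open>G\<close> avoids y,
    \<open>exc_same_level\<close> excludes this.\<close>
  have indep: "\<not> coinc x G i j"
    if x: "x \<in> F" and ij: "i \<in> I x" "j \<in> I x" "i < j" and G: "G \<subseteq> level x - {x}" "x \<notin> E \<Longrightarrow> G \<inter> E = {}" for x G i j
  proof (cases "x \<in> E")
    case True
    then show ?thesis using not_coinc_dropped[OF x] E[OF True] ij G(1) by (auto simp: I_def)
  next
    case False
    show ?thesis
    proof
      assume co: "coinc x G i j"
      have j: "j < n x" using ij by (auto simp: I_def)
      have "coinc x (level x - {x}) i j" by (rule coinc_mono[OF co G(1)])
      then have ex: "exc x" unfolding exc_def using ij(3) j by blast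
      then obtain y where y: "y \<in> E" using E_ex[OF x] by blast
      have "w x = w y" using exc_levels_le[of x y] exc_levels_le[of y x] x ex E[OF y] by force
      moreover have "G \<subseteq> level x - {y, x}" using G False y by blast
      ultimately show False
        using exc_same_level[of y x i j] E[OF y] x y False ij(3) j coinc_mono[OF co] by metis
    qed
  qed
  have Isub: "I x \<subseteq> {..<n x}" for x by (auto simp: I_def)
  have inj_label: "inj_on (\<lambda>i. label (w x) (up (w x) \<union> G) (vpeak x i)) (I x)"
    if x: "x \<in> F" and G: "G \<subseteq> level x - {x}" "x \<notin> E \<Longrightarrow> G \<inter> E = {}" for x G
  proof (rule inj_onI)
    fix i j assume ij: "i \<in> I x" "j \<in> I x" and eq: "label (w x) (up (w x) \<union> G) (vpeak x i) = label (w x) (up (w x) \<union> G) (vpeak x j)"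
    have "path_component_set (up (w x) \<union> G) (upt x i) = path_component_set (up (w x) \<union> G) (upt x j)"
      using eq unfolding label_vpeak[OF x order_refl Un_upper1] .
    moreover have "upt x k \<in> up (w x) \<union> G" for k using upt_up[OF x] by blast
    ultimately have "coinc x G i j" "coinc x G j i" unfolding coinc_def
      by (metis mem_Collect_eq path_component_refl)+
    then show "i = j" using indep[OF x ij(1,2) _ G] indep[OF x ij(2,1) _ G] by (cases i j rule: linorder_cases) auto
  qed
  have cardA: "card (A x) = card (I x)" if x: "x \<in> F" for x
  proof -
    have "inj_on (vpeak x) (I x)"
      using inj_label[OF x, of "{}"] by (auto simp: inj_on_def)
    then show ?thesis unfolding A_def by (rule card_image)
  qed
  have cardI: "card (I x) \<ge> n x - (if x \<in> E then 1 else 0)" if x: "x \<in> F" for x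
  proof (cases "x \<in> E")
    case True
    have "n x - card (dropped x) \<le> card ({..<n x} - dropped x)"
      using diff_card_le_card_Diff[of "dropped x" "{..<n x}"] by (simp add: dropped_def)
    then show ?thesis using True card_dropped[OF x] by (simp add: I_def)
  qed (simp add: I_def)
  have Ane: "A x \<noteq> {}" if x: "x \<in> F" for x
  proof -
    have "card (I x) > 0" using cardI[OF x] n_ge[OF x] by (auto split: if_splits)
    then show ?thesis unfolding A_def by (metis card.empty image_is_empty less_irrefl)
  qed
  \<comment> \<open>Once an exceptional saddle exists, no sector has the hole as its only peak, so
    the vertex \<open>None\<close> is saved. This pays for the index dropped at the chosen
    saddle.\<close>
  define B where "B = (if E = {} then insert None (Some ` ?M) else Some ` ?M)"
  have finB: "finite B" using M by (simp add: B_def)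
  have AB: "A x \<subseteq> B" if x: "x \<in> F" for x
  proof
    fix \<beta> assume "\<beta> \<in> A x"
    then obtain k where k: "\<beta> = vpeak x k" by (auto simp: A_def)
    show "\<beta> \<in> B"
    proof (cases "E = {}")
      case True
      then show ?thesis using peak(2)[OF upt_up[OF x]] unfolding k vpeak_def B_def by simp
    next
      case False
      then obtain y where "y \<in> F" "exc y" using E by blast
      from peak_Some[OF exc_no_K_peak[OF this upt_up[OF x]]] show ?thesis using False unfolding k vpeak_def B_def by simp
    qed
  qed
  have last: "\<exists>x\<in>G. \<exists>f :: complex option \<Rightarrow> complex set. inj_on f (A x) \<and> (\<forall>y\<in>G - {x}. \<forall>b\<in>A y. \<forall>b'\<in>A y. f b = f b')"
    if G: "G \<subseteq> F" "G \<noteq> {}" for G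
  proof -
    have finG: "finite G" using G(1) F finite_subset by blast
    \<comment> \<open>The lowest level is contracted last: all higher saddles already lie in
      \<open>up c\<close>, so their labels are constant, while the sectors of a saddle at level c
      are still distinguished.\<close>
    define c where "c = Min (w ` G)"
    have c: "\<And>y. y \<in> G \<Longrightarrow> c \<le> w y" using finG by (simp add: c_def)
    have "c \<in> w ` G" unfolding c_def using finG G(2) by (intro Min_in) auto
    then obtain x0 where x0: "x0 \<in> G" "w x0 = c" by blast
    \<comment> \<open>Among the saddles at the lowest level the chosen exceptional one is taken if
      present. For it all other saddles of the level may be added to \<open>Y\<close>, because its
      offending index has been dropped.\<close>
    obtain x where x: "x \<in> G" "w x = c" "x \<notin> E \<Longrightarrow> {y \<in> G. w y = c} \<inter> E = {}"
    proof (cases "{y \<in> G. w y = c} \<inter> E = {}")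
      case True
      then show ?thesis using that[of x0] x0 by blast
    next
      case False
      then show ?thesis using that by blast
    qed
    have xF: "x \<in> F" using x G by blast
    define G' where "G' = {y \<in> G. w y = c} - {x}"
    define f where "f = label c (up c \<union> G')"
    have "G' \<subseteq> level x - {x}" "x \<notin> E \<Longrightarrow> G' \<inter> E = {}"
      using x G(1) by (auto simp: G'_def level_def)
    from inj_label[OF xF this] have "inj_on (\<lambda>i. f (vpeak x i)) (I x)"
      unfolding f_def x(2) .
    then have "inj_on f (A x)" unfolding A_def by (auto simp: inj_on_def)
    moreover have "f b = f b'" if y: "y \<in> G - {x}" and b: "b \<in> A y" "b' \<in> A y" for y b b'
    proof -
      obtain k l where "b = vpeak y k" "b' = vpeak y l" using b by (auto simp: A_def)
      moreover have "y \<in> F" using y G by blast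
      ultimately show ?thesis unfolding f_def
        using label_vpeak_const[of y c "up c \<union> G'" k l] c[of y] y by (auto simp: G'_def)
    qed
    ultimately show ?thesis using x(1) by blast
  qed
  have "\<exists>g. g ` B \<subseteq> B \<and> (\<forall>f :: complex option \<Rightarrow> complex set. (\<forall>y\<in>F. \<forall>b\<in>A y. \<forall>b'\<in>A y. f b = f b') \<longrightarrow> (\<forall>b\<in>B. f (g b) = f b)) \<and>
      card (g ` B) + (\<Sum>x\<in>F. card (A x) - 1) \<le> card B"
    by (rule hypergraph_forest[OF F finB AB Ane last])
  then obtain g :: "complex option \<Rightarrow> complex option"
    where g: "card (g ` B) + (\<Sum>x\<in>F. card (A x) - 1) \<le> card B" by - (elim exE conjE, rule that)
  \<comment> \<open>At least one representative survives all contractions. This is the subtracted 1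
    of the forest count.\<close>
  have "B \<noteq> {}" using AB Ane \<open>F \<noteq> {}\<close> by blast
  then have "card (g ` B) \<ge> 1" using finB by (simp add: Suc_leI card_gt_0_iff)
  moreover have "(\<Sum>x\<in>F. n x - 1) \<le> (\<Sum>x\<in>F. card (A x) - 1) + card E"
  proof -
    have EF: "E \<subseteq> F" using E by blast
    have "(\<Sum>x\<in>F. n x - 1) \<le> (\<Sum>x\<in>F. (card (A x) - 1) + (if x \<in> E then 1 else 0))"
    proof (rule sum_mono)
      fix x assume x: "x \<in> F"
      show "n x - 1 \<le> (card (A x) - 1) + (if x \<in> E then 1 else 0)"
        using cardI[OF x] cardA[OF x] n_ge[OF x] by (auto split: if_splits)
    qed
    also have "\<dots> = (\<Sum>x\<in>F. card (A x) - 1) + card (F \<inter> E)"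
      using F by (simp add: sum.distrib sum.If_cases)
    finally show ?thesis using EF by (simp add: Int_absorb1)
  qed
  \<comment> \<open>Without exceptional saddles \<open>B\<close> has one vertex more than the
    maxima; with one, the extra vertex disappears and the dropped index takes its place.\<close>
  moreover have "card B + card E \<le> card ?M + 1"
  proof (cases "E = {}")
    case True
    then show ?thesis using M by (simp add: B_def card_image)
  next
    case False
    then obtain y where "E = {y}" using E_unique by blast
    then show ?thesis by (simp add: B_def card_image)
  qed
  ultimately show ?thesis using g by linarith
qed simp

end

section \<open>Solutions in an annular domain\<close>

lemma inside_linear_image_subset:
  fixes h :: "'a::euclidean_space \<Rightarrow> 'b::euclidean_space"
  assumes h: "linear h" "linear h'" "\<And>x. h' (h x) = x" "\<And>y. h (h' y) = y"
  shows "h ` inside S \<subseteq> inside (h ` S)"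
proof clarify
  fix x assume x: "x \<in> inside S"
  have bl: "bounded_linear h" "bounded_linear h'" using h(1,2) by (simp_all add: linear_conv_bounded_linear)
  have "inj h" using h(3) by (metis injI)
  moreover have "x \<notin> S" using x by (simp add: inside_def)
  ultimately have "h x \<notin> h ` S" by (simp add: inj_image_mem_iff)
  moreover have "connected_component_set (- (h ` S)) (h x) \<subseteq> h ` connected_component_set (- S) x"
  proof
    fix y assume "y \<in> connected_component_set (- (h ` S)) (h x)"
    then obtain C where C: "connected C" "C \<subseteq> - (h ` S)" "h x \<in> C" "y \<in> C" unfolding connected_component_def by auto
    have "connected (h' ` C)" by (intro connected_continuous_image C linear_continuous_on bl)
    moreover have "h' ` C \<subseteq> - S" using C(2) h(4) by (metis ComplD ComplI image_eqI image_subsetI subsetD)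
    moreover have "x \<in> h' ` C" using C(3) h(3) by (metis image_eqI)
    moreover have "h' y \<in> h' ` C" using C(4) by blast
    ultimately have "h' y \<in> connected_component_set (- S) x" unfolding connected_component_def by blast
    then show "y \<in> h ` connected_component_set (- S) x" using h(4) by (metis image_eqI)
  qed
  moreover have "bounded (h ` connected_component_set (- S) x)"
    using x by (intro bounded_linear_image bl) (simp add: inside_def)
  ultimately show "h x \<in> inside (h ` S)" unfolding inside_def using bounded_subset by blast
qed

text \<open>By connectedness \<Omega> lies on one side of each curve, and its frontier decides which
  side. Conversely, the ring between the curves is connected by Janiszewski's theorem and misses the
  frontier of \<Omega>, so it cannot leave \<Omega>.\<close>

lemma annular_domain_eq:
  fixes cI cE :: "real \<Rightarrow> complex"
  assumes \<Omega>: "open \<Omega>" "connected \<Omega>" "bounded \<Omega>"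
    and cI: "simple_path cI" "pathfinish cI = pathstart cI" and cE: "simple_path cE" "pathfinish cE = pathstart cE"
    and disj: "path_image cI \<inter> path_image cE = {}" and fr: "frontier \<Omega> = path_image cI \<union> path_image cE"
    and sub: "path_image cI \<subseteq> inside (path_image cE)"
  shows "\<Omega> = inside (path_image cE) \<inter> outside (path_image cI)" "path_image cI \<union> inside (path_image cI) \<subseteq> inside (path_image cE)"
proof -
  let ?I = "path_image cI" and ?E = "path_image cE"
  have JI: "open (inside ?I)" "open (outside ?I)" "connected (outside ?I)" "inside ?I \<inter> outside ?I = {}" "inside ?I \<union> outside ?I = - ?I"
    "frontier (inside ?I) = ?I" "frontier (outside ?I) = ?I" "\<not> bounded (outside ?I)"
    using Jordan_inside_outside[OF cI] by simp_all
  have JE: "open (inside ?E)" "open (outside ?E)" "connected (inside ?E)" "inside ?E \<inter> outside ?E = {}" "inside ?E \<union> outside ?E = - ?E"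
    "frontier (inside ?E) = ?E" "frontier (outside ?E) = ?E" "bounded (inside ?E)"
    using Jordan_inside_outside[OF cE] by simp_all
  have cpt: "compact ?I" "compact ?E" using cI cE by (simp_all add: compact_simple_path_image)
  have inn: "inside ?I \<subseteq> inside ?E" by (rule inside_subset_inside[OF cE sub])
  then show "?I \<union> inside ?I \<subseteq> inside ?E" using sub by blast
  have \<Omega>fr: "\<Omega> \<inter> frontier \<Omega> = {}" using \<Omega>(1) by (simp add: frontier_def interior_open)
  then have \<Omega>I: "\<Omega> \<subseteq> inside ?I \<union> outside ?I" and \<Omega>E: "\<Omega> \<subseteq> inside ?E \<union> outside ?E" using fr JI(5) JE(5) by blast+
  have clI: "?I \<subseteq> closure \<Omega>" "?E \<subseteq> closure \<Omega>" using fr by (auto simp: frontier_def)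
  have neI: "?I \<noteq> {}" and neE: "?E \<noteq> {}" by simp_all
  have "inside ?E \<inter> \<Omega> = {} \<or> outside ?E \<inter> \<Omega> = {}"
    using connectedD[OF \<Omega>(2) JE(1,2)] JE(4) \<Omega>E by blast
  moreover have "inside ?E \<inter> \<Omega> \<noteq> {}"
  proof
    assume "inside ?E \<inter> \<Omega> = {}"
    then have "inside ?E \<inter> closure \<Omega> = {}" using open_Int_closure_eq_empty[OF JE(1)] by blast
    then show False using clI(1) sub neI by blast
  qed
  ultimately have 1: "\<Omega> \<subseteq> inside ?E" using \<Omega>E by blast
  have "inside ?I \<inter> \<Omega> = {} \<or> outside ?I \<inter> \<Omega> = {}"
    using connectedD[OF \<Omega>(2) JI(1,2)] JI(4) \<Omega>I by blast
  moreover have "outside ?I \<inter> \<Omega> \<noteq> {}"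
  proof
    assume "outside ?I \<inter> \<Omega> = {}"
    then have o: "outside ?I \<inter> closure \<Omega> = {}" using open_Int_closure_eq_empty[OF JI(2)] by blast
    have "inside ?E \<inter> ?E = {}" by (rule inside_no_overlap)
    then have "?E \<subseteq> outside ?I" using JI(5) disj inn by blast
    then show False using o clI(2) neE by blast
  qed
  ultimately have 2: "\<Omega> \<subseteq> outside ?I" using \<Omega>I by blast
  have conR: "connected (inside ?E \<inter> outside ?I)"
    unfolding connected_iff_connected_component
  proof (intro ballI)
    fix y z assume y: "y \<in> inside ?E \<inter> outside ?I" and z: "z \<in> inside ?E \<inter> outside ?I"
    have "outside ?I \<subseteq> - ?I" "inside ?E \<subseteq> - ?E" using JI(5) JE(5) by blast+
    then have "connected_component (- ?I) y z" "connected_component (- ?E) y z"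
      unfolding connected_component_def using JI(3) JE(3) y z by blast+
    then have "connected_component (- (?I \<union> ?E)) y z"
      \<comment> \<open>The hypothesis on the intersection of the two compact sets holds because the
        curves are disjoint and the empty set is connected.\<close>
      using Janiszewski[of ?I ?E y z] cpt disj by (simp add: compact_imp_closed)
    then obtain X where X: "connected X" "X \<subseteq> - (?I \<union> ?E)" "y \<in> X" "z \<in> X" unfolding connected_component_def by blast
    have "X \<subseteq> inside ?E"
    proof (rule ccontr)
      assume "\<not> X \<subseteq> inside ?E"
      then have "X \<inter> frontier (inside ?E) \<noteq> {}" using y X by (intro connected_Int_frontier) blast+
      then show False using X(2) JE(6) by blast
    qed
    moreover have "X \<subseteq> outside ?I"
    proof (rule ccontr)
      assume "\<not> X \<subseteq> outside ?I"
      then have "X \<inter> frontier (outside ?I) \<noteq> {}" using y X by (intro connected_Int_frontier) blast+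
      then show False using X(2) JI(7) by blast
    qed
    ultimately show "connected_component (inside ?E \<inter> outside ?I) y z"
      unfolding connected_component_def using X by blast
  qed
  have "\<Omega> \<noteq> {}" using clI(1) neI by auto
  have "inside ?E \<inter> outside ?I \<subseteq> \<Omega>"
  proof (rule ccontr)
    assume "\<not> inside ?E \<inter> outside ?I \<subseteq> \<Omega>"
    then have "(inside ?E \<inter> outside ?I) \<inter> frontier \<Omega> \<noteq> {}"
      using 1 2 \<open>\<Omega> \<noteq> {}\<close> by (intro connected_Int_frontier conR) blast+
    moreover have "outside ?I \<inter> ?I = {}" "inside ?E \<inter> ?E = {}" using JI(5) JE(5) by blast+
    ultimately show False using fr by blast
  qed
  then show "\<Omega> = inside ?E \<inter> outside ?I" using 1 2 by blast
qed

text \<open>An isometric identification with \<open>complex\<close>, where the plane topology of the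
  counting part is formulated.\<close>

definition to_c :: "real^2 \<Rightarrow> complex" where "to_c y = Complex (y $ 1) (y $ 2)"
definition of_c :: "complex \<Rightarrow> real^2" where "of_c z = vector [Re z, Im z]"

lemma to_c_of_c [simp]: "to_c (of_c z) = z" "of_c (to_c y) = y"
  by (auto simp: to_c_def of_c_def complex_eq_iff vec_eq_iff forall_2)

lemma linear_to_c: "linear to_c" and linear_of_c: "linear of_c"
  by (auto intro!: linearI simp: to_c_def of_c_def complex_eq_iff vec_eq_iff forall_2)

lemma norm_to_c [simp]: "norm (to_c y) = norm y"
  by (simp add: to_c_def cmod_def norm_vec_def L2_set_def UNIV_2)

lemma dist_to_c [simp]: "dist (to_c x) (to_c y) = dist x y"
  using linear_diff[OF linear_to_c, of x y] norm_to_c[of "x - y"] by (simp add: dist_norm)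

lemma to_c_bij: "bij to_c" by (rule o_bij[of of_c]) (auto simp: fun_eq_iff)

lemma continuous_on_to_c: "continuous_on S to_c" and continuous_on_of_c: "continuous_on T of_c"
  using linear_to_c linear_of_c by (simp_all add: linear_continuous_on linear_conv_bounded_linear)

lemma to_c_inside: "to_c ` inside S = inside (to_c ` S)"
proof
  show "to_c ` inside S \<subseteq> inside (to_c ` S)"
    by (rule inside_linear_image_subset[OF linear_to_c linear_of_c]) auto
  have "of_c ` inside (to_c ` S) \<subseteq> inside (of_c ` (to_c ` S))"
    by (rule inside_linear_image_subset[OF linear_of_c linear_to_c]) auto
  then have "of_c ` inside (to_c ` S) \<subseteq> inside S" by (simp add: image_image)
  then have "to_c ` (of_c ` inside (to_c ` S)) \<subseteq> to_c ` inside S" by (rule image_mono)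
  then show "inside (to_c ` S) \<subseteq> to_c ` inside S" by (simp add: image_image)
qed

lemma to_c_open: "open S \<Longrightarrow> open (to_c ` S)"
  using open_surjective_linear_image[OF _ linear_to_c] to_c_bij by (auto simp: bij_def)

lemma to_c_closure: "closure (to_c ` S) = to_c ` closure S"
  using closure_injective_linear_image[OF linear_to_c] to_c_bij by (auto simp: bij_def)

lemma to_c_frontier: "frontier (to_c ` S) = to_c ` frontier S"
  unfolding frontier_closures bij_image_Compl_eq[OF to_c_bij, symmetric] to_c_closure
  using to_c_bij by (simp add: image_Int bij_def)

lemma to_c_bounded: "bounded S \<Longrightarrow> bounded (to_c ` S)"
  using bounded_linear_image linear_to_c linear_conv_bounded_linear by blast

text \<open>At the saddle itself an ascending ray leaves the level. At other nearby points the
  gradient is nonzero, because n |z|^(n - 1) exceeds the error K |z|^(n - 1/2).\<close>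

lemma saddle_normal_form_no_flat_nearby:
  assumes "saddle_normal_form u \<Omega> x0 n \<Lambda>"
  obtains e where "e > 0" "\<And>y \<rho>. y \<in> ball x0 e \<Longrightarrow> \<rho> > 0 \<Longrightarrow> \<exists>y'\<in>ball y \<rho>. u y' \<noteq> u y"
proof -
  have n: "2 \<le> n" and \<Lambda>: "linear \<Lambda>" "bij \<Lambda>" using assms unfolding saddle_normal_form_def by auto
  obtain g K \<delta> where K: "K > 0" "\<delta> > 0" and nf:
    "\<And>z. norm z < \<delta> \<Longrightarrow> ((\<lambda>z. u (x0 + \<Lambda> z)) has_derivative (\<lambda>h. Re (g z * h))) (at z)"
    "\<And>z. norm z < \<delta> \<Longrightarrow> norm (g z - of_nat n * z ^ (n - 1)) \<le> K * norm z powr (n - 1/2)"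
    using assms unfolding saddle_normal_form_def by blast
  \<comment> \<open>Gives K sqrt |z| \<le> 1, which is less than n since n is at least 2.\<close>
  define d where "d = min \<delta> (1 / K\<^sup>2)"
  have d: "d > 0" "d \<le> \<delta>" "d \<le> 1 / K\<^sup>2" using K by (auto simp: d_def)
  define T where "T z = x0 + \<Lambda> z" for z
  have cT: "continuous_on UNIV T" unfolding T_def
    using \<Lambda>(1) by (intro continuous_on_add continuous_on_const linear_continuous_on) (simp add: linear_conv_bounded_linear)
  have opT: "open (T ` ball 0 d)"
    unfolding T_def using open_translation[OF open_surjective_linear_image[OF open_ball \<Lambda>(1), of 0 d], of x0] \<Lambda>(2)
    by (simp add: image_image bij_def)
  have T0: "T 0 = x0" using \<Lambda>(1) by (simp add: T_def linear_0)
  have "x0 \<in> T ` ball 0 d" using d(1) T0 by (intro image_eqI[of _ _ 0]) auto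
  then obtain e where e: "e > 0" "ball x0 e \<subseteq> T ` ball 0 d" using opT open_contains_ball by blast
  show ?thesis
  proof (rule that[OF e(1)], rule ccontr)
    fix y \<rho> assume y: "y \<in> ball x0 e" and \<rho>: "\<rho> > 0" and "\<not> (\<exists>y'\<in>ball y \<rho>. u y' \<noteq> u y)"
    then have flat: "\<And>y'. y' \<in> ball y \<rho> \<Longrightarrow> u y' = u y" by blast
    obtain z where z: "norm z < d" "y = T z" using e(2) y by auto
    show False
    proof (cases "z = 0")
      case True
      obtain \<delta>' where \<delta>': "\<delta>' > 0"
        "\<And>r \<theta>. 0 < r \<Longrightarrow> r < \<delta>' \<Longrightarrow> cos (real n * \<theta>) = 1 \<Longrightarrow> u x0 < u (x0 + \<Lambda> (of_real r * cis \<theta>))"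
        using saddle_normal_form_rays[OF assms] by metis
      have "open (T -` ball y \<rho>)" using cT by (intro open_vimage) auto
      moreover have "0 \<in> T -` ball y \<rho>" using True z \<rho> by simp
      ultimately obtain r where r: "r > 0" "ball 0 r \<subseteq> T -` ball y \<rho>" using open_contains_ball by blast
      define s where "s = min r \<delta>' / 2"
      have s: "0 < s" "s < r" "s < \<delta>'" using r \<delta>' by (auto simp: s_def)
      have "of_real s \<in> ball (0::complex) r" using s by simp
      then have "T (of_real s) \<in> ball y \<rho>" using r(2) by blast
      then have "u (T (of_real s)) = u y" by (rule flat)
      moreover have "u x0 < u (T (of_real s))" using \<delta>'(2)[OF s(1,3), of 0] by (simp add: T_def)
      ultimately show False using True z T0 by simp
    next
      case False
      have z\<delta>: "norm z < \<delta>" using z d by simp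
      have "((\<lambda>z. u (T z)) has_derivative (\<lambda>h. 0)) (at z)"
      proof (rule has_derivative_transform_within_open[of "\<lambda>_. u y" _ z UNIV "T -` ball y \<rho>"])
        show "open (T -` ball y \<rho>)" using cT by (intro open_vimage) auto
        show "z \<in> T -` ball y \<rho>" using z(2) \<rho> by simp
        show "u y = u (T w)" if "w \<in> T -` ball y \<rho>" for w using flat[of "T w"] that by simp
      qed auto
      moreover have "((\<lambda>z. u (T z)) has_derivative (\<lambda>h. Re (g z * h))) (at z)" using nf(1)[OF z\<delta>] by (simp add: T_def)
      ultimately have "(\<lambda>h. Re (g z * h)) = (\<lambda>h. 0)" by (metis has_derivative_unique)
      then have "Re (g z * cnj (g z)) = 0" by meson
      moreover have "Re (g z * cnj (g z)) = (norm (g z))\<^sup>2" unfolding complex_norm_square[symmetric] by (rule Re_complex_of_real)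
      ultimately have "g z = 0" by simp
      then have "of_nat n * norm z ^ (n - 1) \<le> K * norm z powr (n - 1/2)"
        using nf(2)[OF z\<delta>] by (simp add: norm_mult norm_power)
      also have "norm z powr (n - 1/2) = norm z ^ (n - 1) * sqrt (norm z)"
      proof -
        have "norm z powr (real (n - 1) + 1/2) = norm z ^ (n - 1) * sqrt (norm z)"
          using False by (simp only: powr_add) (simp add: powr_realpow powr_half_sqrt)
        moreover have "real (n - 1) + 1/2 = real n - 1/2" using n by (simp add: of_nat_diff)
        ultimately show ?thesis by simp
      qed
      finally have "norm z ^ (n - 1) * n \<le> norm z ^ (n - 1) * (K * sqrt (norm z))" by (simp add: mult_ac)
      moreover have "0 < norm z ^ (n - 1)" using False by simp
      ultimately have "real n \<le> K * sqrt (norm z)" using mult_le_cancel_left_pos by blast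
      moreover have "K * sqrt (norm z) \<le> 1"
      proof -
        have "sqrt (norm z) \<le> sqrt (1 / K\<^sup>2)" using z d by (intro real_sqrt_le_mono) auto
        also have "\<dots> = 1 / K" using K real_sqrt_abs[of K] by (simp only: real_sqrt_divide real_sqrt_one)
        finally show ?thesis using K by (simp add: field_simps)
      qed
      ultimately show False using n by simp
    qed
  qed
qed

section \<open>Unique continuation and the absence of interior extrema\<close>

lemma linear_euclidean_2:
  fixes f :: "real^2 \<Rightarrow> real"
  assumes "linear f"
  shows "f h = (\<Sum>i\<in>UNIV. f (axis i 1) * h $ i)"
proof -
  have "f h = f (\<Sum>i\<in>UNIV. h $ i *\<^sub>R axis i 1)"
    using basis_expansion[of h] by (simp add: scalar_mult_eq_scaleR)
  also have "\<dots> = (\<Sum>i\<in>UNIV. f (axis i 1) * h $ i)"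
    by (simp add: linear_sum[OF assms] linear_cmul[OF assms] mult.commute)
  finally show ?thesis .
qed

lemma has_derivative_partial_deriv:
  fixes f :: "real^2 \<Rightarrow> real"
  assumes "f differentiable (at x)"
  shows "(f has_derivative (\<lambda>h. \<Sum>i\<in>UNIV. partial_deriv i f x * h $ i)) (at x)"
proof -
  have d: "(f has_derivative frechet_derivative f (at x)) (at x)" using assms frechet_derivative_works by blast
  then have lin: "linear (frechet_derivative f (at x))" using has_derivative_linear by blast
  have "frechet_derivative f (at x) = (\<lambda>h. \<Sum>i\<in>UNIV. partial_deriv i f x * h $ i)"
    unfolding partial_deriv_def by (intro ext linear_euclidean_2[OF lin])
  with d show ?thesis by (simp only:)
qed

lemma Ck_on_2_partials:
  assumes "Ck_on 2 (u :: real^2 \<Rightarrow> real) \<Omega>"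
  shows "\<And>x. x \<in> \<Omega> \<Longrightarrow> u differentiable (at x)" "\<And>x i. x \<in> \<Omega> \<Longrightarrow> partial_deriv i u differentiable (at x)"
    "\<And>i j. continuous_on \<Omega> (partial_deriv j (partial_deriv i u))"
proof -
  have pd: "(\<lambda>x. frechet_derivative f (at x) (axis i 1)) = partial_deriv i f" for f :: "real^2 \<Rightarrow> real" and i
    by (auto simp: partial_deriv_def)
  have ax: "axis i 1 \<in> (Basis :: (real^2) set)" for i by (simp add: axis_in_Basis_iff)
  have *: "\<forall>x\<in>\<Omega>. u differentiable (at x)"
    "\<forall>b\<in>Basis. (\<forall>x\<in>\<Omega>. (\<lambda>x. frechet_derivative u (at x) b) differentiable (at x)) \<and>
      (\<forall>b'\<in>Basis. continuous_on \<Omega> (\<lambda>x. frechet_derivative (\<lambda>x. frechet_derivative u (at x) b) (at x) b'))"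
    using assms by (simp_all add: numeral_2_eq_2)
  show "\<And>x. x \<in> \<Omega> \<Longrightarrow> u differentiable (at x)" using *(1) by blast
  show "partial_deriv i u differentiable (at x)" if "x \<in> \<Omega>" for x i
    using bspec[OF *(2) ax[of i]] that unfolding pd by blast
  show "continuous_on \<Omega> (partial_deriv j (partial_deriv i u))" for i j
    using bspec[OF conjunct2[OF bspec[OF *(2) ax[of i]]] ax[of j]] unfolding pd .
qed

text \<open>Ellipticity controls the coefficients only at values taken by the gradient. Positivity
  at 0 is therefore available only when there is a critical point, and the assumption
  \<open>pos\<close> is guarded accordingly.\<close>

locale elliptic_solution =
  fixes u :: "real^2 \<Rightarrow> real" and \<Omega> :: "(real^2) set" and a :: "2 \<Rightarrow> 2 \<Rightarrow> real^2 \<Rightarrow> real"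
  assumes \<Omega>: "open \<Omega>" "connected \<Omega>"
    and C2: "Ck_on 2 u \<Omega>" and nonconst: "\<not> u constant_on \<Omega>"
    and a: "a i j differentiable (at 0)"
    and pos: "x \<in> critical_points u \<Omega> \<Longrightarrow> \<xi> \<noteq> 0 \<Longrightarrow> (\<Sum>i\<in>UNIV. \<Sum>j\<in>UNIV. a i j 0 * \<xi> $ i * \<xi> $ j) > 0"
    and pde: "x \<in> \<Omega> \<Longrightarrow> (\<Sum>i\<in>UNIV. \<Sum>j\<in>UNIV. a i j (grad u x) * partial_deriv j (partial_deriv i u) x) = 0"
begin

lemma dichotomy:
  assumes x: "x \<in> \<Omega>" "\<And>i. partial_deriv i u x = 0"
  shows "(\<exists>\<rho>>0. \<forall>y\<in>ball x \<rho>. u y = u x) \<or> (\<exists>n \<Lambda>. saddle_normal_form u \<Omega> x n \<Lambda>)"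
proof (rule critical_point_dichotomy[where p="\<lambda>i. partial_deriv i u" and q="\<lambda>i j. partial_deriv j (partial_deriv i u)" and a=a])
  have "x \<in> critical_points u \<Omega>" using x by (simp add: critical_points_def grad_def vec_eq_iff)
  then show "(\<Sum>i\<in>UNIV. \<Sum>j\<in>UNIV. a i j 0 * \<xi> $ i * \<xi> $ j) > 0" if "\<xi> \<noteq> 0" for \<xi> using pos that by blast
qed (use x \<Omega> Ck_on_2_partials[OF C2] a pde[unfolded grad_def] in \<open>auto intro: has_derivative_partial_deriv\<close>)

text \<open>The set of points with a flat neighbourhood is open, and it is relatively closed: the
  gradient vanishes at a limit point, and of the two cases of \<open>dichotomy\<close> the saddle
  admits no flat balls nearby. By connectedness one flat ball would make \<open>u\<close>
  constant.\<close>

lemma not_flat: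
  assumes x: "x \<in> \<Omega>" and \<rho>: "\<rho> > 0"
  shows "\<exists>y\<in>ball x \<rho>. u y \<noteq> u x"
proof (rule ccontr)
  assume neg: "\<not> ?thesis"
  define Z where "Z = {x \<in> \<Omega>. \<exists>\<rho>>0. \<forall>y\<in>ball x \<rho>. u y = u x}"
  have xZ: "x \<in> Z" using x \<rho> neg unfolding Z_def by blast
  have ZO: "Z \<subseteq> \<Omega>" unfolding Z_def by blast
  have opZ: "open Z"
    unfolding open_contains_ball
  proof
    fix y assume "y \<in> Z"
    then obtain r where r: "r > 0" "\<forall>y'\<in>ball y r. u y' = u y" and y: "y \<in> \<Omega>" unfolding Z_def by blast
    obtain s where s: "s > 0" "ball y s \<subseteq> \<Omega>" using \<Omega>(1) y open_contains_ball by blast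
    have "ball y (min r s) \<subseteq> Z"
    proof
      fix z assume z: "z \<in> ball y (min r s)"
      then have "z \<in> ball y r" "z \<in> \<Omega>" using s by auto
      then obtain t where t: "t > 0" "ball z t \<subseteq> ball y r" using open_contains_ball[of "ball y r"] by blast
      then have "\<forall>y'\<in>ball z t. u y' = u z" using r(2) \<open>z \<in> ball y r\<close> by (metis subsetD)
      then show "z \<in> Z" using t \<open>z \<in> \<Omega>\<close> unfolding Z_def by blast
    qed
    then show "\<exists>e>0. ball y e \<subseteq> Z" using r s by (intro exI[of _ "min r s"]) auto
  qed
  have grad0: "partial_deriv i u y = 0" if y: "y \<in> Z" for i y
  proof -
    obtain r where r: "r > 0" "\<forall>y'\<in>ball y r. u y' = u y" using y unfolding Z_def by blast
    have "(u has_derivative (\<lambda>h. 0)) (at y)"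
    proof (rule has_derivative_transform_within_open[of "\<lambda>_. u y" _ y UNIV "ball y r"])
      show "u y = u w" if "w \<in> ball y r" for w using bspec[OF r(2) that] by simp
    qed (use r(1) in auto)
    then have "frechet_derivative u (at y) = (\<lambda>h. 0)" by (metis frechet_derivative_at)
    then show ?thesis by (simp add: partial_deriv_def)
  qed
  have clZ: "y \<in> Z" if y: "y \<in> \<Omega>" "y \<in> closure Z" for y
  proof -
    have "partial_deriv i u y = 0" for i
    proof -
      have "continuous_on \<Omega> (partial_deriv i u)"
        using Ck_on_2_partials(2)[OF C2] \<Omega>(1) by (meson continuous_at_imp_continuous_on differentiable_imp_continuous_within)
      then have "continuous_on (\<Omega> \<inter> closure Z) (partial_deriv i u)" by (rule continuous_on_subset) blast
      then have cl: "closedin (top_of_set (\<Omega> \<inter> closure Z)) ((\<Omega> \<inter> closure Z) \<inter> partial_deriv i u -` {0})"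
        by (intro continuous_closedin_preimage) auto
      then obtain C where C: "closed C" "(\<Omega> \<inter> closure Z) \<inter> partial_deriv i u -` {0} = (\<Omega> \<inter> closure Z) \<inter> C"
        by (auto simp: closedin_closed)
      have "Z \<subseteq> C" using C(2) grad0 closure_subset[of Z] ZO by blast
      then have "closure Z \<subseteq> C" using C(1) by (rule closure_minimal)
      then show ?thesis using C(2) y by blast
    qed
    from dichotomy[OF y(1) this] show ?thesis
    proof
      assume "\<exists>\<rho>>0. \<forall>y'\<in>ball y \<rho>. u y' = u y"
      then show ?thesis using y(1) unfolding Z_def by blast
    next
      assume "\<exists>n \<Lambda>. saddle_normal_form u \<Omega> y n \<Lambda>"
      then obtain n \<Lambda> where nf: "saddle_normal_form u \<Omega> y n \<Lambda>" by blast
      obtain e where e: "e > 0" "\<And>z \<rho>. z \<in> ball y e \<Longrightarrow> \<rho> > 0 \<Longrightarrow> \<exists>y'\<in>ball z \<rho>. u y' \<noteq> u z"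
        using saddle_normal_form_no_flat_nearby[OF nf] by blast
      have "ball y e \<inter> Z \<noteq> {}" using open_Int_closure_eq_empty[OF open_ball, of y e Z] y(2) e(1) by (metis IntI centre_in_ball empty_iff)
      then obtain z where z: "z \<in> ball y e" "z \<in> Z" by blast
      then obtain r where "r > 0" "\<forall>y'\<in>ball z r. u y' = u z" unfolding Z_def by blast
      then show ?thesis using e(2)[OF z(1)] by blast
    qed
  qed
  have "closedin (top_of_set \<Omega>) Z"
    unfolding closedin_closed by (intro exI[of _ "closure Z"]) (use clZ closure_subset[of Z] ZO in blast)
  moreover have "openin (top_of_set \<Omega>) Z" using opZ ZO by (simp add: open_openin_trans \<Omega>(1))
  ultimately have "Z = \<Omega>" using \<Omega>(2) xZ unfolding connected_clopen by blast
  have d0: "(u has_derivative (\<lambda>h. 0)) (at y)" if "y \<in> \<Omega>" for y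
    using has_derivative_partial_deriv[OF Ck_on_2_partials(1)[OF C2 that]] grad0[of y] that \<open>Z = \<Omega>\<close> by simp
  have "u y = u x" if "y \<in> \<Omega>" for y
    by (rule has_derivative_zero_unique_connected[OF \<Omega> d0 that x])
  then have "u constant_on \<Omega>" unfolding constant_on_def by blast
  then show False using nonconst by simp
qed

lemma critical_normal_form:
  assumes "x \<in> critical_points u \<Omega>"
  shows "\<exists>n \<Lambda>. saddle_normal_form u \<Omega> x n \<Lambda>"
proof -
  have x: "x \<in> \<Omega>" "\<And>i. partial_deriv i u x = 0" using assms by (auto simp: critical_points_def grad_def vec_eq_iff)
  from dichotomy[OF x] not_flat[OF x(1)] show ?thesis by blast
qed

text \<open>At a critical point the ascending and descending rays of the normal form give both
  inequalities; at any other point the derivative is nonzero.\<close>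

lemma not_local_extremum:
  assumes x: "x \<in> \<Omega>" and e: "e > 0"
  shows "\<exists>y\<in>ball x e \<inter> \<Omega>. u x < u y" "\<exists>y\<in>ball x e \<inter> \<Omega>. u y < u x"
proof -
  have "(\<exists>y\<in>ball x e \<inter> \<Omega>. u x < u y) \<and> (\<exists>y\<in>ball x e \<inter> \<Omega>. u y < u x)"
  proof (cases "x \<in> critical_points u \<Omega>")
    case True
    then obtain n \<Lambda> where nf: "saddle_normal_form u \<Omega> x n \<Lambda>" using critical_normal_form by blast
    have n: "2 \<le> n" and \<Lambda>: "linear \<Lambda>" using nf unfolding saddle_normal_form_def by auto
    obtain \<delta> where \<delta>: "\<delta> > 0" "\<And>z. norm z < \<delta> \<Longrightarrow> x + \<Lambda> z \<in> \<Omega>"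
      "\<And>r \<theta>. 0 < r \<Longrightarrow> r < \<delta> \<Longrightarrow> cos (real n * \<theta>) = 1 \<Longrightarrow> u x < u (x + \<Lambda> (of_real r * cis \<theta>))"
      "\<And>r \<theta>. 0 < r \<Longrightarrow> r < \<delta> \<Longrightarrow> cos (real n * \<theta>) = -1 \<Longrightarrow> u (x + \<Lambda> (of_real r * cis \<theta>)) < u x"
      by (rule saddle_normal_form_rays[OF nf]) blast
    obtain B where B: "B > 0" "\<And>z. norm (\<Lambda> z) \<le> B * norm z"
      using linear_bounded_pos[OF \<Lambda>] by blast
    \<comment> \<open>Small enough for the normal form to apply, and for the image of the circle of
      radius r under \<open>\<Lambda>\<close>, which expands by at most B, to stay in the ball of
      radius e.\<close>
    define r where "r = min (\<delta> / 2) (e / (2 * B))"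
    have r: "0 < r" "r < \<delta>" "B * r < e" 
    proof -
      have "B * r \<le> B * (e / (2 * B))" using B by (intro mult_left_mono) (auto simp: r_def)
      also have "\<dots> < e" using B e by simp
      finally show "B * r < e" .
    qed (use \<delta> e B in \<open>auto simp: r_def\<close>)
    have mem: "x + \<Lambda> (of_real r * cis \<theta>) \<in> ball x e \<inter> \<Omega>" for \<theta>
    proof -
      have "norm (of_real r * cis \<theta>) = r" using r by (simp add: norm_mult)
      then show ?thesis using \<delta>(2)[of "of_real r * cis \<theta>"] B(2)[of "of_real r * cis \<theta>"] r by (simp add: dist_norm)
    qed
    have "cos (real n * 0) = 1" "cos (real n * (pi / n)) = -1" using n by auto
    then show ?thesis using \<delta>(3,4)[OF r(1,2)] mem by blast
  next
    case False
    have d: "(u has_derivative (\<lambda>h. \<Sum>i\<in>UNIV. partial_deriv i u x * h $ i)) (at x)"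
      by (rule has_derivative_partial_deriv[OF Ck_on_2_partials(1)[OF C2 x]])
    obtain i where i: "partial_deriv i u x \<noteq> 0" using False x by (auto simp: critical_points_def grad_def vec_eq_iff)
    have "(\<Sum>k\<in>UNIV. partial_deriv k u x * axis i 1 $ k) = partial_deriv i u x"
      by (simp add: axis_def if_distrib cong: if_cong)
    then have ne: "(\<lambda>h. \<Sum>k\<in>UNIV. partial_deriv k u x * h $ k) \<noteq> (\<lambda>h. 0)" using i by metis
    have S: "x \<in> ball x e \<inter> \<Omega>" "open (ball x e \<inter> \<Omega>)" using x e \<Omega>(1) by auto
    have "\<not> ((\<forall>y\<in>ball x e \<inter> \<Omega>. u y \<le> u x) \<or> (\<forall>y\<in>ball x e \<inter> \<Omega>. u x \<le> u y))"
      using differential_zero_maxmin[OF S d] ne by blast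
    then show ?thesis by (meson not_le)
  qed
  then show "\<exists>y\<in>ball x e \<inter> \<Omega>. u x < u y" "\<exists>y\<in>ball x e \<inter> \<Omega>. u y < u x" by blast+
qed

end

lemma finite_of_sum_le:
  assumes "\<And>F. finite F \<Longrightarrow> F \<subseteq> C \<Longrightarrow> (\<Sum>x\<in>F. k x) \<le> (N :: nat)" and "\<And>x. x \<in> C \<Longrightarrow> 1 \<le> k x"
  shows "finite C"
proof (rule finite_if_finite_subsets_card_bdd[of _ N, THEN conjunct1])
  show "card F \<le> N" if "F \<subseteq> C" "finite F" for F
  proof -
    have "card F = (\<Sum>x\<in>F. 1)" by simp
    also have "\<dots> \<le> (\<Sum>x\<in>F. k x)" using that assms(2) by (intro sum_mono) auto
    also have "\<dots> \<le> N" using assms(1) that by blast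
    finally show ?thesis .
  qed
qed

text \<open>The problem is moved to \<open>complex\<close> and the hole is filled by the constant H,
  so that \<open>saddle_family\<close> applies to the Jordan domain of the outer curve.
  \<open>K\<close> is the closed inside of the inner curve.\<close>

lemma (in elliptic_solution) sum_saddle_orders_le:
  fixes \<gamma>\<^sub>I \<gamma>\<^sub>E :: "(real^2) set" and H :: real
  assumes annular: "smooth_annular_domain \<Omega> \<gamma>\<^sub>I \<gamma>\<^sub>E"
    and cont: "continuous_on (closure \<Omega>) u" and H: "\<And>x. x \<in> \<gamma>\<^sub>I \<Longrightarrow> u x = H"
    and M: "finite (local_max_points u \<gamma>\<^sub>E)"
    and F: "finite F" "F \<subseteq> critical_points u \<Omega>" and nf: "\<And>x. x \<in> F \<Longrightarrow> saddle_normal_form u \<Omega> x (n x) (L x)"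
  shows "(\<Sum>x\<in>F. n x - 1) \<le> card (local_max_points u \<gamma>\<^sub>E)"
proof -
  obtain gI where gI: "simple_path gI" "pathfinish gI = pathstart gI" "path_image gI = \<gamma>\<^sub>I"
    using annular unfolding smooth_annular_domain_def smooth_simple_closed_curve_def by blast
  obtain gE where gE: "simple_path gE" "pathfinish gE = pathstart gE" "path_image gE = \<gamma>\<^sub>E"
    using annular unfolding smooth_annular_domain_def smooth_simple_closed_curve_def by blast
  have dom: "bounded \<Omega>" "\<gamma>\<^sub>I \<inter> \<gamma>\<^sub>E = {}" "frontier \<Omega> = \<gamma>\<^sub>I \<union> \<gamma>\<^sub>E" "\<gamma>\<^sub>I \<subseteq> inside \<gamma>\<^sub>E"
    using annular unfolding smooth_annular_domain_def by blast+
  define cI cE where "cI = to_c \<circ> gI" and "cE = to_c \<circ> gE"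
  define \<Omega>' where "\<Omega>' = to_c ` \<Omega>"
  have inj: "inj to_c" using to_c_bij by (simp add: bij_def)
  have img: "path_image cI = to_c ` \<gamma>\<^sub>I" "path_image cE = to_c ` \<gamma>\<^sub>E"
    using gI gE by (simp_all add: cI_def cE_def path_image_compose)
  have cI: "simple_path cI" "pathfinish cI = pathstart cI" and cE: "simple_path cE" "pathfinish cE = pathstart cE"
    using gI gE inj_on_subset[OF inj] unfolding cI_def cE_def
    by (auto intro!: simple_path_continuous_image continuous_on_to_c simp: pathfinish_compose pathstart_compose)
  have \<Omega>': "open \<Omega>'" "connected \<Omega>'" "bounded \<Omega>'"
    using \<Omega> dom(1) to_c_open to_c_bounded connected_continuous_image[OF continuous_on_to_c] by (auto simp: \<Omega>'_def)
  have disj: "path_image cI \<inter> path_image cE = {}" 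
    unfolding img image_Int[OF inj, symmetric] dom(2) by simp
  have fr: "frontier \<Omega>' = path_image cI \<union> path_image cE"
    unfolding \<Omega>'_def to_c_frontier dom(3) img by blast
  have sub: "path_image cI \<subseteq> inside (path_image cE)"
    unfolding img to_c_inside[symmetric] using dom(4) by (rule image_mono)
  note ann = annular_domain_eq[OF \<Omega>' cI cE disj fr sub]
  define D where "D = inside (path_image cE)"
  define K where "K = path_image cI \<union> inside (path_image cI)"
  have JI: "inside (path_image cI) \<union> outside (path_image cI) = - path_image cI" "connected (inside (path_image cI))"
    "inside (path_image cI) \<inter> outside (path_image cI) = {}"
    "frontier (inside (path_image cI)) = path_image cI" "bounded (inside (path_image cI))"
    using Jordan_inside_outside[OF cI] by simp_all
  have Kcl: "K = closure (inside (path_image cI))"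
    unfolding K_def using closure_Un_frontier[of "inside (path_image cI)"] JI(4) by blast
  have KD: "K \<subseteq> D" using ann(2) by (simp add: K_def D_def)
  have D\<Omega>: "D - K = \<Omega>'" unfolding ann(1) K_def D_def using JI(1,3) by blast
  have K\<Omega>: "K \<inter> \<Omega>' = {}" using D\<Omega> by blast
  have cl\<Omega>: "closure \<Omega>' = \<Omega>' \<union> path_image cI \<union> path_image cE"
    using closure_Un_frontier[of \<Omega>'] fr by blast
  have clD: "closure D = closure \<Omega>' \<union> K"
  proof -
    have "frontier D = path_image cE" unfolding D_def using Jordan_inside_outside[OF cE] by simp
    then have "closure D = D \<union> path_image cE" using closure_Un_frontier[of D] by simp
    moreover have "path_image cI \<subseteq> K" by (simp add: K_def)
    ultimately show ?thesis unfolding cl\<Omega> using D\<Omega> KD by blast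
  qed
  have Kcl\<Omega>: "K \<inter> closure \<Omega>' \<subseteq> path_image cI"
  proof -
    have "D \<inter> path_image cE = {}" unfolding D_def by (rule inside_no_overlap)
    then show ?thesis unfolding cl\<Omega> using K\<Omega> KD by blast
  qed
  \<comment> \<open>Continuity of the extension holds because the hole meets the closure of the
    annulus only in the inner curve, where \<open>u\<close> already equals H.\<close>
  define w where "w z = (if z \<in> closure \<Omega>' then u (of_c z) else H)" for z
  have w_u: "w (to_c x) = u x" if "x \<in> closure \<Omega>" for x
    using that unfolding w_def \<Omega>'_def to_c_closure by auto
  have wI: "u (of_c z) = H" if "z \<in> path_image cI" for z using that H unfolding img by auto
  have cont_w: "continuous_on (closure D) w"
    unfolding clD w_def
  proof (rule continuous_on_cases)
    show "continuous_on (closure \<Omega>') (\<lambda>z. u (of_c z))"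
      by (rule continuous_on_compose2[OF cont continuous_on_of_c]) (auto simp: \<Omega>'_def to_c_closure)
    show "\<forall>x. x \<in> closure \<Omega>' \<and> x \<notin> closure \<Omega>' \<or> x \<in> K \<and> x \<in> closure \<Omega>' \<longrightarrow> u (of_c x) = H"
      using wI Kcl\<Omega> by blast
  qed (simp_all add: Kcl)
  have wK: "w z = H" if "z \<in> K" for z using that wI Kcl\<Omega> unfolding w_def by auto
  \<comment> \<open>Off the hole the domain is the annulus, so interior extrema are excluded by
    \<open>not_local_extremum\<close>.\<close>
  have extr: "(\<exists>y\<in>ball z e. w z < w y) \<and> (\<exists>y\<in>ball z e. w y < w z)" if z: "z \<in> D - K" and e: "e > 0" for z e
  proof -
    obtain x where x: "x \<in> \<Omega>" "z = to_c x" using z D\<Omega> by (auto simp: \<Omega>'_def)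
    have w_\<Omega>: "w (to_c y) = u y" if "y \<in> \<Omega>" for y using w_u that closure_subset[of \<Omega>] by blast
    obtain y1 where y1: "y1 \<in> ball x e \<inter> \<Omega>" "u x < u y1" using not_local_extremum(1)[OF x(1) e] by blast
    obtain y2 where y2: "y2 \<in> ball x e \<inter> \<Omega>" "u y2 < u x" using not_local_extremum(2)[OF x(1) e] by blast
    have "to_c y1 \<in> ball z e" "to_c y2 \<in> ball z e" using y1 y2 x(2) by simp_all
    moreover have "w z < w (to_c y1)" "w (to_c y2) < w z" using y1 y2 x w_\<Omega> by simp_all
    ultimately show ?thesis by blast
  qed
  have sad: "\<exists>\<delta>. saddle w D (to_c x) (n x) (to_c \<circ> L x) \<delta>" if x: "x \<in> F" for x
  proof -
    have nl: "2 \<le> n x" "linear (L x)" "bij (L x)" using nf[OF x] unfolding saddle_normal_form_def by auto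
    obtain \<delta> where \<delta>: "\<delta> > 0" "\<And>z. norm z < \<delta> \<Longrightarrow> x + L x z \<in> \<Omega>"
      "\<And>r \<theta>. 0 < r \<Longrightarrow> r < \<delta> \<Longrightarrow> cos (real (n x) * \<theta>) = 1 \<Longrightarrow> u x < u (x + L x (of_real r * cis \<theta>))"
      "\<And>r \<theta>. 0 < r \<Longrightarrow> r < \<delta> \<Longrightarrow> cos (real (n x) * \<theta>) = -1 \<Longrightarrow> u (x + L x (of_real r * cis \<theta>)) < u x"
      by (rule saddle_normal_form_rays[OF nf[OF x]]) blast
    have x\<Omega>: "x \<in> \<Omega>" using x F(2) by (auto simp: critical_points_def)
    have add: "to_c x + (to_c \<circ> L x) z = to_c (x + L x z)" for z using linear_add[OF linear_to_c] by simp
    have w_\<Omega>: "w (to_c y) = u y" if "y \<in> \<Omega>" for y using w_u that closure_subset[of \<Omega>] by blast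
    have wr: "w (ray (to_c x) (to_c \<circ> L x) \<theta> r) = u (x + L x (of_real r * cis \<theta>))" if "0 < r" "r < \<delta>" for r \<theta>
      unfolding ray_def add using \<delta>(2)[of "of_real r * cis \<theta>"] that by (intro w_\<Omega>) (simp add: norm_mult)
    have "to_c (x + L x z) \<in> D" if "norm z < \<delta>" for z
      using \<delta>(2)[OF that] D\<Omega> by (auto simp: \<Omega>'_def)
    then have "saddle w D (to_c x) (n x) (to_c \<circ> L x) \<delta>"
      unfolding saddle_def add
      using nl \<delta>(1,3,4) wr w_\<Omega>[OF x\<Omega>] linear_compose[OF nl(2) linear_to_c] bij_comp[OF nl(3) to_c_bij] by simp
    then show ?thesis by blast
  qed
  then obtain \<delta> where \<delta>: "\<And>x. x \<in> F \<Longrightarrow> saddle w D (to_c x) (n x) (to_c \<circ> L x) (\<delta> x)" by metis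
  interpret saddle_family cE w K H "to_c ` F" "\<lambda>z. n (of_c z)" "\<lambda>z. to_c \<circ> L (of_c z)" "\<lambda>z. \<delta> (of_c z)"
  proof unfold_locales
    show "simple_path cE" "pathfinish cE = pathstart cE" by (rule cE)+
    show "continuous_on (closure (inside (path_image cE))) w" using cont_w by (simp add: D_def)
    show "compact K" unfolding Kcl using JI(5) by simp
    show "connected K" unfolding Kcl using JI(2) by (rule connected_imp_connected_closure)
    show "K \<noteq> {}" by (simp add: K_def)
    show "K \<subseteq> inside (path_image cE)" using KD by (simp add: D_def)
    show "w x = H" if "x \<in> K" for x by (rule wK[OF that])
    show "\<exists>y\<in>ball x e. w x < w y" "\<exists>y\<in>ball x e. w y < w x" if "x \<in> inside (path_image cE) - K" "e > 0" for x e
      using extr[of x e] that by (auto simp: D_def)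
    show "finite (to_c ` F)" using F(1) by simp
    show "saddle w (inside (path_image cE)) x (n (of_c x)) (to_c \<circ> L (of_c x)) (\<delta> (of_c x))" if "x \<in> to_c ` F" for x
      using that \<delta> by (auto simp: D_def)
  qed
  have sub_max: "local_max_points w (path_image cE) \<subseteq> to_c ` local_max_points u \<gamma>\<^sub>E"
  proof
    fix b assume b: "b \<in> local_max_points w (path_image cE)"
    then obtain x where x: "x \<in> \<gamma>\<^sub>E" "b = to_c x" unfolding local_max_points_def img by blast
    have \<gamma>cl: "\<gamma>\<^sub>E \<subseteq> closure \<Omega>" using dom(3) by (auto simp: frontier_def)
    obtain d where d: "d > 0" "\<And>y. y \<in> to_c ` \<gamma>\<^sub>E \<Longrightarrow> y \<noteq> b \<Longrightarrow> dist y b < d \<Longrightarrow> w y \<le> w b"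
      using b unfolding local_max_points_def img eventually_at by blast
    have "u y \<le> u x" if y: "y \<in> \<gamma>\<^sub>E" "y \<noteq> x" "dist y x < d" for y
    proof -
      have "to_c y \<noteq> b" using y(2) x(2) inj by (simp add: inj_eq)
      then have "w (to_c y) \<le> w b" using d(2)[of "to_c y"] y x(2) by simp
      moreover have "y \<in> closure \<Omega>" "x \<in> closure \<Omega>" using y(1) x(1) \<gamma>cl by blast+
      ultimately show ?thesis using w_u x(2) by simp
    qed
    then have "x \<in> local_max_points u \<gamma>\<^sub>E" unfolding local_max_points_def eventually_at using x(1) d(1) by blast
    then show "b \<in> to_c ` local_max_points u \<gamma>\<^sub>E" using x(2) by blast
  qed
  have fin: "finite (local_max_points w (path_image cE))" using sub_max M finite_subset by blast
  have "(\<Sum>x\<in>F. n x - 1) = (\<Sum>z\<in>to_c ` F. n (of_c z) - 1)"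
    by (subst sum.reindex) (auto intro: inj_on_subset[OF inj])
  also have "\<dots> \<le> card (local_max_points w (path_image cE))" by (rule sum_saddles_le[OF fin])
  also have "\<dots> \<le> card (to_c ` local_max_points u \<gamma>\<^sub>E)" using sub_max M by (intro card_mono) auto
  also have "\<dots> \<le> card (local_max_points u \<gamma>\<^sub>E)" using M by (rule card_image_le)
  finally show ?thesis .
qed

theorem theorem1p5:
  fixes \<Omega> \<gamma>\<^sub>I \<gamma>\<^sub>E :: "(real^2) set"
    and a :: "2 \<Rightarrow> 2 \<Rightarrow> real^2 \<Rightarrow> real"
    and \<psi> u :: "real^2 \<Rightarrow> real"
    and H lam Lam :: real
    and N :: nat
  assumes domain: "smooth_annular_domain \<Omega> \<gamma>\<^sub>I \<gamma>\<^sub>E"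
    and coeff_smooth: "\<And>i j. smooth_on (a i j) UNIV"
    and psi_C1: "C1_closure \<psi> \<Omega>"
    and min_less: "(INF x\<in>\<gamma>\<^sub>E. \<psi> x) < H"
    and less_max: "H < (SUP x\<in>\<gamma>\<^sub>E. \<psi> x)"
    and max_finite: "finite (local_max_points \<psi> \<gamma>\<^sub>E)"
    and max_count: "card (local_max_points \<psi> \<gamma>\<^sub>E) = N"
    and u_C2: "Ck_on 2 u \<Omega>"
    and u_cont: "continuous_on (closure \<Omega>) u"
    and u_nonconst: "\<not> u constant_on \<Omega>"
    and lam_pos: "0 < lam" and lam_le: "lam \<le> Lam"
    and elliptic: "\<And>x \<xi>. x \<in> \<Omega> \<Longrightarrow>
          lam * (norm \<xi>)\<^sup>2 \<le> (\<Sum>i\<in>UNIV. \<Sum>j\<in>UNIV. a i j (grad u x) * \<xi> $ i * \<xi> $ j) \<and>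
          (\<Sum>i\<in>UNIV. \<Sum>j\<in>UNIV. a i j (grad u x) * \<xi> $ i * \<xi> $ j) \<le> Lam * (norm \<xi>)\<^sup>2"
    and pde: "\<And>x. x \<in> \<Omega> \<Longrightarrow>
          (\<Sum>i\<in>UNIV. \<Sum>j\<in>UNIV. a i j (grad u x) * partial_deriv j (partial_deriv i u) x) = 0"
    and bdry_I: "\<And>x. x \<in> \<gamma>\<^sub>I \<Longrightarrow> u x = H"
    and bdry_E: "\<And>x. x \<in> \<gamma>\<^sub>E \<Longrightarrow> u x = \<psi> x"
  shows "finite (critical_points u \<Omega>)
       \<and> (\<forall>x\<in>critical_points u \<Omega>. \<exists>!m. has_multiplicity u \<Omega> x m)
       \<and> (\<Sum>x\<in>critical_points u \<Omega>. multiplicity_at u \<Omega> x) \<le> N"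
proof -
  interpret elliptic_solution u \<Omega> a
  proof
    show "open \<Omega>" "connected \<Omega>" using domain unfolding smooth_annular_domain_def by blast+
    show "a i j differentiable (at 0)" for i j
    proof -
      have "Ck_on (Suc 0) (a i j) UNIV" using coeff_smooth[of i j] unfolding smooth_on_def by blast
      then show ?thesis by simp
    qed
    show "0 < (\<Sum>i\<in>UNIV. \<Sum>j\<in>UNIV. a i j 0 * \<xi> $ i * \<xi> $ j)" if x: "x \<in> critical_points u \<Omega>" and \<xi>: "\<xi> \<noteq> 0" for x \<xi>
    proof -
      have "x \<in> \<Omega>" "grad u x = 0" using x by (auto simp: critical_points_def)
      then have "lam * (norm \<xi>)\<^sup>2 \<le> (\<Sum>i\<in>UNIV. \<Sum>j\<in>UNIV. a i j 0 * \<xi> $ i * \<xi> $ j)" using elliptic[of x \<xi>] by metis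
      moreover have "0 < lam * (norm \<xi>)\<^sup>2" using lam_pos \<xi> by simp
      ultimately show ?thesis by linarith
    qed
  qed (use u_C2 u_nonconst pde in blast)+
  let ?C = "critical_points u \<Omega>"
  obtain n L where nf: "\<And>x. x \<in> ?C \<Longrightarrow> saddle_normal_form u \<Omega> x (n x) (L x)"
    using critical_normal_form by metis
  have mult: "has_multiplicity u \<Omega> x (n x - 1)" if "x \<in> ?C" for x by (rule saddle_has_multiplicity[OF nf[OF that]])
  have ex1: "\<exists>!m. has_multiplicity u \<Omega> x m" if "x \<in> ?C" for x using mult[OF that] has_multiplicity_unique by blast
  have mult_at: "multiplicity_at u \<Omega> x = n x - 1" if "x \<in> ?C" for x
    unfolding multiplicity_at_def by (rule the1_equality[OF ex1[OF that] mult[OF that]])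
  \<comment> \<open>Local maximality refers only to values on the outer curve, where
    \<open>u\<close> and \<open>\<psi>\<close> agree.\<close>
  have \<psi>_u: "local_max_points u \<gamma>\<^sub>E = local_max_points \<psi> \<gamma>\<^sub>E"
  proof -
    have "(\<forall>\<^sub>F y in at p within \<gamma>\<^sub>E. u y \<le> u p) \<longleftrightarrow> (\<forall>\<^sub>F y in at p within \<gamma>\<^sub>E. \<psi> y \<le> \<psi> p)" if "p \<in> \<gamma>\<^sub>E" for p
      using that bdry_E by (intro eventually_cong[OF eventually_at_topological[THEN iffD2]]) (auto simp: eventually_at_filter)
    then show ?thesis unfolding local_max_points_def by blast
  qed
  have bound: "(\<Sum>x\<in>F. n x - 1) \<le> N" if "finite F" "F \<subseteq> ?C" for F
    unfolding max_count[symmetric] \<psi>_u[symmetric]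
  proof (rule sum_saddle_orders_le[OF domain u_cont bdry_I _ that])
    show "finite (local_max_points u \<gamma>\<^sub>E)" using max_finite \<psi>_u by simp
  qed (use nf that in auto)
  have "1 \<le> n x - 1" if "x \<in> ?C" for x using nf[OF that] unfolding saddle_normal_form_def by linarith
  \<comment> \<open>The bound for all finite sets of critical points, each with a term at least 1,
    caps their cardinality by N and so gives finiteness.\<close>
  then have fin: "finite ?C" using finite_of_sum_le[of ?C "\<lambda>x. n x - 1" N] bound by blast
  have "(\<Sum>x\<in>?C. multiplicity_at u \<Omega> x) = (\<Sum>x\<in>?C. n x - 1)" using mult_at by (rule sum.cong[OF refl])
  also have "\<dots> \<le> N" by (rule bound[OF fin order_refl])
  finally show ?thesis using fin ex1 by blast
qed

end
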